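(* Let $\alpha_1\approx 0.24760367$ be the root in $[0,1]$ of $16\alpha^4+16\alpha^3-52\alpha^2+48\alpha-9=0$, and let $\alpha_2\approx 0.2797707433$ be the root in $[0,1]$ of $8\alpha^4-8\alpha^3+8\alpha^2=1/2$. For every $\alpha\in[\alpha_1,\alpha_2]$, the map $G_\alpha$ admits an absolutely continuous invariant probability measure (with respect to two-dimensional Lebesgue measure on $[0,1]^2$).
   Context: Let $\tau:[0,1]\to[0,1]$ be the symmetric tent map, $\tau(x)=2x$ for $0\le x<1/2$ and $\tau(x)=2-2x$ for $1/2\le x\le 1$. For $0<\alpha<1$ define $G_\alpha:[0,1]^2\to[0,1]^2$ by $G_\alpha(x,y)=(y,\tau(\alpha y+(1-\alpha)x))$. *)

theory Defs
  imports "HOL-Probability.Probability"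
begin

definition tent :: "real \<Rightarrow> real" where
  "tent x = (if x < 1/2 then 2 * x else 2 - 2 * x)"

definition G :: "real \<Rightarrow> real \<times> real \<Rightarrow> real \<times> real" where
  "G \<alpha> p = (snd p, tent (\<alpha> * snd p + (1 - \<alpha>) * fst p))"

definition unit_square :: "(real \<times> real) set" where
  "unit_square = {0..1} \<times> {0..1}"

definition leb_square :: "(real \<times> real) measure" where
  "leb_square = restrict_space lborel unit_square"

definition has_acip :: "(real \<times> real \<Rightarrow> real \<times> real) \<Rightarrow> bool" where
  "has_acip T \<longleftrightarrow> (\<exists>\<mu>. sets \<mu> = sets leb_square \<and> prob_space \<mu> \<and>
      absolutely_continuous leb_square \<mu> \<and>
      T \<in> measurable \<mu> \<mu> \<and>
      (\<forall>A \<in> sets \<mu>. emeasure \<mu> (T -` A \<inter> space \<mu>) = emeasure \<mu> A))"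

end

theory Submission
  imports Defs
begin

text \<open>
  Both branches expand area, but not every vector in every step, so the transfer operator
  \<open>P f q = bb (f (psi1 q) + f (psi2 q))\<close> does not contract the variation in one step. Variation is measured by
  difference quotients: for a piecewise constant displacement field \<open>h\<close>,
  \<open>Q\<^sub>t f h = \<integral>|f (p + t h p) - f p|\<close>, where only pairs with \<open>h (p + t h p) = h p\<close> inside \<open>{x \<le> 1, y \<le> 1}\<close> are compared.
  Then \<open>Q\<^sub>t (P f) h \<le> Q\<^sub>t f h'\<close>, where \<open>h'\<close> is the pull back of \<open>h\<close> by the derivative of the map, up to an integral of \<open>f\<close>
  over a strip of width \<open>O(t)\<close> at the right edge of the square, caused by the folding line \<open>lf (x, y) = \<alpha> y + (1 - \<alpha>) x = 1/2\<close>, whose image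
  is the top edge. Two further steps turn that strip into one along the folding line, and the mass in a strip of width
  \<open>t \<tau>\<close> along a line is at most \<open>Q\<^sub>t f g\<close> plus \<open>O(t)\<close> times the total mass, for a new field \<open>g\<close> which is transversal to
  the line, proportional to \<open>\<tau>\<close> and lives in a \<open>\<delta>\<close>-neighbourhood of the line: telescope along the chain of
  translates of the strip.

  All fields together must stay bounded. This holds because a suitable polyhedral norm, depending on the state of a finite
  automaton which records the position of the orbit relative to its last visits to the folding line, contracts by the
  factor \<open>0.999\<close> in each step, uniformly for \<open>\<alpha>\<close> in \<open>[0.2476, 0.27978]\<close>; the parameter bounds of the theorem enter here.
  Consequently the iterated densities \<open>f\<^sub>n\<close> of a Lipschitz bump satisfy \<open>\<integral>|f\<^sub>n (p + v) - f\<^sub>n p| \<le> C |v|\<close>, uniformly in \<open>n\<close>,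
  for \<open>v\<close> in the lower left quadrant. Averaging over \<open>v\<close> shows that their measures are uniformly absolutely continuous,
  and a cluster point of the Cesaro means (as set functions, by Tychonoff) is the invariant measure.
\<close>

section \<open>Functions constant on the cells of a line arrangement\<close>

text \<open>The densities jump at y = 1, the image of the folding line, and one step later at x = 1;
  the next image of the jump lies inside the square. Hence pairs across these two edges are left
  out, and the strip term of the second branch has to be followed. The sup norm of the iterated
  densities may grow. Every error in which it enters is o(t), so the inequalities hold only for t =
  2^-N with N large depending on the number n of steps, but with constants independent of n; adding
  up 2^N small shifts then gives the bound for v itself. The O(t) losses of the telescoping multiply
  the total mass, which is preserved, while the fields shrink geometrically; so the losses form a
  convergent series. They play the role of the weak norm in a Lasota-Yorke inequality. The upper
  parameter bound is where the third image of (1, 0), the point (4a^2, 8a^3 - 4a^2 + 4a), meets the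
  folding line: \<open>lf\<close> there equals 8a^4 - 8a^3 + 8a^2.\<close>

definition aff :: "real \<times> real \<times> real \<Rightarrow> real \<times> real \<Rightarrow> real" where
  "aff n p = fst n * fst p + fst (snd n) * snd p + snd (snd n)"

text \<open>Sign 0 counts as a sign, so the function is controlled at every point, also on the lines
  themselves. Such functions are closed under pointwise operations and affine pull back, which is
  all that the iteration does to fields and widths.\<close>

definition tame :: "(real \<times> real \<Rightarrow> 'b) \<Rightarrow> bool" where
  "tame h \<longleftrightarrow> (\<exists>N. finite N \<and>
     (\<forall>p q. (\<forall>n\<in>N. sgn (aff n p) = sgn (aff n q)) \<longrightarrow> h p = h q))"

lemma tame_const [simp]: "tame (\<lambda>p. k)"
  unfolding tame_def by (rule exI[of _ "{}"]) auto

lemma tame_comp2: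
  assumes "tame f" "tame g"
  shows "tame (\<lambda>p. F (f p) (g p))"
proof -
  obtain M where M: "finite M" "\<And>p q. (\<forall>n\<in>M. sgn (aff n p) = sgn (aff n q)) \<Longrightarrow> f p = f q"
    using assms(1) unfolding tame_def by blast
  obtain N where N: "finite N" "\<And>p q. (\<forall>n\<in>N. sgn (aff n p) = sgn (aff n q)) \<Longrightarrow> g p = g q"
    using assms(2) unfolding tame_def by blast
  show ?thesis unfolding tame_def
    by (rule exI[of _ "M \<union> N"]) (auto simp: M(1) N(1) intro!: arg_cong2[of _ _ _ _ F] M(2) N(2))
qed

lemma tame_comp: "tame f \<Longrightarrow> tame (\<lambda>p. F (f p))"
  using tame_comp2[of f "\<lambda>p. ()" "\<lambda>x y. F x"] by simp

lemma tame_if: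
  assumes "tame P" "tame f" "tame g"
  shows "tame (\<lambda>p. if P p then f p else g p)"
  using tame_comp2[OF assms(1) tame_comp2[OF assms(2,3), of Pair], of "\<lambda>b z. if b then fst z else snd z"]
  by (simp cong: if_cong)

lemma tame_sgn_aff: "tame (\<lambda>p. F (sgn (aff n p)))"
  unfolding tame_def by (rule exI[of _ "{n}"]) auto

lemma tame_aff_less: "tame (\<lambda>p. aff n p < 0)" and tame_aff_le: "tame (\<lambda>p. aff n p \<le> 0)"
proof -
  have "(\<lambda>p. aff n p < 0) = (\<lambda>p. sgn (aff n p) < 0)" "(\<lambda>p. aff n p \<le> 0) = (\<lambda>p. sgn (aff n p) \<le> 0)"
    by auto
  then show "tame (\<lambda>p. aff n p < 0)" "tame (\<lambda>p. aff n p \<le> 0)"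
    using tame_sgn_aff[of "\<lambda>s. s < 0" n] tame_sgn_aff[of "\<lambda>s. s \<le> 0" n] by auto
qed

lemma aff_shift: "aff n (p + r *\<^sub>R d) = aff n p + r * (fst n * fst d + fst (snd n) * snd d)"
  by (simp add: aff_def algebra_simps)

text \<open>Affine maps are described by what they do to affine forms, since this is what carries an
  arrangement back to an arrangement.\<close>

definition affmap :: "(real \<times> real \<Rightarrow> real \<times> real) \<Rightarrow> bool" where
  "affmap A \<longleftrightarrow> (\<forall>n. \<exists>m. \<forall>p. aff n (A p) = aff m p)"

lemma affmapI:
  assumes "\<And>p. A p = (a1 * fst p + b1 * snd p + c1, a2 * fst p + b2 * snd p + c2)"
  shows "affmap A"
  unfolding affmap_def
proof
  fix n :: "real \<times> real \<times> real"
  show "\<exists>m. \<forall>p. aff n (A p) = aff m p"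
    by (rule exI[of _ "(fst n * a1 + fst (snd n) * a2, fst n * b1 + fst (snd n) * b2,
          fst n * c1 + fst (snd n) * c2 + snd (snd n))"])
       (simp add: assms aff_def algebra_simps)
qed

lemma tame_affmap:
  assumes "tame h" "affmap A"
  shows "tame (\<lambda>p. h (A p))"
proof -
  obtain N where N: "finite N" "\<And>p q. (\<forall>n\<in>N. sgn (aff n p) = sgn (aff n q)) \<Longrightarrow> h p = h q"
    using assms(1) unfolding tame_def by blast
  obtain m where m: "\<And>n p. aff n (A p) = aff (m n) p"
    using assms(2) unfolding affmap_def by metis
  show ?thesis unfolding tame_def
    by (rule exI[of _ "m ` N"]) (auto simp: N(1) m intro!: N(2))
qed

lemma tame_sign_factor:
  assumes "tame h"
  shows "\<exists>N. finite N \<and> (\<forall>p q. restrict (\<lambda>n. sgn (aff n p)) N = restrict (\<lambda>n. sgn (aff n q)) N \<longrightarrow> h p = h q)"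
proof -
  obtain N where N: "finite N" "\<And>p q. (\<forall>n\<in>N. sgn (aff n p) = sgn (aff n q)) \<Longrightarrow> h p = h q"
    using assms unfolding tame_def by blast
  show ?thesis
  proof (intro exI[of _ N] conjI N(1) allI impI)
    fix p q assume "restrict (\<lambda>n. sgn (aff n p)) N = restrict (\<lambda>n. sgn (aff n q)) N"
    then show "h p = h q" by (intro N(2)) (metis restrict_apply')
  qed
qed

lemma finite_sign_vectors:
  assumes "finite N"
  shows "finite (range (\<lambda>p. restrict (\<lambda>n. sgn (aff n p)) N))"
proof (rule finite_subset)
  show "range (\<lambda>p. restrict (\<lambda>n. sgn (aff n p)) N) \<subseteq> PiE N (\<lambda>_. {-1,0,1})"
    by (simp add: sgn_real_def PiE_def image_subset_iff)
  show "finite (PiE N (\<lambda>_. {-1,0,1::real}))" using assms by (intro finite_PiE) auto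
qed

lemma tame_finite_range:
  assumes "tame h"
  shows "finite (range h)"
proof -
  obtain N where N0: "finite N \<and> (\<forall>p q. restrict (\<lambda>n. sgn (aff n p)) N = restrict (\<lambda>n. sgn (aff n q)) N \<longrightarrow> h p = h q)"
    using tame_sign_factor[OF assms] ..
  note N = N0[THEN conjunct1] N0[THEN conjunct2, THEN spec, THEN spec, THEN mp]
  define \<sigma> where "\<sigma> = (\<lambda>p. restrict (\<lambda>n. sgn (aff n p)) N)"
  have "h p = h (SOME q. \<sigma> q = \<sigma> p)" for p
  proof (rule N(2))
    have "\<sigma> (SOME q. \<sigma> q = \<sigma> p) = \<sigma> p" by (rule someI) (rule refl)
    then show "restrict (\<lambda>n. sgn (aff n p)) N = restrict (\<lambda>n. sgn (aff n (SOME q. \<sigma> q = \<sigma> p))) N"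
      unfolding \<sigma>_def by (rule sym)
  qed
  then have "range h \<subseteq> (\<lambda>s. h (SOME q. \<sigma> q = s)) ` range \<sigma>"
  proof (intro subsetI)
    fix v assume hv: "\<And>p. h p = h (SOME q. \<sigma> q = \<sigma> p)" and "v \<in> range h"
    then obtain p where "v = h p" by blast
    then have "v = h (SOME q. \<sigma> q = \<sigma> p)" using hv[of p] by (rule trans)
    then show "v \<in> (\<lambda>s. h (SOME q. \<sigma> q = s)) ` range \<sigma>" by (intro image_eqI[of _ _ "\<sigma> p"] rangeI)
  qed
  with finite_sign_vectors[OF N(1), folded \<sigma>_def] show ?thesis
    by (rule finite_surj)
qed

lemma borel_aff [measurable]: "aff n \<in> borel_measurable borel"
  unfolding aff_def by (intro borel_measurable_continuous_onI continuous_intros)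

lemma tame_measurable:
  assumes "tame h"
  shows "h \<in> measurable borel (count_space UNIV)"
proof -
  obtain N where N0: "finite N \<and> (\<forall>p q. restrict (\<lambda>n. sgn (aff n p)) N = restrict (\<lambda>n. sgn (aff n q)) N \<longrightarrow> h p = h q)"
    using tame_sign_factor[OF assms] ..
  note N = N0[THEN conjunct1] N0[THEN conjunct2, THEN spec, THEN spec, THEN mp]
  define \<sigma> where "\<sigma> = (\<lambda>p. restrict (\<lambda>n. sgn (aff n p)) N)"
  have "h -` A \<in> sets borel" for A
  proof -
    have eq: "h -` A = (\<Union>s\<in>\<sigma> ` (h -` A). \<Inter>n\<in>N. {p. sgn (aff n p) = s n})" (is "_ = ?R")
    proof (rule set_eqI, rule iffI)
      fix p assume "p \<in> h -` A"
      then show "p \<in> ?R" by (auto simp: \<sigma>_def)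
    next
      fix p assume "p \<in> ?R"
      then obtain q where q: "h q \<in> A" "\<forall>n\<in>N. sgn (aff n p) = \<sigma> q n" by auto
      then have "restrict (\<lambda>n. sgn (aff n p)) N = restrict (\<lambda>n. sgn (aff n q)) N"
        by (intro restrict_ext) (simp add: \<sigma>_def)
      then have "h p = h q" by (rule N(2))
      then show "p \<in> h -` A" using q(1) by simp
    qed
    have fin: "finite (\<sigma> ` (h -` A))" using finite_sign_vectors[OF N(1)] unfolding \<sigma>_def
      by (rule finite_subset[rotated]) auto
    have m: "{p. sgn (aff n p) = v} \<in> sets borel" for n v
    proof -
      have "{x::real. sgn x = v} \<in> sets borel"
      proof -
        have "{x::real. sgn x = v} = (if v = 1 then {0<..} else if v = -1 then {..<0} else if v = 0 then {0} else {})"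
          by (auto simp: sgn_real_def)
        then show ?thesis by simp
      qed
      from measurable_sets[OF borel_aff this, of n] show ?thesis by (simp add: vimage_def)
    qed
    have "(\<Inter>n\<in>N. {p. sgn (aff n p) = s n}) \<in> sets borel" for s
    proof (cases "N = {}")
      case False
      then show ?thesis by (intro sets.finite_INT N(1) m)
    qed simp
    then have "(\<Union>s\<in>\<sigma> ` (h -` A). \<Inter>n\<in>N. {p. sgn (aff n p) = s n}) \<in> sets borel"
      by (intro sets.finite_UN fin)
    then show ?thesis by (subst eq)
  qed
  then show ?thesis by (auto simp: measurable_def)
qed

lemma tame_borel:
  assumes "tame h"
  shows "h \<in> measurable borel borel"
  using measurable_compose[OF tame_measurable[OF assms], of "\<lambda>x. x" borel] by simp

definition side_val :: "(real \<times> real \<Rightarrow> 'b) \<Rightarrow> real \<times> real \<Rightarrow> real \<times> real \<Rightarrow> 'b" where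
  "side_val h d p = (THE v. eventually (\<lambda>r. h (p + r *\<^sub>R d) = v) (at_right (0::real)))"

lemma sgn_aff_eventually:
  "eventually (\<lambda>r. sgn (aff n (p + r *\<^sub>R d)) =
     (if aff n p = 0 then sgn (fst n * fst d + fst (snd n) * snd d) else sgn (aff n p))) (at_right 0)"
proof (cases "aff n p = 0")
  case True
  show ?thesis
    by (rule eventually_mono[OF eventually_at_right_less[of 0]]) (simp add: True aff_shift sgn_mult)
next
  case False
  have "((\<lambda>r. aff n (p + r *\<^sub>R d)) \<longlongrightarrow> aff n p) (at_right 0)"
    unfolding aff_shift by (auto intro!: tendsto_eq_intros)
  then have "eventually (\<lambda>r. dist (aff n (p + r *\<^sub>R d)) (aff n p) < \<bar>aff n p\<bar>) (at_right 0)"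
    using False by (intro tendstoD) auto
  then show ?thesis
    by eventually_elim (use False in \<open>auto simp: dist_real_def sgn_if\<close>)
qed

text \<open>For small r > 0 the sign of a form at p + r d is its sign at p, or the sign of its slope
  along d if it vanishes at p. So the side value depends only on the sign vector at p, for the same
  arrangement.\<close>

lemma tame_side_val:
  assumes "tame h"
  shows side_val: "eventually (\<lambda>r. h (p + r *\<^sub>R d) = side_val h d p) (at_right 0)"
    and tame_side: "tame (side_val h d)"
proof -
  obtain N where N: "finite N" "\<And>p q. (\<forall>n\<in>N. sgn (aff n p) = sgn (aff n q)) \<Longrightarrow> h p = h q"
    using assms unfolding tame_def by blast
  define E where "E = (\<lambda>n p. if aff n p = 0 then sgn (fst n * fst d + fst (snd n) * snd d) else sgn (aff n p))"
  have ev: "eventually (\<lambda>r. \<forall>n\<in>N. sgn (aff n (p + r *\<^sub>R d)) = E n p) (at_right 0)" for p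
    unfolding E_def by (intro eventually_ball_finite N(1) ballI sgn_aff_eventually)
  have ex: "\<exists>v. eventually (\<lambda>r. h (p + r *\<^sub>R d) = v) (at_right 0)" for p
  proof -
    obtain r0 where r0: "\<forall>n\<in>N. sgn (aff n (p + r0 *\<^sub>R d)) = E n p"
      using eventually_happens'[OF _ ev[of p]] by auto
    show ?thesis
      by (rule exI[of _ "h (p + r0 *\<^sub>R d)"], rule eventually_mono[OF ev[of p]], rule N(2)) (use r0 in simp)
  qed
  have un: "v = w" if "eventually (\<lambda>r. h (p + r *\<^sub>R d) = v) (at_right 0)"
      "eventually (\<lambda>r. h (p + r *\<^sub>R d) = w) (at_right (0::real))" for p v w
    using eventually_happens'[OF _ eventually_conj[OF that]] by auto
  have sv: "eventually (\<lambda>r. h (p + r *\<^sub>R d) = side_val h d p) (at_right 0)" for p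
    unfolding side_val_def by (rule theI', rule ex_ex1I, rule ex, rule un)
  then show "eventually (\<lambda>r. h (p + r *\<^sub>R d) = side_val h d p) (at_right 0)" .
  have "side_val h d p = side_val h d q" if agree: "\<forall>n\<in>N. sgn (aff n p) = sgn (aff n q)" for p q
  proof -
    have E_eq: "E n p = E n q" if "n \<in> N" for n
    proof -
      have s: "sgn (aff n p) = sgn (aff n q)" using agree that by blast
      then have "aff n p = 0 \<longleftrightarrow> aff n q = 0" using sgn_zero_iff[of "aff n p"] sgn_zero_iff[of "aff n q"] by simp
      then show ?thesis unfolding E_def by (simp add: s)
    qed
    have "eventually (\<lambda>r. h (q + r *\<^sub>R d) = h (p + r *\<^sub>R d)) (at_right 0)"
    proof (rule eventually_mono[OF eventually_conj[OF ev[of p] ev[of q]]])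
      fix r assume r: "(\<forall>n\<in>N. sgn (aff n (p + r *\<^sub>R d)) = E n p) \<and> (\<forall>n\<in>N. sgn (aff n (q + r *\<^sub>R d)) = E n q)"
      show "h (q + r *\<^sub>R d) = h (p + r *\<^sub>R d)"
        by (rule N(2)) (use r E_eq in simp)
    qed
    from eventually_happens'[OF _ eventually_conj[OF this eventually_conj[OF sv[of p] sv[of q]]]]
    show ?thesis by auto
  qed
  then show "tame (side_val h d)" unfolding tame_def using N(1) by blast
qed

section \<open>Difference quotients along displacement fields\<close>

lemma nn_integral_translate:
  fixes F :: "'a::euclidean_space \<Rightarrow> ennreal"
  assumes [measurable]: "F \<in> borel_measurable borel"
  shows "(\<integral>\<^sup>+p. F (p + v) \<partial>lborel) = (\<integral>\<^sup>+p. F p \<partial>lborel)"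
proof -
  have "(\<integral>\<^sup>+p. F p \<partial>lborel) = (\<integral>\<^sup>+p. F p \<partial>distr lborel borel ((+) v))"
    by (simp add: lborel_distr_plus)
  also have "\<dots> = (\<integral>\<^sup>+p. F (v + p) \<partial>lborel)"
    by (subst nn_integral_distr) auto
  finally show ?thesis by (simp add: add.commute)
qed

definition square :: "(real \<times> real) set" where "square = {0..1} \<times> {0..1}"

text \<open>Requiring \<open>h\<close> to agree at both ends makes the shift a translation on each
  of the finitely many value classes, so it can be undone by a change of variables.\<close>

definition Qt :: "real \<Rightarrow> (real \<times> real \<Rightarrow> real) \<Rightarrow> (real \<times> real \<Rightarrow> real \<times> real) \<Rightarrow> ennreal" where
  "Qt t f h = (\<integral>\<^sup>+p. indicator {p. fst p \<le> 1 \<and> snd p \<le> 1 \<and> fst (p + t *\<^sub>R h p) \<le> 1 \<and>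
      snd (p + t *\<^sub>R h p) \<le> 1 \<and> h (p + t *\<^sub>R h p) = h p} p * ennreal \<bar>f (p + t *\<^sub>R h p) - f p\<bar> \<partial>lborel)"

section \<open>Strips along a line and chains of translates\<close>

definition base :: "real \<times> real \<times> real \<Rightarrow> real \<times> real \<Rightarrow> real \<times> real \<Rightarrow> real \<times> real" where
  "base n d p = p - aff n p *\<^sub>R d"

definition unit_dir :: "real \<times> real \<times> real \<Rightarrow> real \<times> real \<Rightarrow> bool" where
  "unit_dir n d \<longleftrightarrow> fst n * fst d + fst (snd n) * snd d = 1"

lemma aff_unit: "unit_dir n d \<Longrightarrow> aff n (p + r *\<^sub>R d) = aff n p + r"
  by (simp add: aff_shift unit_dir_def)

lemma base_shift: "unit_dir n d \<Longrightarrow> base n d (p + r *\<^sub>R d) = base n d p"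
  by (simp add: base_def aff_unit algebra_simps)

lemma affmap_base: "affmap (base n d)"
  by (rule affmapI[of _ "1 - fst n * fst d" "- fst (snd n) * fst d" "- snd (snd n) * fst d"
        "- fst n * snd d" "1 - fst (snd n) * snd d" "- snd (snd n) * snd d"])
     (simp add: base_def aff_def prod_eq_iff algebra_simps)

lemma base_measurable [measurable]: "base n d \<in> measurable borel borel"
  unfolding base_def by measurable

lemma chain_step_sum:
  fixes a x :: real
  assumes "0 < a"
  shows "(\<Sum>j<k. indicator {real j * a <.. real (Suc j) * a} x :: ennreal) = indicator {0<.. real k * a} x"
proof (induction k)
  case (Suc k)
  have "0 \<le> real k * a" "real k * a \<le> real (Suc k) * a" using assms by (auto simp: algebra_simps)
  then show ?case unfolding sum.lessThan_Suc Suc by (auto simp: indicator_def)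
qed simp

text \<open>Consecutive strips of width a are translates of each other by a d, so passing from one
  to the next costs one difference integral. The first strip is therefore bounded by each of the k
  strips plus all difference integrals together; these k bounds are added.\<close>

lemma chain_single:
  assumes f [measurable]: "f \<in> borel_measurable borel" and f0: "\<And>p. 0 \<le> f p"
    and S [measurable]: "S \<in> sets borel" and inv: "\<And>p r. p + r *\<^sub>R d \<in> S \<longleftrightarrow> p \<in> S"
    and u: "unit_dir n d" and a: "0 < a"
  shows "of_nat k * (\<integral>\<^sup>+p. ennreal (f p) * (indicator S p * indicator {0<..a} (aff n p)) \<partial>lborel)
     \<le> (\<integral>\<^sup>+p. ennreal (f p) * (indicator S p * indicator {0<..real k * a} (aff n p)) \<partial>lborel)
       + of_nat k * (\<integral>\<^sup>+p. ennreal \<bar>f (p + a *\<^sub>R d) - f p\<bar> * (indicator S p * indicator {0<..real k * a} (aff n p)) \<partial>lborel)"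
proof -
  define J where "J j = {real j * a <.. real (Suc j) * a}" for j :: nat
  define A where "A j = (\<integral>\<^sup>+p. ennreal (f p) * (indicator S p * indicator (J j) (aff n p)) \<partial>lborel)" for j
  define I where "I j = (\<integral>\<^sup>+p. ennreal \<bar>f (p + a *\<^sub>R d) - f p\<bar> * (indicator S p * indicator (J j) (aff n p)) \<partial>lborel)" for j
  have [measurable]: "J j \<in> sets borel" for j by (simp add: J_def)
  have step: "A j \<le> A (Suc j) + I j" for j
  proof -
    have "A (Suc j) = (\<integral>\<^sup>+p. ennreal (f (p + a *\<^sub>R d)) * (indicator S (p + a *\<^sub>R d) * indicator (J (Suc j)) (aff n (p + a *\<^sub>R d))) \<partial>lborel)"
      unfolding A_def by (subst nn_integral_translate) auto
    also have "\<dots> = (\<integral>\<^sup>+p. ennreal (f (p + a *\<^sub>R d)) * (indicator S p * indicator (J j) (aff n p)) \<partial>lborel)"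
      by (intro nn_integral_cong) (auto simp: aff_unit[OF u] inv indicator_def J_def algebra_simps)
    finally have A': "A (Suc j) = \<dots>" .
    have "A j \<le> (\<integral>\<^sup>+p. ennreal (f (p + a *\<^sub>R d)) * (indicator S p * indicator (J j) (aff n p))
        + ennreal \<bar>f (p + a *\<^sub>R d) - f p\<bar> * (indicator S p * indicator (J j) (aff n p)) \<partial>lborel)"
      unfolding A_def
    proof (intro nn_integral_mono)
      fix p
      have "ennreal (f p) \<le> ennreal (f (p + a *\<^sub>R d)) + ennreal \<bar>f (p + a *\<^sub>R d) - f p\<bar>"
      proof -
        have "f p \<le> f (p + a *\<^sub>R d) + \<bar>f (p + a *\<^sub>R d) - f p\<bar>" by linarith
        then show ?thesis
          unfolding ennreal_plus[OF f0[of "p + a *\<^sub>R d"] abs_ge_zero, symmetric] by (rule ennreal_leI)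
      qed
      then show "ennreal (f p) * (indicator S p * indicator (J j) (aff n p)) \<le> ennreal (f (p + a *\<^sub>R d)) * (indicator S p * indicator (J j) (aff n p))
        + ennreal \<bar>f (p + a *\<^sub>R d) - f p\<bar> * (indicator S p * indicator (J j) (aff n p))"
        by (auto simp: indicator_def)
    qed
    also have "\<dots> = A (Suc j) + I j"
      unfolding A' I_def by (rule nn_integral_add) auto
    finally show ?thesis .
  qed
  have A0: "A 0 \<le> A j + (\<Sum>i<j. I i)" for j
  proof (induction j)
    case (Suc j)
    have "A j + (\<Sum>i<j. I i) \<le> A (Suc j) + I j + (\<Sum>i<j. I i)" by (intro add_right_mono step)
    also have "\<dots> = A (Suc j) + (\<Sum>i<Suc j. I i)" by (simp add: ac_simps)
    finally show ?case by (rule order_trans[OF Suc])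
  qed simp
  have "of_nat k * A 0 = (\<Sum>j<k. A 0)" by simp
  also have "\<dots> \<le> (\<Sum>j<k. A j + (\<Sum>i<k. I i))"
  proof (intro sum_mono)
    fix j assume "j \<in> {..<k}"
    then have "(\<Sum>i<j. I i) \<le> (\<Sum>i<k. I i)" by (intro sum_mono2) auto
    then show "A 0 \<le> A j + (\<Sum>i<k. I i)" by (rule order_trans[OF A0 add_left_mono])
  qed
  also have "\<dots> = (\<Sum>j<k. A j) + of_nat k * (\<Sum>i<k. I i)" by (simp add: sum.distrib)
  also have "(\<Sum>j<k. A j) = (\<integral>\<^sup>+p. (\<Sum>j<k. ennreal (f p) * (indicator S p * indicator (J j) (aff n p))) \<partial>lborel)"
    unfolding A_def by (intro nn_integral_sum[symmetric]) auto
  also have "\<dots> = (\<integral>\<^sup>+p. ennreal (f p) * (indicator S p * indicator {0<..real k * a} (aff n p)) \<partial>lborel)"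
    unfolding sum_distrib_left[symmetric] J_def chain_step_sum[OF a] ..
  also have "(\<Sum>i<k. I i) = (\<integral>\<^sup>+p. (\<Sum>i<k. ennreal \<bar>f (p + a *\<^sub>R d) - f p\<bar> * (indicator S p * indicator (J i) (aff n p))) \<partial>lborel)"
    unfolding I_def by (intro nn_integral_sum[symmetric]) auto
  also have "\<dots> = (\<integral>\<^sup>+p. ennreal \<bar>f (p + a *\<^sub>R d) - f p\<bar> * (indicator S p * indicator {0<..real k * a} (aff n p)) \<partial>lborel)"
    unfolding sum_distrib_left[symmetric] J_def chain_step_sum[OF a] ..
  finally show ?thesis unfolding A_def J_def by simp
qed

text \<open>The bound at 0 is strict: on the folding line it gives x < \<open>bb\<close>, and it
  leaves room for a small step downwards from the base.\<close>

definition good_base :: "real \<times> real \<times> real \<Rightarrow> real \<times> real \<Rightarrow> real \<times> real \<Rightarrow> bool" where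
  "good_base n d p \<longleftrightarrow> 0 < snd (base n d p) \<and> snd (base n d p) \<le> 1"

lemma good_base_shift: "unit_dir n d \<Longrightarrow> good_base n d (p + r *\<^sub>R d) = good_base n d p"
  by (simp add: good_base_def base_shift)

lemma good_base_measurable [measurable]: "Measurable.pred borel (good_base n d)"
proof -
  have [measurable]: "(\<lambda>p. snd (base n d p)) \<in> borel_measurable borel"
    unfolding base_def aff_def by (intro borel_measurable_continuous_onI continuous_intros)
  show ?thesis unfolding good_base_def by measurable
qed

text \<open>The field that controls the mass in a strip of width \<open>m \<sigma>\<close> along the line \<open>aff n = 0\<close>. It is constant in the direction
  \<open>d\<close>, and points whose base on the line lies outside the range of the second coordinate are left out.\<close>

definition ghost :: "real \<Rightarrow> real \<Rightarrow> real \<times> real \<times> real \<Rightarrow> real \<times> real \<Rightarrow> (real \<times> real \<Rightarrow> real) \<Rightarrow> real \<times> real \<Rightarrow> real \<times> real" where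
  "ghost \<delta> m n d \<sigma> p = (if 0 < aff n p \<and> aff n p < \<delta> \<and> good_base n d p
     then (m * side_val \<sigma> d (base n d p)) *\<^sub>R d else 0)"

text \<open>This is \<open>chain_single\<close> divided by k, with the longest chain that stays
  within half of the neighbourhood.\<close>

lemma chain_value:
  assumes f [measurable]: "f \<in> borel_measurable borel" and f0: "\<And>p. 0 \<le> f p"
    and [measurable]: "S \<in> sets borel" and inv: "\<And>p r. p + r *\<^sub>R d \<in> S \<longleftrightarrow> p \<in> S"
    and u: "unit_dir n d" and a: "0 \<le> a" "4 * a \<le> \<delta>" and \<delta>: "0 < \<delta>"
  shows "(\<integral>\<^sup>+p. ennreal (f p) * (indicator S p * indicator {0<..a} (aff n p)) \<partial>lborel)
     \<le> (\<integral>\<^sup>+p. ennreal (4 * a / \<delta> * f p) * (indicator S p * indicator {0<..<\<delta>} (aff n p)) \<partial>lborel)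
       + (\<integral>\<^sup>+p. ennreal \<bar>f (p + a *\<^sub>R d) - f p\<bar> * (indicator S p * indicator {0<..\<delta>/2} (aff n p)) \<partial>lborel)"
proof (cases "a = 0")
  case False
  then have a0: "0 < a" using a by simp
  \<comment> \<open>Length at most \<open>\<delta>/2\<close> leaves room for one more shift inside
    the neighbourhood. Since \<open>\<delta>/(2 * a)\<close> is at least 2, rounding down costs at
    most a factor 2, whence the constant 4.\<close>
  define k where "k = nat \<lfloor>\<delta> / (2 * a)\<rfloor>"
  have x: "2 \<le> \<delta> / (2 * a)" using a a0 by (simp add: field_simps)
  have k1: "real k \<le> \<delta> / (2 * a)" "\<delta> / (2 * a) - 1 \<le> real k"
    using x unfolding k_def by linarith+
  have ka: "real k * a \<le> \<delta> / 2" using k1(1) a0 by (simp add: field_simps)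
  have k2: "\<delta> / (4 * a) \<le> real k" using k1(2) x by (simp add: field_simps)
  have k0: "0 < real k" using k1(2) x by linarith
  have ik: "1 / real k \<le> 4 * a / \<delta>" using k2 a0 k0 \<delta> by (simp add: field_simps)
  let ?A = "(\<integral>\<^sup>+p. ennreal (f p) * (indicator S p * indicator {0<..a} (aff n p)) \<partial>lborel)"
  let ?B = "(\<integral>\<^sup>+p. ennreal (f p) * (indicator S p * indicator {0<..real k * a} (aff n p)) \<partial>lborel)"
  let ?I = "(\<integral>\<^sup>+p. ennreal \<bar>f (p + a *\<^sub>R d) - f p\<bar> * (indicator S p * indicator {0<..real k * a} (aff n p)) \<partial>lborel)"
  have e: "ennreal (1 / real k) * of_nat k = 1"
    using k0 by (simp add: ennreal_of_nat_eq_real_of_nat ennreal_mult[symmetric] flip: ennreal_1)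
  have "?A = ennreal (1 / real k) * of_nat k * ?A" unfolding e by simp
  also have "\<dots> = ennreal (1 / real k) * (of_nat k * ?A)" by (simp add: mult.assoc)
  also have "\<dots> \<le> ennreal (1 / real k) * (?B + of_nat k * ?I)"
    by (intro mult_left_mono chain_single[OF f f0 _ inv u a0]) auto
  also have "\<dots> = ennreal (1 / real k) * ?B + ennreal (1 / real k) * of_nat k * ?I"
    by (simp add: distrib_left mult.assoc)
  also have "\<dots> = ennreal (1 / real k) * ?B + ?I" unfolding e by simp
  also have "\<dots> \<le> (\<integral>\<^sup>+p. ennreal (4 * a / \<delta> * f p) * (indicator S p * indicator {0<..<\<delta>} (aff n p)) \<partial>lborel)
       + (\<integral>\<^sup>+p. ennreal \<bar>f (p + a *\<^sub>R d) - f p\<bar> * (indicator S p * indicator {0<..\<delta>/2} (aff n p)) \<partial>lborel)"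
  proof (intro add_mono)
    have "ennreal (1 / real k) * ?B = (\<integral>\<^sup>+p. ennreal (1 / real k) * (ennreal (f p) * (indicator S p * indicator {0<..real k * a} (aff n p))) \<partial>lborel)"
      by (rule nn_integral_cmult[symmetric]) auto
    also have "\<dots> \<le> (\<integral>\<^sup>+p. ennreal (4 * a / \<delta> * f p) * (indicator S p * indicator {0<..<\<delta>} (aff n p)) \<partial>lborel)"
    proof (intro nn_integral_mono)
      fix p
      have "ennreal (1 / real k) * ennreal (f p) \<le> ennreal (4 * a / \<delta> * f p)"
      proof -
        have "1 / real k * f p \<le> 4 * a / \<delta> * f p" by (rule mult_right_mono[OF ik f0])
        from ennreal_leI[OF this] show ?thesis
          using f0[of p] k0 ennreal_mult[of "1 / real k" "f p"] by simp
      qed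
      moreover have "aff n p < \<delta>" if "aff n p \<le> real k * a" using ka \<delta> that by linarith
      ultimately show "ennreal (1 / real k) * (ennreal (f p) * (indicator S p * indicator {0<..real k * a} (aff n p)))
        \<le> ennreal (4 * a / \<delta> * f p) * (indicator S p * indicator {0<..<\<delta>} (aff n p))"
        by (auto simp: indicator_def)
    qed
    finally show "ennreal (1 / real k) * ?B \<le> (\<integral>\<^sup>+p. ennreal (4 * a / \<delta> * f p) * (indicator S p * indicator {0<..<\<delta>} (aff n p)) \<partial>lborel)" .
    show "?I \<le> (\<integral>\<^sup>+p. ennreal \<bar>f (p + a *\<^sub>R d) - f p\<bar> * (indicator S p * indicator {0<..\<delta>/2} (aff n p)) \<partial>lborel)"
      by (intro nn_integral_mono mult_left_mono) (use ka in \<open>auto simp: indicator_def\<close>)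
  qed
  finally show ?thesis .
qed simp

lemma sum_over_values:
  assumes "finite V" "s q \<in> V"
  shows "(\<Sum>v\<in>V. F v * (indicator {p. P p \<and> s p = v} q)) = (F (s q) * indicator {p. P p} q :: ennreal)"
proof -
  have "(\<Sum>v\<in>V. F v * (indicator {p. P p \<and> s p = v} q)) = (\<Sum>v\<in>V. if v = s q then F (s q) * indicator {p. P p} q else 0)"
    by (intro sum.cong) (auto simp: indicator_def)
  then show ?thesis using assms by simp
qed

text \<open>The width is constant along the direction d, so its level sets are unions of lines in
  that direction and invariant under the chain. On each of them the strip has constant width and
  \<open>chain_value\<close> applies; there are finitely many.\<close>

lemma ghost_main:
  assumes f [measurable]: "f \<in> borel_measurable borel" and f0: "\<And>p. 0 \<le> f p"
    and u: "unit_dir n d" and \<delta>: "0 < \<delta>" and m: "0 \<le> m"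
    and \<sigma>: "tame \<sigma>" and \<sigma>0: "\<And>p. 0 \<le> side_val \<sigma> d p" and t: "0 < t" "\<And>p. 4 * (t * (m * side_val \<sigma> d p)) \<le> \<delta>"
    and chainQ: "\<And>p. 0 < aff n p \<Longrightarrow> aff n p < \<delta> \<Longrightarrow> good_base n d p \<Longrightarrow> fst p \<le> 1 \<and> snd p \<le> 1"
  shows "(\<integral>\<^sup>+p. ennreal (f p) * indicator {p. 0 < aff n p \<and> aff n p \<le> t * (m * side_val \<sigma> d (base n d p)) \<and> good_base n d p} p \<partial>lborel)
    \<le> Qt t f (ghost \<delta> m n d \<sigma>)
      + (\<integral>\<^sup>+p. ennreal (4 * t / \<delta> * (m * side_val \<sigma> d (base n d p)) * f p) * indicator {p. 0 < aff n p \<and> aff n p < \<delta> \<and> good_base n d p} p \<partial>lborel)"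
proof -
  define s where "s p = side_val \<sigma> d (base n d p)" for p
  have ts: "tame s" unfolding s_def by (intro tame_affmap[OF tame_side[OF \<sigma>]] affmap_base)
  have s_shift: "s (p + r *\<^sub>R d) = s p" for p r by (simp add: s_def base_shift[OF u])
  note s_meas = tame_measurable[OF ts] tame_borel[OF ts]
  have [measurable]: "s \<in> borel_measurable borel" by (rule s_meas)
  define V where "V = range s"
  have fV: "finite V" unfolding V_def by (rule tame_finite_range[OF ts])
  define S where "S v = {p. good_base n d p \<and> s p = v}" for v
  have [measurable]: "S v \<in> sets borel" for v unfolding S_def by measurable
  have inv: "p + r *\<^sub>R d \<in> S v \<longleftrightarrow> p \<in> S v" for p r v by (simp add: S_def s_shift good_base_shift[OF u])
  have v0: "0 \<le> v" and tv: "4 * (t * (m * v)) \<le> \<delta>" if "v \<in> V" for v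
  proof -
    obtain p where "v = side_val \<sigma> d (base n d p)" using \<open>v \<in> V\<close> unfolding V_def s_def by (rule imageE)
    then show "0 \<le> v" "4 * (t * (m * v)) \<le> \<delta>"
      using \<sigma>0[of "base n d p"] t(2)[of "base n d p"] by simp_all
  qed
  have split: "(\<Sum>v\<in>V. F v * indicator (S v) p) = (F (s p) * indicator {p. good_base n d p} p :: ennreal)" for F p
    unfolding S_def by (rule sum_over_values[OF fV]) (auto simp: V_def)
  let ?L = "\<lambda>v p. ennreal (f p) * (indicator (S v) p * indicator {0<..t * (m * v)} (aff n p))"
  let ?M = "\<lambda>v p. ennreal (4 * (t * (m * v)) / \<delta> * f p) * (indicator (S v) p * indicator {0<..<\<delta>} (aff n p))"
  let ?I = "\<lambda>v p. ennreal \<bar>f (p + (t * (m * v)) *\<^sub>R d) - f p\<bar> * (indicator (S v) p * indicator {0<..\<delta>/2} (aff n p))"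
  have "(\<integral>\<^sup>+p. ennreal (f p) * indicator {p. 0 < aff n p \<and> aff n p \<le> t * (m * side_val \<sigma> d (base n d p)) \<and> good_base n d p} p \<partial>lborel)
     = (\<integral>\<^sup>+p. (\<Sum>v\<in>V. ?L v p) \<partial>lborel)"
  proof (intro nn_integral_cong)
    fix p
    have "(\<Sum>v\<in>V. ?L v p) = (\<Sum>v\<in>V. (ennreal (f p) * indicator {0<..t * (m * v)} (aff n p)) * indicator (S v) p)"
      by (intro sum.cong) (auto simp: ac_simps)
    also have "\<dots> = ennreal (f p) * indicator {0<..t * (m * s p)} (aff n p) * indicator {p. good_base n d p} p"
      by (rule split)
    finally show "ennreal (f p) * indicator {p. 0 < aff n p \<and> aff n p \<le> t * (m * side_val \<sigma> d (base n d p)) \<and> good_base n d p} p = (\<Sum>v\<in>V. ?L v p)"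
      by (auto simp: indicator_def s_def)
  qed
  also have "\<dots> = (\<Sum>v\<in>V. \<integral>\<^sup>+p. ?L v p \<partial>lborel)" by (intro nn_integral_sum) auto
  also have "\<dots> \<le> (\<Sum>v\<in>V. (\<integral>\<^sup>+p. ?M v p \<partial>lborel) + (\<integral>\<^sup>+p. ?I v p \<partial>lborel))"
  proof (intro sum_mono)
    fix v assume v: "v \<in> V"
    show "(\<integral>\<^sup>+p. ?L v p \<partial>lborel) \<le> (\<integral>\<^sup>+p. ?M v p \<partial>lborel) + (\<integral>\<^sup>+p. ?I v p \<partial>lborel)"
      by (rule chain_value[OF f f0 _ inv u _ tv[OF v] \<delta>]) (use t(1) m v0[OF v] in auto)
  qed
  also have "\<dots> = (\<integral>\<^sup>+p. (\<Sum>v\<in>V. ?I v p) \<partial>lborel) + (\<integral>\<^sup>+p. (\<Sum>v\<in>V. ?M v p) \<partial>lborel)"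
    by (simp add: sum.distrib nn_integral_sum add.commute)
  also have "\<dots> \<le> Qt t f (ghost \<delta> m n d \<sigma>) + (\<integral>\<^sup>+p. ennreal (4 * t / \<delta> * (m * side_val \<sigma> d (base n d p)) * f p) * indicator {p. 0 < aff n p \<and> aff n p < \<delta> \<and> good_base n d p} p \<partial>lborel)"
  proof (intro add_mono)
    show "(\<integral>\<^sup>+p. (\<Sum>v\<in>V. ?M v p) \<partial>lborel) \<le> (\<integral>\<^sup>+p. ennreal (4 * t / \<delta> * (m * side_val \<sigma> d (base n d p)) * f p) * indicator {p. 0 < aff n p \<and> aff n p < \<delta> \<and> good_base n d p} p \<partial>lborel)"
    proof (intro nn_integral_mono)
      fix p
      have "(\<Sum>v\<in>V. ?M v p) = (\<Sum>v\<in>V. (ennreal (4 * (t * (m * v)) / \<delta> * f p) * indicator {0<..<\<delta>} (aff n p)) * indicator (S v) p)"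
        by (intro sum.cong) (auto simp: ac_simps)
      also have "\<dots> = ennreal (4 * (t * (m * s p)) / \<delta> * f p) * indicator {0<..<\<delta>} (aff n p) * indicator {p. good_base n d p} p"
        by (rule split)
      finally show "(\<Sum>v\<in>V. ?M v p) \<le> ennreal (4 * t / \<delta> * (m * side_val \<sigma> d (base n d p)) * f p) * indicator {p. 0 < aff n p \<and> aff n p < \<delta> \<and> good_base n d p} p"
        by (auto simp: indicator_def s_def ac_simps)
    qed
    show "(\<integral>\<^sup>+p. (\<Sum>v\<in>V. ?I v p) \<partial>lborel) \<le> Qt t f (ghost \<delta> m n d \<sigma>)"
      unfolding Qt_def
    proof (intro nn_integral_mono)
      fix p
      let ?g = "ghost \<delta> m n d \<sigma>"
      have "(\<Sum>v\<in>V. ?I v p) = (\<Sum>v\<in>V. (ennreal \<bar>f (p + (t * (m * v)) *\<^sub>R d) - f p\<bar> * indicator {0<..\<delta>/2} (aff n p)) * indicator (S v) p)"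
        by (intro sum.cong) (auto simp: ac_simps)
      also have "\<dots> = ennreal \<bar>f (p + (t * (m * s p)) *\<^sub>R d) - f p\<bar> * indicator {0<..\<delta>/2} (aff n p) * indicator {p. good_base n d p} p"
        by (rule split)
      also have "\<dots> \<le> indicator {p. fst p \<le> 1 \<and> snd p \<le> 1 \<and> fst (p + t *\<^sub>R ?g p) \<le> 1 \<and>
          snd (p + t *\<^sub>R ?g p) \<le> 1 \<and> ?g (p + t *\<^sub>R ?g p) = ?g p} p * ennreal \<bar>f (p + t *\<^sub>R ?g p) - f p\<bar>"
      \<comment> \<open>A shift has length at most \<open>\<delta>/4\<close>, so a chain point
        within \<open>\<delta>/2\<close> of the line stays in the neighbourhood, where the ghost
        field has the same value at both ends. Such a pair is counted by \<open>Qt\<close>.\<close>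
      proof (cases "0 < aff n p \<and> aff n p \<le> \<delta> / 2 \<and> good_base n d p")
        case True
        have gp: "?g p = (m * s p) *\<^sub>R d" using True \<delta> by (auto simp: ghost_def s_def)
        have sh: "p + t *\<^sub>R ?g p = p + (t * (m * s p)) *\<^sub>R d" by (simp add: gp)
        have a0: "0 \<le> t * (m * s p)" using t(1) m \<sigma>0 by (simp add: s_def)
        have a1: "4 * (t * (m * s p)) \<le> \<delta>" using t(2) by (simp add: s_def)
        have af: "aff n (p + (t * (m * s p)) *\<^sub>R d) = aff n p + t * (m * s p)" by (rule aff_unit[OF u])
        have in1: "0 < aff n (p + (t * (m * s p)) *\<^sub>R d)" "aff n (p + (t * (m * s p)) *\<^sub>R d) < \<delta>"
          "good_base n d (p + (t * (m * s p)) *\<^sub>R d)"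
          using True a0 a1 \<delta> by (auto simp: af good_base_shift[OF u])
        have Q1: "fst p \<le> 1 \<and> snd p \<le> 1" using chainQ[of p] True \<delta> by auto
        have Q2: "fst (p + (t * (m * s p)) *\<^sub>R d) \<le> 1 \<and> snd (p + (t * (m * s p)) *\<^sub>R d) \<le> 1"
          using chainQ[OF in1] .
        have g2: "?g (p + (t * (m * s p)) *\<^sub>R d) = ?g p"
          unfolding gp using in1 by (simp add: ghost_def s_def base_shift[OF u])
        have mem: "p \<in> {p. fst p \<le> 1 \<and> snd p \<le> 1 \<and> fst (p + t *\<^sub>R ?g p) \<le> 1 \<and>
          snd (p + t *\<^sub>R ?g p) \<le> 1 \<and> ?g (p + t *\<^sub>R ?g p) = ?g p}"
          unfolding mem_Collect_eq sh using Q1 Q2 g2 by blast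
        show ?thesis unfolding indicator_simps(1)[OF mem] sh using True by (simp add: indicator_def)
      qed (auto simp: indicator_def)
      finally show "(\<Sum>v\<in>V. ?I v p) \<le> \<dots>" .
    qed
  qed
  finally show ?thesis .
qed

section \<open>Dyadic scales and thin layers along a line\<close>

text \<open>Dyadic, so that 2^N shifts of relative size \<open>tt N\<close> make up exactly one full
  shift.\<close>

definition tt :: "nat \<Rightarrow> real" where "tt N = (1/2) ^ N"

lemma tt_pos [simp]: "0 < tt N" by (simp add: tt_def)

lemma tt_tendsto: "tt \<longlonglongrightarrow> 0"
  unfolding tt_def by (rule LIMSEQ_realpow_zero) auto

lemma tt_at_right_mult:
  assumes "0 < r"
  shows "filterlim (\<lambda>N. tt N * r) (at_right 0) sequentially"
  by (rule tendsto_imp_filterlim_at_right) (use assms in \<open>auto intro!: tendsto_eq_intros tt_tendsto\<close>)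

lemma eventually_tt_mult_le:
  assumes "0 < e"
  shows "eventually (\<lambda>N. tt N * C \<le> e) sequentially"
proof -
  have "(\<lambda>N. tt N * C) \<longlonglongrightarrow> 0" by (auto intro!: tendsto_eq_intros tt_tendsto)
  from order_tendstoD(2)[OF this assms] show ?thesis by (auto elim: eventually_mono)
qed

text \<open>Coordinates along the lines in direction \<open>d\<close>; \<open>e u\<close> is the point of the line \<open>aff n = 0\<close>.\<close>

definition adapted :: "(real \<Rightarrow> real \<times> real) \<Rightarrow> real \<times> real \<times> real \<Rightarrow> real \<times> real \<Rightarrow> bool" where
  "adapted e n d \<longleftrightarrow> unit_dir n d \<and> continuous_on UNIV e \<and> (\<forall>u. aff n (e u) = 0) \<and>
     (\<forall>F \<in> borel_measurable borel. (\<integral>\<^sup>+p. F p \<partial>lborel) = (\<integral>\<^sup>+u. (\<integral>\<^sup>+s. F (e u + s *\<^sub>R d) \<partial>lborel) \<partial>lborel)) \<and>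
     (\<forall>u s. e u + s *\<^sub>R d \<in> square \<longrightarrow> \<bar>u\<bar> \<le> 1) \<and> finite {u. snd (e u) = 0}"

lemma adapted_base: "adapted e n d \<Longrightarrow> base n d (e u + s *\<^sub>R d) = e u"
  by (simp add: adapted_def base_shift) (simp add: base_def)

lemma square_closed: "closed square" unfolding square_def by (intro closed_Times) auto

lemma square_measurable [measurable]: "square \<in> sets borel"
  using square_closed by (rule borel_closed)

text \<open>Rescale the distance to the line by t. For fixed u and r > 0 the points
  \<open>e u + (t * r) *\<^sub>R d\<close> approach \<open>e u\<close> from the side d, so
  eventually \<open>\<sigma>\<close> has its side value there. Dominated convergence over a fixed
  box shows that the bad part of the layer has area o(t).\<close>

lemma layer_error:
  assumes ad: "adapted e n d" and \<sigma>: "tame \<sigma>" and M: "0 \<le> M" and eps: "0 < \<epsilon>"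
  shows "eventually (\<lambda>N. (\<integral>\<^sup>+p. indicator {p \<in> square. 0 \<le> aff n p \<and> aff n p < tt N * M \<and>
      \<not> (\<sigma> p = side_val \<sigma> d (base n d p) \<and> good_base n d p)} p \<partial>lborel) \<le> ennreal (tt N * \<epsilon>)) sequentially"
proof -
  define Z where "Z = {p \<in> square. \<not> (\<sigma> p = side_val \<sigma> d (base n d p) \<and> good_base n d p)}"
  define F where "F N = (\<lambda>z::real \<times> real. indicator {0..<M} (snd z) * indicator Z (e (fst z) + (tt N * snd z) *\<^sub>R d) :: ennreal)" for N
  note eprops = ad[unfolded adapted_def]
  have u: "unit_dir n d" using eprops by blast
  have [measurable]: "e \<in> borel_measurable borel" using eprops by (intro borel_measurable_continuous_onI) blast
  have tb: "tame (\<lambda>p. side_val \<sigma> d (base n d p))" by (intro tame_affmap[OF tame_side[OF \<sigma>]] affmap_base)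
  have "tame (\<lambda>p. \<sigma> p = side_val \<sigma> d (base n d p))" by (rule tame_comp2[OF \<sigma> tb])
  then have [measurable]: "Measurable.pred borel (\<lambda>p. \<sigma> p = side_val \<sigma> d (base n d p))" by (rule tame_measurable)
  have Zm [measurable]: "Z \<in> sets borel" unfolding Z_def by measurable
  have [measurable]: "F N \<in> borel_measurable (lborel \<Otimes>\<^sub>M lborel)" for N unfolding F_def by measurable
  have int: "(\<integral>\<^sup>+p. indicator {p \<in> square. 0 \<le> aff n p \<and> aff n p < tt N * M \<and>
      \<not> (\<sigma> p = side_val \<sigma> d (base n d p) \<and> good_base n d p)} p \<partial>lborel)
      = ennreal (tt N) * (\<integral>\<^sup>+z. F N z \<partial>(lborel \<Otimes>\<^sub>M lborel))" for N
  proof -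
    let ?I = "\<lambda>p. indicator Z p * indicator {0..<tt N * M} (aff n p) :: ennreal"
    have "(\<integral>\<^sup>+p. indicator {p \<in> square. 0 \<le> aff n p \<and> aff n p < tt N * M \<and>
      \<not> (\<sigma> p = side_val \<sigma> d (base n d p) \<and> good_base n d p)} p \<partial>lborel) = (\<integral>\<^sup>+p. ?I p \<partial>lborel)"
      by (intro nn_integral_cong) (auto simp: indicator_def Z_def)
    also have "\<dots> = (\<integral>\<^sup>+u. (\<integral>\<^sup>+s. ?I (e u + s *\<^sub>R d) \<partial>lborel) \<partial>lborel)"
    proof -
      have "?I \<in> borel_measurable borel" by measurable
      with eprops show ?thesis by blast
    qed
    also have "\<dots> = (\<integral>\<^sup>+u. ennreal (tt N) * (\<integral>\<^sup>+r. F N (u, r) \<partial>lborel) \<partial>lborel)"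
    proof (intro nn_integral_cong)
      fix u
      have a: "aff n (e u + s *\<^sub>R d) = s" for s using eprops by (simp add: aff_unit)
      have "(\<integral>\<^sup>+s. ?I (e u + s *\<^sub>R d) \<partial>lborel) = ennreal \<bar>tt N\<bar> * (\<integral>\<^sup>+r. ?I (e u + (0 + tt N * r) *\<^sub>R d) \<partial>lborel)"
        by (rule nn_integral_real_affine) (auto simp: less_imp_neq[symmetric])
      also have "(\<integral>\<^sup>+r. ?I (e u + (0 + tt N * r) *\<^sub>R d) \<partial>lborel) = (\<integral>\<^sup>+r. F N (u, r) \<partial>lborel)"
      proof (intro nn_integral_cong)
        fix r
        have "0 \<le> tt N * r \<longleftrightarrow> 0 \<le> r" "tt N * r < tt N * M \<longleftrightarrow> r < M" 
          using mult_le_cancel_left_pos[of "tt N" 0 r] mult_less_cancel_left_pos[of "tt N" r M] by simp_all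
        then show "?I (e u + (0 + tt N * r) *\<^sub>R d) = F N (u, r)"
          unfolding F_def a by (auto simp: indicator_def)
      qed
      finally show "(\<integral>\<^sup>+s. ?I (e u + s *\<^sub>R d) \<partial>lborel) = ennreal (tt N) * (\<integral>\<^sup>+r. F N (u, r) \<partial>lborel)"
        using tt_pos[of N] by simp
    qed
    also have "\<dots> = ennreal (tt N) * (\<integral>\<^sup>+u. (\<integral>\<^sup>+r. F N (u, r) \<partial>lborel) \<partial>lborel)"
      by (rule nn_integral_cmult) measurable
    also have "(\<integral>\<^sup>+u. (\<integral>\<^sup>+r. F N (u, r) \<partial>lborel) \<partial>lborel) = (\<integral>\<^sup>+z. F N z \<partial>(lborel \<Otimes>\<^sub>M lborel))"
      by (rule lborel.nn_integral_fst) measurable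
    finally show ?thesis .
  qed
  have "(\<lambda>N. \<integral>\<^sup>+z. F N z \<partial>(lborel \<Otimes>\<^sub>M lborel)) \<longlonglongrightarrow> (\<integral>\<^sup>+z. 0 \<partial>((lborel :: real measure) \<Otimes>\<^sub>M (lborel :: real measure)))"
  proof (rule nn_integral_dominated_convergence[where w = "indicator ({-1..1::real} \<times> {0..M})"])
    show "AE z in lborel \<Otimes>\<^sub>M lborel. F N z \<le> indicator ({-1..1::real} \<times> {0..M}) z" for N
    proof (rule AE_I2)
      fix z :: "real \<times> real"
      have "\<bar>fst z\<bar> \<le> 1" if "e (fst z) + (tt N * snd z) *\<^sub>R d \<in> square" using eprops that by blast
      then show "F N z \<le> indicator ({-1..1::real} \<times> {0..M}) z"
        by (cases z) (auto simp: F_def indicator_def Z_def)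
    qed
    have "(\<integral>\<^sup>+z. indicator ({-1..1::real} \<times> {0..M}) z \<partial>(lborel \<Otimes>\<^sub>M lborel)) = emeasure (lborel \<Otimes>\<^sub>M lborel) ({-1..1::real} \<times> {0..M})"
      by (rule nn_integral_indicator) simp
    also have "\<dots> = emeasure lborel {-1..1::real} * emeasure lborel {0..M}"
      by (rule lborel.emeasure_pair_measure_Times) auto
    also have "\<dots> < \<infinity>" using M by (simp add: ennreal_mult_less_top)
    finally show "(\<integral>\<^sup>+z. indicator ({-1..1::real} \<times> {0..M}) z \<partial>(lborel \<Otimes>\<^sub>M lborel)) < \<infinity>" .
    show "AE z in lborel \<Otimes>\<^sub>M lborel. (\<lambda>N. F N z) \<longlonglongrightarrow> 0"
    proof (rule AE_I')
      \<comment> \<open>Excluded are the lines whose base lies on y = 0, where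
        \<open>good_base\<close> fails although the base may belong to the square, and the line r =
        0 itself.\<close>
      let ?N = "({u. snd (e u) = 0} \<times> UNIV) \<union> (UNIV \<times> {0::real})"
      have fin: "finite {u. snd (e u) = 0}" using eprops by blast
      have "({u. snd (e u) = 0} \<times> (UNIV::real set)) \<in> null_sets (lborel \<Otimes>\<^sub>M lborel)"
      proof (rule null_setsI)
        show "({u. snd (e u) = 0} \<times> (UNIV::real set)) \<in> sets (lborel \<Otimes>\<^sub>M lborel)"
          using fin by (intro pair_measureI) (auto intro: borel_closed finite_imp_closed)
        show "emeasure (lborel \<Otimes>\<^sub>M lborel) ({u. snd (e u) = 0} \<times> (UNIV::real set)) = 0"
          using fin by (subst lborel.emeasure_pair_measure_Times)
            (auto simp: emeasure_lborel_countable countable_finite intro: borel_closed finite_imp_closed)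
      qed
      moreover have "((UNIV::real set) \<times> {0::real}) \<in> null_sets (lborel \<Otimes>\<^sub>M lborel)"
      proof (rule null_setsI)
        show "((UNIV::real set) \<times> {0::real}) \<in> sets (lborel \<Otimes>\<^sub>M lborel)" by measurable
        show "emeasure (lborel \<Otimes>\<^sub>M lborel) ((UNIV::real set) \<times> {0::real}) = 0"
          by (subst lborel.emeasure_pair_measure_Times) auto
      qed
      ultimately show "?N \<in> null_sets (lborel \<Otimes>\<^sub>M lborel)" by (rule null_sets.Un)
      show "{z \<in> space (lborel \<Otimes>\<^sub>M lborel). \<not> (\<lambda>N. F N z) \<longlonglongrightarrow> 0} \<subseteq> ?N"
      proof (rule subsetI, rule ccontr)
        fix z :: "real \<times> real"
        assume z: "z \<in> {z \<in> space (lborel \<Otimes>\<^sub>M lborel). \<not> (\<lambda>N. F N z) \<longlonglongrightarrow> 0}" "z \<notin> ?N"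
        obtain v r where zz: "z = (v, r)" by fastforce
        have r0: "r \<noteq> 0" and v0: "snd (e v) \<noteq> 0" using z(2) by (auto simp: zz)
        have "eventually (\<lambda>N. F N z = 0) sequentially"
        proof (cases "0 < r")
          case False
          then show ?thesis using r0 by (simp add: F_def zz indicator_def)
        next
          case True
          note fl = tt_at_right_mult[OF True]
          have bb: "base n d (e v + s *\<^sub>R d) = e v" for s by (rule adapted_base[OF ad])
          show ?thesis
          proof (cases "0 < snd (e v) \<and> snd (e v) \<le> 1")
            case True
            have "eventually (\<lambda>s. \<sigma> (e v + s *\<^sub>R d) = side_val \<sigma> d (e v)) (at_right 0)" by (rule side_val[OF \<sigma>])
            from eventually_compose_filterlim[OF this fl] show ?thesis
              by eventually_elim (use True in \<open>auto simp: F_def zz Z_def bb good_base_def indicator_def\<close>)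
          next
            case False
            then have "snd (e v) < 0 \<or> 1 < snd (e v)" using v0 by auto
            then have nsq: "e v \<notin> square" by (auto simp: square_def mem_Times_iff)
            have "((\<lambda>s. e v + s *\<^sub>R d) \<longlongrightarrow> e v + 0 *\<^sub>R d) (at_right 0)" by (intro tendsto_intros)
            from topological_tendstoD[OF this, of "- square", OF open_Compl[OF square_closed]] nsq
            have "eventually (\<lambda>s. e v + s *\<^sub>R d \<in> - square) (at_right 0)" by simp
            from eventually_compose_filterlim[OF this fl] show ?thesis
              by eventually_elim (auto simp: F_def zz Z_def indicator_def)
          qed
        qed
        then have "(\<lambda>N. F N z) \<longlonglongrightarrow> 0" by (rule tendsto_eventually)
        then show False using z(1) by simp
      qed
    qed
  qed measurable
  then have "(\<lambda>N. \<integral>\<^sup>+z. F N z \<partial>(lborel \<Otimes>\<^sub>M lborel)) \<longlonglongrightarrow> 0" by simp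
  from order_tendstoD(2)[OF this, of "ennreal \<epsilon>"] eps
  have "eventually (\<lambda>N. (\<integral>\<^sup>+z. F N z \<partial>(lborel \<Otimes>\<^sub>M lborel)) < ennreal \<epsilon>) sequentially" by simp
  then show ?thesis
  proof eventually_elim
    case (elim N)
    show ?case unfolding int ennreal_mult[OF less_imp_le[OF tt_pos] less_imp_le[OF eps]]
      by (intro mult_left_mono less_imp_le elim) simp
  qed
qed

text \<open>Change of variables for both inverse branches, with k equal to \<open>bb\<close> or
  \<open>- bb\<close>.\<close>

lemma nn_integral_swap_affine:
  fixes F :: "real \<times> real \<Rightarrow> ennreal"
  assumes [measurable]: "F \<in> borel_measurable borel" and k: "k \<noteq> 0"
  shows "(\<integral>\<^sup>+q. ennreal \<bar>k\<bar> * F (k * snd q + l * fst q + m, fst q) \<partial>lborel) = (\<integral>\<^sup>+p. F p \<partial>lborel)"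
proof -
  have "(\<integral>\<^sup>+q. ennreal \<bar>k\<bar> * F (k * snd q + l * fst q + m, fst q) \<partial>lborel)
     = (\<integral>\<^sup>+q. ennreal \<bar>k\<bar> * F (k * snd q + l * fst q + m, fst q) \<partial>(lborel \<Otimes>\<^sub>M lborel))"
    by (simp add: lborel_prod)
  also have "\<dots> = (\<integral>\<^sup>+u. (\<integral>\<^sup>+z. ennreal \<bar>k\<bar> * F (k * z + l * u + m, u) \<partial>lborel) \<partial>lborel)"
  proof -
    have "(\<lambda>q. ennreal \<bar>k\<bar> * F (k * snd q + l * fst q + m, fst q)) \<in> borel_measurable (lborel \<Otimes>\<^sub>M lborel)"
      by measurable
    from lborel.nn_integral_fst[OF this] show ?thesis by simp
  qed
  also have "\<dots> = (\<integral>\<^sup>+u. (\<integral>\<^sup>+x. F (x, u) \<partial>lborel) \<partial>lborel)"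
  proof (rule nn_integral_cong)
    fix u
    have "(\<integral>\<^sup>+x. F (x, u) \<partial>lborel) = ennreal \<bar>k\<bar> * (\<integral>\<^sup>+z. F ((l * u + m) + k * z, u) \<partial>lborel)"
      by (rule nn_integral_real_affine) (use k in auto)
    also have "\<dots> = (\<integral>\<^sup>+z. ennreal \<bar>k\<bar> * F (k * z + l * u + m, u) \<partial>lborel)"
      by (subst nn_integral_cmult) (auto simp: ac_simps)
    finally show "(\<integral>\<^sup>+z. ennreal \<bar>k\<bar> * F (k * z + l * u + m, u) \<partial>lborel) = (\<integral>\<^sup>+x. F (x, u) \<partial>lborel)" by simp
  qed
  also have "\<dots> = (\<integral>\<^sup>+p. F p \<partial>(lborel \<Otimes>\<^sub>M lborel))"
    by (rule lborel_pair.nn_integral_snd) (simp add: lborel_prod)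
  finally show ?thesis by (simp add: lborel_prod)
qed

lemma tt_nonneg [simp]: "0 \<le> tt N"
  by (rule less_imp_le[OF tt_pos])

lemma null_line:
  assumes "fst n \<noteq> 0"
  shows "{p. aff n p = 0} \<in> null_sets lborel"
proof -
  have eq: "{p. aff n p = 0} = {p. (fst n, fst (snd n)) \<bullet> p = - snd (snd n)}"
    by (auto simp: aff_def inner_prod_def)
  have "negligible {p. aff n p = 0}"
    unfolding eq by (rule negligible_hyperplane) (use assms in \<open>auto simp: zero_prod_def\<close>)
  moreover have "{p. aff n p = 0} \<in> sets lborel"
    using measurable_sets[OF borel_aff, of "{0}" n] by (simp add: vimage_def)
  ultimately show ?thesis by (simp add: negligible_iff_null_sets null_sets_completion_iff)
qed

definition nice :: "(real \<times> real \<Rightarrow> real) \<Rightarrow> bool" where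
  "nice f \<longleftrightarrow> f \<in> borel_measurable borel \<and> (\<forall>p. 0 \<le> f p) \<and> (\<forall>p. p \<notin> square \<longrightarrow> f p = 0) \<and> (\<exists>M. \<forall>p. f p \<le> M)"

definition RS :: "real \<Rightarrow> (real \<times> real \<Rightarrow> real) \<Rightarrow> (real \<times> real \<Rightarrow> real) \<Rightarrow> ennreal" where
  "RS t f r = (\<integral>\<^sup>+p. ennreal (f p) * indicator {p. 1 - t * r p < fst p \<and> fst p \<le> 1} p \<partial>lborel)"

definition TS :: "real \<Rightarrow> (real \<times> real \<Rightarrow> real) \<Rightarrow> (real \<times> real \<Rightarrow> real) \<Rightarrow> ennreal" where
  "TS t f r = (\<integral>\<^sup>+p. ennreal (f p) * indicator {p. 1 - t * r p < snd p \<and> snd p \<le> 1} p \<partial>lborel)"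

text \<open>The strip that arises has its width read off at p, the chain argument wants it read off
  at the base of p. The discrepancy lives where the two differ, a set of area o(t).\<close>

lemma ghost_side:
  assumes f: "nice f" and ad: "adapted e n d" and \<delta>: "0 < \<delta>" and m: "0 \<le> m"
    and \<sigma>: "tame \<sigma>" and \<sigma>0: "\<And>p. 0 \<le> \<sigma> p" and eps: "0 < \<epsilon>"
    and chainQ: "\<And>p. 0 < aff n p \<Longrightarrow> aff n p < \<delta> \<Longrightarrow> good_base n d p \<Longrightarrow> fst p \<le> 1 \<and> snd p \<le> 1"
  shows "eventually (\<lambda>N. (\<integral>\<^sup>+p. ennreal (f p) * indicator {p. 0 < aff n p \<and> aff n p < tt N * (m * \<sigma> p)} p \<partial>lborel)
    \<le> Qt (tt N) f (ghost \<delta> m n d \<sigma>)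
      + (\<integral>\<^sup>+p. ennreal (4 * tt N / \<delta> * (m * side_val \<sigma> d (base n d p)) * f p) * indicator {p. 0 < aff n p \<and> aff n p < \<delta> \<and> good_base n d p} p \<partial>lborel)
      + ennreal (tt N * \<epsilon>)) sequentially"
proof -
  have f_meas [measurable]: "f \<in> borel_measurable borel" and f0: "\<And>p. 0 \<le> f p" and fsq: "\<And>p. p \<notin> square \<Longrightarrow> f p = 0"
    using f unfolding nice_def by auto
  obtain M0 where M0: "\<And>p. f p \<le> M0" using f unfolding nice_def by auto
  have M00: "0 \<le> M0" using f0[of 0] M0[of 0] by linarith
  have u: "unit_dir n d" using ad unfolding adapted_def by blast
  define K where "K = Max (range \<sigma>)"
  have K: "\<sigma> p \<le> K" for p unfolding K_def by (intro Max_ge tame_finite_range[OF \<sigma>]) auto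
  have sv: "\<exists>q. side_val \<sigma> d p = \<sigma> q" for p
  proof -
    obtain r where "\<sigma> (p + r *\<^sub>R d) = side_val \<sigma> d p"
      using eventually_happens'[OF _ side_val[OF \<sigma>, of p d]] by auto
    then show ?thesis by (intro exI[of _ "p + r *\<^sub>R d"]) simp
  qed
  have sv0: "0 \<le> side_val \<sigma> d p" and svK: "side_val \<sigma> d p \<le> K" for p
    using sv[of p] \<sigma>0 K by metis+
  have K0: "0 \<le> K" using \<sigma>0[of 0] K[of 0] by linarith
  have [measurable]: "\<sigma> \<in> borel_measurable borel" by (rule tame_borel[OF \<sigma>])
  have [measurable]: "(\<lambda>p. side_val \<sigma> d (base n d p)) \<in> borel_measurable borel"
    by (rule tame_borel) (intro tame_affmap[OF tame_side[OF \<sigma>]] affmap_base)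
  \<comment> \<open>The bound \<open>M0\<close> of the density influences only how large
    \<open>N\<close> has to be, not the constants of the estimate.\<close>
  define \<epsilon>' where "\<epsilon>' = \<epsilon> / (M0 + 1)"
  have eps': "0 < \<epsilon>'" "M0 * \<epsilon>' \<le> \<epsilon>" unfolding \<epsilon>'_def using eps M00 by (auto simp: field_simps)
  note err = layer_error[OF ad \<sigma> mult_nonneg_nonneg[OF m K0] eps'(1)]
  have small: "eventually (\<lambda>N. tt N * (4 * (m * K)) \<le> \<delta>) sequentially" by (rule eventually_tt_mult_le[OF \<delta>])
  show ?thesis using err small
  proof eventually_elim
    case (elim N)
    let ?t = "tt N"
    let ?Z = "{p \<in> square. 0 \<le> aff n p \<and> aff n p < ?t * (m * K) \<and> \<not> (\<sigma> p = side_val \<sigma> d (base n d p) \<and> good_base n d p)}"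
    let ?A = "{p. 0 < aff n p \<and> aff n p \<le> ?t * (m * side_val \<sigma> d (base n d p)) \<and> good_base n d p}"
    have tp: "0 < ?t" by simp
    have "tame (\<lambda>p. \<sigma> p = side_val \<sigma> d (base n d p))"
      by (rule tame_comp2[OF \<sigma> tame_affmap[OF tame_side[OF \<sigma>] affmap_base]])
    then have [measurable]: "Measurable.pred borel (\<lambda>p. \<sigma> p = side_val \<sigma> d (base n d p))" by (rule tame_measurable)
    have Zm: "?Z \<in> sets borel" by measurable
    have "(\<integral>\<^sup>+p. ennreal (f p) * indicator {p. 0 < aff n p \<and> aff n p < ?t * (m * \<sigma> p)} p \<partial>lborel)
      \<le> (\<integral>\<^sup>+p. ennreal (f p) * indicator ?A p + ennreal M0 * indicator ?Z p \<partial>lborel)"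
    proof (intro nn_integral_mono)
      fix p
      show "ennreal (f p) * indicator {p. 0 < aff n p \<and> aff n p < ?t * (m * \<sigma> p)} p
         \<le> ennreal (f p) * indicator ?A p + ennreal M0 * indicator ?Z p"
      proof (cases "p \<in> square \<and> 0 < aff n p \<and> aff n p < ?t * (m * \<sigma> p)")
        case True
        show ?thesis
        proof (cases "\<sigma> p = side_val \<sigma> d (base n d p) \<and> good_base n d p")
          case t: True
          then have "p \<in> ?A" using True by auto
          then show ?thesis by (simp add: indicator_def)
        next
          case False
          have "?t * (m * \<sigma> p) \<le> ?t * (m * K)" using tp m K by (intro mult_left_mono) (auto intro: less_imp_le)
          then have "aff n p < ?t * (m * K)" using True by linarith
          then have "p \<in> ?Z" using True False by auto
          moreover have "ennreal (f p) \<le> ennreal M0" by (rule ennreal_leI[OF M0])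
          ultimately show ?thesis by (auto simp: indicator_def intro: add_increasing)
        qed
      next
        case False
        then show ?thesis using fsq[of p] by (auto simp: indicator_def)
      qed
    qed
    also have "\<dots> = (\<integral>\<^sup>+p. ennreal (f p) * indicator ?A p \<partial>lborel) + ennreal M0 * (\<integral>\<^sup>+p. indicator ?Z p \<partial>lborel)"
    proof -
      have "(\<lambda>p. indicator ?Z p :: ennreal) \<in> borel_measurable borel" using Zm by (rule borel_measurable_indicator)
      then show ?thesis by (subst nn_integral_add) (auto simp: nn_integral_cmult)
    qed
    also have "\<dots> \<le> (Qt ?t f (ghost \<delta> m n d \<sigma>)
      + (\<integral>\<^sup>+p. ennreal (4 * ?t / \<delta> * (m * side_val \<sigma> d (base n d p)) * f p) * indicator {p. 0 < aff n p \<and> aff n p < \<delta> \<and> good_base n d p} p \<partial>lborel))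
      + ennreal (?t * \<epsilon>)"
    proof (intro add_mono)
      show "(\<integral>\<^sup>+p. ennreal (f p) * indicator ?A p \<partial>lborel) \<le> Qt ?t f (ghost \<delta> m n d \<sigma>)
      + (\<integral>\<^sup>+p. ennreal (4 * ?t / \<delta> * (m * side_val \<sigma> d (base n d p)) * f p) * indicator {p. 0 < aff n p \<and> aff n p < \<delta> \<and> good_base n d p} p \<partial>lborel)"
      proof (rule ghost_main[OF f_meas f0 u \<delta> m \<sigma> sv0 tp _ chainQ])
        fix p
        have "4 * (?t * (m * side_val \<sigma> d p)) \<le> 4 * (?t * (m * K))"
          using tp m svK by (intro mult_left_mono) (auto intro: less_imp_le)
        also have "\<dots> \<le> \<delta>" using elim(2) by (simp add: ac_simps)
        finally show "4 * (?t * (m * side_val \<sigma> d p)) \<le> \<delta>" .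
      qed
      have "ennreal M0 * (\<integral>\<^sup>+p. indicator ?Z p \<partial>lborel) \<le> ennreal M0 * ennreal (?t * \<epsilon>')"
        by (intro mult_left_mono elim(1)) simp
      also have "\<dots> = ennreal (M0 * (?t * \<epsilon>'))" using M00 tp eps'(1) by (simp add: ennreal_mult)
      also have "\<dots> \<le> ennreal (?t * \<epsilon>)"
        using mult_left_mono[OF eps'(2), of ?t] tp by (intro ennreal_leI) (simp add: ac_simps)
      finally show "ennreal M0 * (\<integral>\<^sup>+p. indicator ?Z p \<partial>lborel) \<le> ennreal (?t * \<epsilon>)" .
    qed
    finally show ?case .
  qed
qed

section \<open>The transfer operator\<close>

locale memory_map =
  fixes a :: real
  assumes a_pos: "0 < a" and a_half: "a < 1/2"
begin

text \<open>Both branches have Jacobian 2 (1 - a) in absolute value; \<open>bb\<close> is its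
  inverse. \<open>bb\<close> and \<open>cc\<close> are the coefficients obtained by solving the
  branches for x.\<close>

definition "cc = a / (1 - a)"
definition "bb = 1 / (2 * (1 - a))"
definition "lf p = a * snd p + (1 - a) * fst (p :: real \<times> real)"
definition "A1 p = (snd p, 2 * lf p)"
definition "A2 p = (snd p, 2 - 2 * lf p)"
definition "psi1 q = (bb * snd q - cc * fst q, fst (q :: real \<times> real))"
definition "psi2 q = (bb * (2 - snd q) - cc * fst q, fst (q :: real \<times> real))"
definition "B1 h = (bb * snd h - cc * fst h, fst (h :: real \<times> real))"
definition "B2 h = (- bb * snd h - cc * fst h, fst (h :: real \<times> real))"
definition "Gm p = (if lf p \<le> 1/2 then A1 p else A2 p)"
text \<open>\<open>lf (psi1 q)\<close> is half of \<open>snd q\<close>, and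
  \<open>lf (psi2 q)\<close> its reflection at 1/2; hence the condition \<open>snd q\<close> at most
  1 says that both preimages lie on the correct side of the folding line.\<close>

definition "Pop f q = (if snd q \<le> 1 then bb * (f (psi1 q) + f (psi2 q)) else (0::real))"
definition "Up h p = (if lf p \<le> 1/2 then B1 (h (A1 p)) else B2 (h (A2 p)))"
text \<open>The absolute value of the first component of \<open>B2 (h (A2 p))\<close>: the
  horizontal speed with which the pulled back pair can cross the right edge.\<close>

definition "Rr h p = \<bar>cc * fst (h (A2 p)) + bb * snd (h (A2 p) :: real \<times> real)\<bar>"

lemma G_eq: "G a p = Gm p"
proof -
  have "tent (lf p) = (if lf p \<le> 1/2 then 2 * lf p else 2 - 2 * lf p)" by (auto simp: tent_def)
  then show ?thesis by (simp add: G_def Gm_def A1_def A2_def lf_def)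
qed

lemma bb_pos: "0 < bb" and bb_less: "bb < 1" and cc_pos: "0 < cc"
  using a_pos a_half by (auto simp: bb_def cc_def field_simps)

lemma bc_rel: "(1 - a) * bb = 1/2" "(1 - a) * cc = a" "cc = 2 * a * bb"
  using a_half by (auto simp: bb_def cc_def field_simps)

lemma lf_psi: "lf (psi1 q) = snd q / 2" "lf (psi2 q) = 1 - snd q / 2"
proof -
  have "lf (psi1 q) = a * fst q + ((1 - a) * bb) * snd q - ((1 - a) * cc) * fst q"
    "lf (psi2 q) = a * fst q + ((1 - a) * bb) * (2 - snd q) - ((1 - a) * cc) * fst q"
    by (simp_all add: lf_def psi1_def psi2_def algebra_simps)
  then show "lf (psi1 q) = snd q / 2" "lf (psi2 q) = 1 - snd q / 2" unfolding bc_rel(1,2) by simp_all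
qed

lemma A_psi: "A1 (psi1 q) = q" "A2 (psi2 q) = q"
  by (simp_all add: A1_def A2_def lf_psi) (simp_all add: psi1_def psi2_def)

lemma psi_A: "psi1 (A1 p) = p" "psi2 (A2 p) = p"
proof -
  have "bb * (2 * lf p) - cc * snd p = ((1 - a) * bb) * (2 * fst p)"
    unfolding bc_rel(3) by (simp add: lf_def algebra_simps)
  then have *: "bb * (2 * lf p) - cc * snd p = fst p" unfolding bc_rel(1) by simp
  then show "psi1 (A1 p) = p" by (simp add: A1_def psi1_def)
  from * show "psi2 (A2 p) = p" by (simp add: A2_def psi2_def)
qed

lemma psi_shift: "psi1 (q + t *\<^sub>R h) = psi1 q + t *\<^sub>R B1 h" "psi2 (q + t *\<^sub>R h) = psi2 q + t *\<^sub>R B2 h"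
  by (simp_all add: psi1_def psi2_def B1_def B2_def prod_eq_iff algebra_simps)

lemma A_shift: "A1 (p + t *\<^sub>R B1 h) = A1 p + t *\<^sub>R h" "A2 (p + t *\<^sub>R B2 h) = A2 p + t *\<^sub>R h"
proof -
  have "A1 (psi1 (A1 p + t *\<^sub>R h)) = A1 p + t *\<^sub>R h" "A2 (psi2 (A2 p + t *\<^sub>R h)) = A2 p + t *\<^sub>R h"
    by (rule A_psi)+
  then show "A1 (p + t *\<^sub>R B1 h) = A1 p + t *\<^sub>R h" "A2 (p + t *\<^sub>R B2 h) = A2 p + t *\<^sub>R h"
    by (simp_all only: psi_shift psi_A)
qed

lemma lf_aff: "lf p = aff (1 - a, a, 0) p" by (simp add: lf_def aff_def)

lemma lf_measurable [measurable]: "lf \<in> borel_measurable borel"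
  using borel_aff[of "(1 - a, a, 0)"] by (simp add: lf_aff[abs_def])

lemma affmap_A: "affmap A1" "affmap A2"
proof -
  show "affmap A1"
    by (rule affmapI[of _ 0 1 0 "2 * (1 - a)" "2 * a" 0]) (simp add: A1_def lf_def algebra_simps)
  show "affmap A2"
    by (rule affmapI[of _ 0 1 0 "- 2 * (1 - a)" "- 2 * a" 2]) (simp add: A2_def lf_def algebra_simps)
qed

lemma A_measurable [measurable]: "A1 \<in> measurable borel borel" "A2 \<in> measurable borel borel"
  unfolding A1_def lf_def A2_def by (intro borel_measurable_continuous_onI continuous_intros)+

lemma psi_measurable [measurable]: "psi1 \<in> measurable borel borel" "psi2 \<in> measurable borel borel"
  unfolding psi1_def psi2_def by (intro borel_measurable_continuous_onI continuous_intros)+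

lemma Gm_measurable [measurable]: "Gm \<in> measurable borel borel"
  unfolding Gm_def[abs_def] by measurable

lemma fst_borel [measurable]: "(fst :: real \<times> real \<Rightarrow> real) \<in> borel_measurable borel"
  and snd_borel [measurable]: "(snd :: real \<times> real \<Rightarrow> real) \<in> borel_measurable borel"
  by (intro borel_measurable_continuous_onI continuous_intros)+

lemma tame_lf: "tame (\<lambda>p. lf p \<le> 1/2)"
proof -
  have "(lf p \<le> 1/2) = (aff (1 - a, a, - 1/2) p \<le> 0)" for p by (auto simp: aff_def lf_def)
  then show ?thesis using tame_aff_le[of "(1 - a, a, - 1/2)"] by simp
qed

lemma tame_Gm:
  assumes "tame h"
  shows "tame (\<lambda>p. h (Gm p))"
proof -
  have "(\<lambda>p. h (Gm p)) = (\<lambda>p. if lf p \<le> 1/2 then h (A1 p) else h (A2 p))" by (auto simp: Gm_def)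
  then show ?thesis using tame_if[OF tame_lf tame_affmap[OF assms affmap_A(1)] tame_affmap[OF assms affmap_A(2)]] by simp
qed

lemma tame_Up:
  assumes "tame h"
  shows "tame (Up h)"
  unfolding Up_def[abs_def]
  by (rule tame_if[OF tame_lf tame_comp[OF tame_affmap[OF assms affmap_A(1)]] tame_comp[OF tame_affmap[OF assms affmap_A(2)]]])

lemma tame_Rr:
  assumes "tame h"
  shows "tame (Rr h)"
  unfolding Rr_def[abs_def]
  by (rule tame_comp[OF tame_affmap[OF assms affmap_A(2)], of "\<lambda>v. \<bar>cc * fst v + bb * snd v\<bar>"])

lemma nn_integral_psi:
  assumes [measurable]: "F \<in> borel_measurable borel"
  shows "(\<integral>\<^sup>+q. ennreal bb * F (psi1 q) \<partial>lborel) = (\<integral>\<^sup>+p. F p \<partial>lborel)"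
    and "(\<integral>\<^sup>+q. ennreal bb * F (psi2 q) \<partial>lborel) = (\<integral>\<^sup>+p. F p \<partial>lborel)"
  using nn_integral_swap_affine[OF assms, of bb "- cc" 0] nn_integral_swap_affine[OF assms, of "- bb" "- cc" "2 * bb"] bb_pos
  by (simp_all add: psi1_def psi2_def algebra_simps)

lemma AE_off_line: "AE p in lborel. lf p \<noteq> 1/2"
proof -
  have "{p. aff (1 - a, a, - 1/2) p = 0} \<in> null_sets lborel" by (rule null_line) (use a_half in auto)
  from AE_not_in[OF this] show ?thesis by (auto simp: aff_def lf_def algebra_simps)
qed

lemma push:
  assumes f [measurable]: "f \<in> borel_measurable borel" and f0: "\<And>p. 0 \<le> f p"
    and F [measurable]: "F \<in> borel_measurable borel"
  shows "(\<integral>\<^sup>+q. ennreal (Pop f q) * F q \<partial>lborel) = (\<integral>\<^sup>+p. ennreal (f p) * F (Gm p) \<partial>lborel)"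
proof -
  let ?L1 = "\<lambda>p. ennreal (f p) * (F (A1 p) * indicator {p. lf p \<le> 1/2} p)"
  let ?L2 = "\<lambda>p. ennreal (f p) * (F (A2 p) * indicator {p. 1/2 \<le> lf p} p)"
  have "(\<integral>\<^sup>+q. ennreal (Pop f q) * F q \<partial>lborel) = (\<integral>\<^sup>+q. ennreal bb * ?L1 (psi1 q) + ennreal bb * ?L2 (psi2 q) \<partial>lborel)"
  proof (intro nn_integral_cong)
    fix q
    show "ennreal (Pop f q) * F q = ennreal bb * ?L1 (psi1 q) + ennreal bb * ?L2 (psi2 q)"
      using bb_pos f0
      by (auto simp: Pop_def indicator_def lf_psi A_psi ennreal_mult ennreal_plus distrib_left distrib_right mult.assoc)
  qed
  also have "\<dots> = (\<integral>\<^sup>+q. ennreal bb * ?L1 (psi1 q) \<partial>lborel) + (\<integral>\<^sup>+q. ennreal bb * ?L2 (psi2 q) \<partial>lborel)"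
    by (rule nn_integral_add) auto
  also have "\<dots> = (\<integral>\<^sup>+p. ?L1 p \<partial>lborel) + (\<integral>\<^sup>+p. ?L2 p \<partial>lborel)"
    by (intro arg_cong2[of _ _ _ _ "(+)"] nn_integral_psi) auto
  also have "\<dots> = (\<integral>\<^sup>+p. ?L1 p + ?L2 p \<partial>lborel)" by (rule nn_integral_add[symmetric]) auto
  \<comment> \<open>On the folding line both summands count, whereas \<open>Gm\<close> takes only
    the first branch there; the line is null.\<close>
  also have "\<dots> = (\<integral>\<^sup>+p. ennreal (f p) * F (Gm p) \<partial>lborel)"
    by (rule nn_integral_cong_AE, rule AE_mp[OF AE_off_line])
       (auto simp: Gm_def indicator_def intro!: AE_I2)
  finally show ?thesis .
qed

lemma nice_Pop: assumes "nice f" shows "nice (Pop f)"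
proof -
  have [measurable]: "f \<in> borel_measurable borel" and f0: "\<And>p. 0 \<le> f p" and sq: "\<And>p. p \<notin> square \<Longrightarrow> f p = 0"
    using assms unfolding nice_def by auto
  obtain M where M: "\<And>p. f p \<le> M" using assms unfolding nice_def by auto
  have "Pop f \<in> borel_measurable borel" unfolding Pop_def[abs_def] by measurable
  moreover have "0 \<le> Pop f p" for p using f0 bb_pos by (simp add: Pop_def)
  moreover have "Pop f q = 0" if "q \<notin> square" for q
  proof (cases "snd q \<le> 1")
    case True
    have lfsq: "0 \<le> lf p" "lf p \<le> 1" if "p \<in> square" for p
    proof -
      have b: "0 \<le> fst p" "fst p \<le> 1" "0 \<le> snd p" "snd p \<le> 1" using that by (auto simp: square_def mem_Times_iff)
      show "0 \<le> lf p" unfolding lf_def using b a_pos a_half by simp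
      have "a * snd p \<le> a * 1" "(1 - a) * fst p \<le> (1 - a) * 1" using b a_pos a_half by (simp_all add: mult_left_mono)
      then show "lf p \<le> 1" unfolding lf_def by simp
    qed
    have "psi1 q \<notin> square"
    proof
      assume s: "psi1 q \<in> square"
      from lfsq(1)[OF s] have "0 \<le> snd q" by (simp add: lf_psi)
      moreover have "fst q \<in> {0..1}" using s by (simp add: psi1_def square_def)
      ultimately show False using True that by (simp add: square_def mem_Times_iff)
    qed
    moreover have "psi2 q \<notin> square"
    proof
      assume s: "psi2 q \<in> square"
      from lfsq(2)[OF s] have "0 \<le> snd q" by (simp add: lf_psi)
      moreover have "fst q \<in> {0..1}" using s by (simp add: psi2_def square_def)
      ultimately show False using True that by (simp add: square_def mem_Times_iff)
    qed
    ultimately show ?thesis by (simp add: Pop_def sq)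
  qed (simp add: Pop_def)
  moreover have "Pop f p \<le> bb * (2 * M)" for p
  proof -
    have "0 \<le> M" using f0[of 0] M[of 0] by linarith
    moreover have "f (psi1 p) + f (psi2 p) \<le> 2 * M" using M[of "psi1 p"] M[of "psi2 p"] by linarith
    ultimately show ?thesis using bb_pos by (auto simp: Pop_def intro!: mult_left_mono)
  qed
  ultimately show ?thesis unfolding nice_def by blast
qed

section \<open>Difference quotients under the transfer operator\<close>

definition gd :: "real \<Rightarrow> (real \<times> real \<Rightarrow> real \<times> real) \<Rightarrow> (real \<times> real) set" where
  "gd t h = {p. fst p \<le> 1 \<and> snd p \<le> 1 \<and> fst (p + t *\<^sub>R h p) \<le> 1 \<and>
      snd (p + t *\<^sub>R h p) \<le> 1 \<and> h (p + t *\<^sub>R h p) = h p}"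

lemma Qt_gd: "Qt t f h = (\<integral>\<^sup>+p. indicator (gd t h) p * ennreal \<bar>f (p + t *\<^sub>R h p) - f p\<bar> \<partial>lborel)"
  unfolding Qt_def gd_def ..

lemma gd_measurable [measurable]:
  assumes "tame h"
  shows "gd t h \<in> sets borel"
proof -
  have [measurable]: "h \<in> measurable borel borel" by (rule tame_borel[OF assms])
  have m: "(\<lambda>p. p + t *\<^sub>R h p) \<in> measurable borel borel" by measurable
  note [measurable] = measurable_compose[OF m fst_borel] measurable_compose[OF m snd_borel]
  have "gd t h = {p. fst p \<le> 1 \<and> snd p \<le> 1 \<and> fst (p + t *\<^sub>R h p) \<le> 1 \<and>
      snd (p + t *\<^sub>R h p) \<le> 1 \<and> dist (h (p + t *\<^sub>R h p)) (h p) = 0}"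
    by (simp add: gd_def)
  also have "\<dots> \<in> sets borel" by measurable
  finally show ?thesis .
qed

lemma B_measurable [measurable]: "B1 \<in> measurable borel borel" "B2 \<in> measurable borel borel"
  unfolding B1_def B2_def by (intro borel_measurable_continuous_onI continuous_intros)+

text \<open>The part of the square folded by the first branch ends at \<open>bb\<close> < 1, so only
  the second branch can produce pairs across the right edge.\<close>

lemma lf_upper_left:
  assumes "p \<in> square" "lf p \<le> 1/2"
  shows "fst p \<le> bb"
proof -
  have "0 \<le> a * snd p" using assms(1) a_pos by (simp add: square_def mem_Times_iff)
  then have "(1 - a) * fst p \<le> (1 - a) * bb" using assms(2) unfolding lf_def bc_rel by simp
  then show ?thesis using a_half by simp
qed

text \<open>The inverse branches carry a pair for \<open>h\<close> to pairs for \<open>Up h\<close>,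
  and the Jacobian cancels \<open>bb\<close>. Both ends stay on one side of the folding line because
  the pairs for \<open>h\<close> do not cross y = 1, and they do not cross y = 1 because these do
  not cross x = 1. Only crossings of x = 1 are left over.\<close>

lemma Qt_step:
  assumes f: "nice f" and h: "tame h" and t: "0 < t" and small: "\<And>p. t * \<bar>fst (B1 (h p))\<bar> \<le> 1 - bb"
  shows "Qt t (Pop f) h \<le> Qt t f (Up h) + RS t f (Rr h)"
proof -
  have [measurable]: "f \<in> borel_measurable borel" and f0: "\<And>p. 0 \<le> f p" and fsq: "\<And>p. p \<notin> square \<Longrightarrow> f p = 0"
    using f unfolding nice_def by auto
  have h_borel [measurable]: "h \<in> measurable borel borel" by (rule tame_borel[OF h])
  have U_borel [measurable]: "Up h \<in> measurable borel borel" by (rule tame_borel[OF tame_Up[OF h]])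
  have gdm [measurable]: "gd t h \<in> sets borel" "gd t (Up h) \<in> sets borel" by (intro gd_measurable h tame_Up)+
  define K1 where "K1 p = indicator (gd t h) (A1 p) * ennreal \<bar>f (p + t *\<^sub>R B1 (h (A1 p))) - f p\<bar>" for p
  define K2 where "K2 p = indicator (gd t h) (A2 p) * ennreal \<bar>f (p + t *\<^sub>R B2 (h (A2 p))) - f p\<bar>" for p
  define w where "w p = fst (B2 (h (A2 p)))" for p
  define X1 where "X1 p = ennreal (f p) * indicator {p. 1 - t * w p < fst p \<and> fst p \<le> 1} p" for p
  define X2 where "X2 p = ennreal (f (p + t *\<^sub>R B2 (h (A2 p)))) * indicator {p. 1 < fst p \<and> fst p + t * w p \<le> 1 \<and>
      h (A2 p + t *\<^sub>R h (A2 p)) = h (A2 p)} p" for p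
  define X3 where "X3 p = ennreal (f p) * indicator {p. 1 + t * w p < fst p \<and> fst p \<le> 1} p" for p
  define Y where "Y v p = ennreal (f p) * indicator {p. 1 + t * fst (B2 v) < fst p \<and> fst p \<le> 1 \<and> h (A2 p) = v} p" for v p
  define W where "W p = indicator (gd t (Up h)) p * ennreal \<bar>f (p + t *\<^sub>R Up h p) - f p\<bar>" for p
  have [measurable]: "K1 \<in> borel_measurable borel" "K2 \<in> borel_measurable borel"
    unfolding K1_def[abs_def] K2_def[abs_def] by measurable
  have "(\<lambda>p. B2 (h (A2 p))) \<in> measurable borel borel" by measurable
  from measurable_compose[OF this fst_borel] have [measurable]: "w \<in> borel_measurable borel"
    unfolding w_def[abs_def] .
  have [measurable]: "X1 \<in> borel_measurable borel" "X3 \<in> borel_measurable borel" "W \<in> borel_measurable borel"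
    unfolding X1_def[abs_def] X3_def[abs_def] W_def[abs_def] by measurable
  have finV: "finite (range h)" by (rule tame_finite_range[OF h])
  have Ym [measurable]: "Y v \<in> borel_measurable borel" for v
  proof -
    have "tame (\<lambda>p. h (A2 p) = v)" by (rule tame_comp[OF tame_affmap[OF h affmap_A(2)]])
    then have [measurable]: "Measurable.pred borel (\<lambda>p. h (A2 p) = v)" by (rule tame_measurable)
    show ?thesis unfolding Y_def[abs_def] by measurable
  qed
  have "Qt t (Pop f) h \<le> (\<integral>\<^sup>+q. ennreal bb * K1 (psi1 q) + ennreal bb * K2 (psi2 q) \<partial>lborel)"
    unfolding Qt_gd
  proof (intro nn_integral_mono)
    fix q
    show "indicator (gd t h) q * ennreal \<bar>Pop f (q + t *\<^sub>R h q) - Pop f q\<bar> \<le> ennreal bb * K1 (psi1 q) + ennreal bb * K2 (psi2 q)"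
    proof (cases "q \<in> gd t h")
      case True
      have s: "snd q \<le> 1" "snd (q + t *\<^sub>R h q) \<le> 1" using True unfolding gd_def by blast+
      let ?d1 = "f (psi1 q + t *\<^sub>R B1 (h q)) - f (psi1 q)" and ?d2 = "f (psi2 q + t *\<^sub>R B2 (h q)) - f (psi2 q)"
      have "Pop f (q + t *\<^sub>R h q) - Pop f q = bb * ?d1 + bb * ?d2"
        unfolding Pop_def if_P[OF s(1)] if_P[OF s(2)] psi_shift by (simp add: algebra_simps)
      also have "\<bar>\<dots>\<bar> \<le> bb * \<bar>?d1\<bar> + bb * \<bar>?d2\<bar>"
        using abs_triangle_ineq[of "bb * ?d1" "bb * ?d2"] bb_pos by (simp add: abs_mult)
      finally have "ennreal \<bar>Pop f (q + t *\<^sub>R h q) - Pop f q\<bar> \<le> ennreal (bb * \<bar>?d1\<bar> + bb * \<bar>?d2\<bar>)" by (rule ennreal_leI)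
      also have "\<dots> = ennreal bb * ennreal \<bar>?d1\<bar> + ennreal bb * ennreal \<bar>?d2\<bar>"
        using bb_pos by (simp add: ennreal_plus ennreal_mult)
      finally show ?thesis using True by (simp add: K1_def K2_def A_psi)
    qed simp
  qed
  also have "\<dots> = (\<integral>\<^sup>+q. ennreal bb * K1 (psi1 q) \<partial>lborel) + (\<integral>\<^sup>+q. ennreal bb * K2 (psi2 q) \<partial>lborel)"
    by (rule nn_integral_add) auto
  also have "\<dots> = (\<integral>\<^sup>+p. K1 p \<partial>lborel) + (\<integral>\<^sup>+p. K2 p \<partial>lborel)"
    by (intro arg_cong2[of _ _ _ _ "(+)"] nn_integral_psi) auto
  also have "\<dots> = (\<integral>\<^sup>+p. K1 p + K2 p \<partial>lborel)" by (rule nn_integral_add[symmetric]) auto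
  also have "\<dots> \<le> (\<integral>\<^sup>+p. W p + (X1 p + X2 p) \<partial>lborel)"
  proof (rule nn_integral_mono_AE)
    \<comment> \<open>For the first branch a pair across x = 1 carries no mass at either end: the
      density there lives on x at most \<open>bb\<close>, further from the edge than the shift is
      long.\<close>
    have K1: "K1 p \<le> W p" if "lf p \<le> 1/2" for p
    proof (cases "A1 p \<in> gd t h")
      case True
      let ?p' = "p + t *\<^sub>R B1 (h (A1 p))"
      have A': "A1 ?p' = A1 p + t *\<^sub>R h (A1 p)" by (rule A_shift)
      have s: "snd p \<le> 1" "snd ?p' \<le> 1" "lf ?p' \<le> 1/2" "h (A1 ?p') = h (A1 p)"
        using True unfolding gd_def mem_Collect_eq A'[symmetric] by (auto simp: A1_def)
      have U: "Up h p = B1 (h (A1 p))" "Up h ?p' = B1 (h (A1 p))" using that s by (simp_all add: Up_def)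
      have close: "\<bar>fst ?p' - fst p\<bar> \<le> 1 - bb" using small[of "A1 p"] t by (simp add: abs_mult)
      show ?thesis
      proof (cases "fst p \<le> 1 \<and> fst ?p' \<le> 1")
        case fst_le: True
        then have "p \<in> gd t (Up h)" unfolding gd_def mem_Collect_eq U using s U by auto
        then show ?thesis by (simp add: W_def K1_def U indicator_def)
      next
        case False
        have "f p = 0 \<and> f ?p' = 0"
        proof (cases "fst p \<le> 1")
          case True
          then have p': "1 < fst ?p'" using False by auto
          then have "f ?p' = 0" by (intro fsq) (auto simp: square_def mem_Times_iff)
          moreover have "f p = 0"
          proof (rule ccontr)
            assume "f p \<noteq> 0"
            then have "fst p \<le> bb" using fsq lf_upper_left that by blast
            then show False using close p' by linarith
          qed
          ultimately show ?thesis by simp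
        next
          case False
          then have "f p = 0" by (intro fsq) (auto simp: square_def mem_Times_iff)
          moreover have "f ?p' = 0"
          proof (rule ccontr)
            assume "f ?p' \<noteq> 0"
            then have "fst ?p' \<le> bb" using fsq lf_upper_left s(3) by blast
            then show False using close False by linarith
          qed
          ultimately show ?thesis by simp
        qed
        then show ?thesis by (simp add: K1_def)
      qed
    qed (simp add: K1_def)
    have K1': "K1 p = 0" if "\<not> lf p \<le> 1/2" for p
    proof -
      have "A1 p \<notin> gd t h" using that by (simp add: gd_def A1_def)
      then show ?thesis by (simp add: K1_def)
    qed
    have K2': "K2 p = 0" if "lf p < 1/2" for p
    proof -
      have "A2 p \<notin> gd t h" using that by (simp add: gd_def A2_def)
      then show ?thesis by (simp add: K2_def)
    qed
    have K2: "K2 p \<le> W p + (X1 p + X2 p)" if "1/2 < lf p" and off: "lf (p + t *\<^sub>R B2 (h (A2 p))) \<noteq> 1/2" for p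
    proof (cases "A2 p \<in> gd t h")
      case True
      let ?p' = "p + t *\<^sub>R B2 (h (A2 p))"
      have A': "A2 ?p' = A2 p + t *\<^sub>R h (A2 p)" by (rule A_shift)
      have s: "snd p \<le> 1" "snd ?p' \<le> 1" "1/2 \<le> lf ?p'" "h (A2 ?p') = h (A2 p)"
        using True unfolding gd_def mem_Collect_eq A'[symmetric] by (auto simp: A2_def)
      have s': "1/2 < lf ?p'" using s(3) off by linarith
      have U: "Up h p = B2 (h (A2 p))" "Up h ?p' = B2 (h (A2 p))" using that s' s by (simp_all add: Up_def)
      have w': "fst ?p' = fst p + t * w p" by (simp add: w_def)
      \<comment> \<open>If exactly one end lies beyond the right edge, the density vanishes at that
        end, and the other end is in a strip of width t times the absolute value of
        \<open>w p\<close>.\<close>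
      consider "fst p \<le> 1" "fst ?p' \<le> 1" | "fst p \<le> 1" "1 < fst ?p'" | "1 < fst p" "fst ?p' \<le> 1" | "1 < fst p" "1 < fst ?p'"
        by linarith
      then show ?thesis
      proof cases
        case 1
        then have "p \<in> gd t (Up h)" unfolding gd_def mem_Collect_eq U using s U by auto
        then have "K2 p \<le> W p" by (simp add: W_def K2_def U indicator_def)
        then show ?thesis by (simp add: add_increasing2)
      next
        case 2
        then have "f ?p' = 0" by (intro fsq) (auto simp: square_def mem_Times_iff)
        then have "K2 p \<le> X1 p" using 2 w' f0[of p] by (auto simp: K2_def X1_def indicator_def)
        then show ?thesis by (simp add: add_increasing add_increasing2)
      next
        case 3
        then have "f p = 0" by (intro fsq) (auto simp: square_def mem_Times_iff)
        then have "K2 p \<le> X2 p" using 3 w' s(4) f0[of ?p'] unfolding A' by (auto simp: K2_def X2_def indicator_def)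
        then show ?thesis by (simp add: add_increasing)
      next
        case 4
        then have "f p = 0" "f ?p' = 0" by (auto intro!: fsq simp: square_def mem_Times_iff)
        then show ?thesis by (simp add: K2_def)
      qed
    qed (simp add: K2_def)
    \<comment> \<open>The second end of the pair has to avoid the folding line too, since
      \<open>Up\<close> uses the first branch there. There are only finitely many shifts.\<close>
    have "AE p in lborel. \<forall>v\<in>range h. lf (p + t *\<^sub>R B2 v) \<noteq> 1/2"
    proof (rule AE_finite_allI[OF finV])
      fix v
      let ?n = "(1 - a, a, lf (t *\<^sub>R B2 v) - 1/2)"
      have "{p. aff ?n p = 0} \<in> null_sets lborel" by (rule null_line) (use a_half in auto)
      from AE_not_in[OF this] show "AE p in lborel. lf (p + t *\<^sub>R B2 v) \<noteq> 1/2"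
        by (auto simp: aff_def lf_def algebra_simps elim!: eventually_mono)
    qed
    with AE_off_line show "AE p in lborel. K1 p + K2 p \<le> W p + (X1 p + X2 p)"
    proof eventually_elim
      case (elim p)
      then have off: "lf (p + t *\<^sub>R B2 (h (A2 p))) \<noteq> 1/2" by blast
      show ?case
      proof (cases "lf p \<le> 1/2")
        case True
        then have "lf p < 1/2" using elim by simp
        then show ?thesis using K1[OF True] K2'[of p] by (simp add: add_increasing2)
      next
        case False
        then show ?thesis using K1'[of p] K2[OF _ off] by simp
      qed
    qed
  qed
  also have "\<dots> \<le> (\<integral>\<^sup>+p. W p \<partial>lborel) + (\<integral>\<^sup>+p. X1 p + X2 p \<partial>lborel)"
  proof -
    have "X2 \<in> borel_measurable borel"
    proof -
      have [measurable]: "(\<lambda>p. h (A2 p + t *\<^sub>R h (A2 p))) \<in> measurable borel borel" by measurable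
      have eq: "{p. 1 < fst p \<and> fst p + t * w p \<le> 1 \<and> h (A2 p + t *\<^sub>R h (A2 p)) = h (A2 p)}
        = {p. 1 < fst p \<and> fst p + t * w p \<le> 1 \<and> dist (h (A2 p + t *\<^sub>R h (A2 p))) (h (A2 p)) = 0}" by simp
      show ?thesis unfolding X2_def[abs_def] eq by measurable
    qed
    then show ?thesis by (subst nn_integral_add) auto
  qed
  \<comment> \<open>In \<open>X2\<close> the density is evaluated at the shifted end, so the
    integral is moved there. Splitting by the value v of the field turns the shift into finitely
    many translations; afterwards \<open>X1\<close> and \<open>X3\<close> are supported where
    \<open>w\<close> is positive and negative, respectively.\<close>
  also have "(\<integral>\<^sup>+p. X1 p + X2 p \<partial>lborel) \<le> (\<integral>\<^sup>+p. X1 p + (\<Sum>v\<in>range h. Y v (p + t *\<^sub>R B2 v)) \<partial>lborel)"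
  proof (intro nn_integral_mono add_left_mono)
    fix p
    have "X2 p \<le> Y (h (A2 p)) (p + t *\<^sub>R B2 (h (A2 p)))"
      by (auto simp: X2_def Y_def indicator_def w_def A_shift)
    also have "\<dots> \<le> (\<Sum>v\<in>range h. Y v (p + t *\<^sub>R B2 v))"
      by (rule member_le_sum) (auto simp: finV)
    finally show "X2 p \<le> (\<Sum>v\<in>range h. Y v (p + t *\<^sub>R B2 v))" .
  qed
  also have "\<dots> = (\<integral>\<^sup>+p. X1 p \<partial>lborel) + (\<Sum>v\<in>range h. (\<integral>\<^sup>+p. Y v (p + t *\<^sub>R B2 v) \<partial>lborel))"
    by (subst nn_integral_add) (auto simp: nn_integral_sum)
  also have "(\<Sum>v\<in>range h. (\<integral>\<^sup>+p. Y v (p + t *\<^sub>R B2 v) \<partial>lborel)) = (\<Sum>v\<in>range h. (\<integral>\<^sup>+p. Y v p \<partial>lborel))"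
    by (intro sum.cong refl nn_integral_translate) auto
  also have "\<dots> = (\<integral>\<^sup>+p. (\<Sum>v\<in>range h. Y v p) \<partial>lborel)" by (rule nn_integral_sum[symmetric]) auto
  also have "\<dots> = (\<integral>\<^sup>+p. X3 p \<partial>lborel)"
  proof (rule nn_integral_cong)
    fix p
    have "(\<Sum>v\<in>range h. Y v p) = (\<Sum>v\<in>range h. if v = h (A2 p) then X3 p else 0)"
      by (intro sum.cong) (auto simp: Y_def X3_def w_def indicator_def)
    then show "(\<Sum>v\<in>range h. Y v p) = X3 p" using finV by simp
  qed
  also have "(\<integral>\<^sup>+p. X1 p \<partial>lborel) + (\<integral>\<^sup>+p. X3 p \<partial>lborel) = (\<integral>\<^sup>+p. X1 p + X3 p \<partial>lborel)"
    by (rule nn_integral_add[symmetric]) auto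
  also have "\<dots> \<le> RS t f (Rr h)"
    unfolding RS_def
  proof (intro nn_integral_mono)
    fix p
    have R: "Rr h p = \<bar>w p\<bar>" by (simp add: Rr_def w_def B2_def algebra_simps abs_minus_commute) 
    have tw: "0 \<le> t * w p \<longleftrightarrow> 0 \<le> w p" using t by (simp add: zero_le_mult_iff)
    show "X1 p + X3 p \<le> ennreal (f p) * indicator {p. 1 - t * Rr h p < fst p \<and> fst p \<le> 1} p"
      using tw by (cases "0 \<le> w p") (auto simp: X1_def X3_def indicator_def R abs_if)
  qed
  finally show ?thesis unfolding W_def Qt_gd by (simp add: add_left_mono)
qed

end

lemma sum_list_eventually_le:
  fixes F G :: "nat \<Rightarrow> 'b \<Rightarrow> ennreal"
  assumes "\<And>x \<epsilon>. x \<in> set xs \<Longrightarrow> 0 < \<epsilon> \<Longrightarrow> eventually (\<lambda>N. F N x \<le> G N x + ennreal (tt N * \<epsilon>)) sequentially"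
    and "0 < \<epsilon>"
  shows "eventually (\<lambda>N. (\<Sum>x\<leftarrow>xs. F N x) \<le> (\<Sum>x\<leftarrow>xs. G N x) + ennreal (tt N * \<epsilon>)) sequentially"
  using assms
proof (induction xs arbitrary: \<epsilon>)
  case (Cons x xs)
  have 1: "eventually (\<lambda>N. F N x \<le> G N x + ennreal (tt N * (\<epsilon>/2))) sequentially"
    using Cons.prems by (intro Cons.prems(1)) auto
  have 2: "eventually (\<lambda>N. (\<Sum>x\<leftarrow>xs. F N x) \<le> (\<Sum>x\<leftarrow>xs. G N x) + ennreal (tt N * (\<epsilon>/2))) sequentially"
    using Cons.prems by (intro Cons.IH) auto
  from 1 2 show ?case
  proof eventually_elim
    case (elim N)
    have "ennreal (tt N * \<epsilon>) = ennreal (tt N * (\<epsilon>/2)) + ennreal (tt N * (\<epsilon>/2))"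
      using Cons.prems(2) by (subst ennreal_plus[symmetric]) (auto simp: field_simps)
    then show ?case using add_mono[OF elim] by (simp add: ac_simps)
  qed
qed simp

context memory_map
begin

section \<open>The two sides of the folding line\<close>

text \<open>On the side of the first branch chains run down the diagonal, away from both edges, and
  lines are labelled by u = x - y. On the other side they run horizontally, keeping their height,
  and u = y.\<close>

definition "n_plus = (- (1 - a), - a, 1/2 :: real)"
definition "d_plus = (-1, -1 :: real)"
definition "e_plus u = (1/2 - (1 - a) * u + u, 1/2 - (1 - a) * (u::real))"
definition "n_minus = (1 :: real, cc, - bb)"
definition "d_minus = (1 :: real, 0 :: real)"
definition "e_minus u = (bb - cc * u, u :: real)"

lemma aff_plus: "aff n_plus p = 1/2 - lf p"
  by (simp add: n_plus_def aff_def lf_def algebra_simps)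

lemma aff_minus: "aff n_minus p = 2 * bb * (lf p - 1/2)"
proof -
  have "aff n_minus p = 2 * ((1 - a) * bb) * fst p + 2 * a * bb * snd p - bb"
    unfolding bc_rel(1) by (simp add: n_minus_def aff_def bc_rel(3))
  then show ?thesis by (simp add: lf_def algebra_simps)
qed

lemma adapted_minus: "adapted e_minus n_minus d_minus"
  unfolding adapted_def
proof (intro conjI ballI allI impI)
  show "unit_dir n_minus d_minus" by (simp add: unit_dir_def n_minus_def d_minus_def)
  show "continuous_on UNIV e_minus" unfolding e_minus_def by (intro continuous_intros)
  show "aff n_minus (e_minus u) = 0" for u by (simp add: aff_def n_minus_def e_minus_def)
  show "finite {u. snd (e_minus u) = 0}" by (simp add: e_minus_def)
  show "\<bar>u\<bar> \<le> 1" if "e_minus u + s *\<^sub>R d_minus \<in> square" for u s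
    using that by (simp add: e_minus_def d_minus_def square_def)
  fix F :: "real \<times> real \<Rightarrow> ennreal" assume [measurable]: "F \<in> borel_measurable borel"
  have "(\<integral>\<^sup>+p. F p \<partial>lborel) = (\<integral>\<^sup>+p. F p \<partial>(lborel \<Otimes>\<^sub>M lborel))" by (simp add: lborel_prod)
  also have "\<dots> = (\<integral>\<^sup>+u. (\<integral>\<^sup>+x. F (x, u) \<partial>lborel) \<partial>lborel)"
    by (rule lborel_pair.nn_integral_snd[symmetric]) (simp add: lborel_prod)
  also have "\<dots> = (\<integral>\<^sup>+u. (\<integral>\<^sup>+s. F (e_minus u + s *\<^sub>R d_minus) \<partial>lborel) \<partial>lborel)"
  proof (rule nn_integral_cong)
    fix u
    have "(\<integral>\<^sup>+x. F (x, u) \<partial>lborel) = (\<integral>\<^sup>+s. F (s + (bb - cc * u), u) \<partial>lborel)"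
      by (rule nn_integral_translate[symmetric]) measurable
    then show "(\<integral>\<^sup>+x. F (x, u) \<partial>lborel) = (\<integral>\<^sup>+s. F (e_minus u + s *\<^sub>R d_minus) \<partial>lborel)"
      by (simp add: e_minus_def d_minus_def add.commute)
  qed
  finally show "(\<integral>\<^sup>+p. F p \<partial>lborel) = (\<integral>\<^sup>+u. (\<integral>\<^sup>+s. F (e_minus u + s *\<^sub>R d_minus) \<partial>lborel) \<partial>lborel)" .
qed

lemma adapted_plus: "adapted e_plus n_plus d_plus"
  unfolding adapted_def
proof (intro conjI ballI allI impI)
  show "unit_dir n_plus d_plus" by (simp add: unit_dir_def n_plus_def d_plus_def)
  show "continuous_on UNIV e_plus" unfolding e_plus_def by (intro continuous_intros)
  show "aff n_plus (e_plus u) = 0" for u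
    unfolding aff_plus lf_def e_plus_def by (simp add: algebra_simps) (simp add: field_simps)
  have "{u. snd (e_plus u) = 0} \<subseteq> {1 / (2 * (1 - a))}" using a_half by (auto simp: e_plus_def field_simps)
  then show "finite {u. snd (e_plus u) = 0}" by (rule finite_subset) simp
  show "\<bar>u\<bar> \<le> 1" if "e_plus u + s *\<^sub>R d_plus \<in> square" for u s
    using that by (auto simp: e_plus_def d_plus_def square_def)
  fix F :: "real \<times> real \<Rightarrow> ennreal" assume [measurable]: "F \<in> borel_measurable borel"
  have "(\<integral>\<^sup>+p. F p \<partial>lborel) = (\<integral>\<^sup>+p. F p \<partial>(lborel \<Otimes>\<^sub>M lborel))" by (simp add: lborel_prod)
  also have "\<dots> = (\<integral>\<^sup>+y. (\<integral>\<^sup>+x. F (x, y) \<partial>lborel) \<partial>lborel)"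
    by (rule lborel_pair.nn_integral_snd[symmetric]) (simp add: lborel_prod)
  also have "\<dots> = (\<integral>\<^sup>+y. (\<integral>\<^sup>+u. F (u + y, y) \<partial>lborel) \<partial>lborel)"
  proof (rule nn_integral_cong)
    fix y
    show "(\<integral>\<^sup>+x. F (x, y) \<partial>lborel) = (\<integral>\<^sup>+u. F (u + y, y) \<partial>lborel)"
      by (rule nn_integral_translate[symmetric]) measurable
  qed
  also have "\<dots> = (\<integral>\<^sup>+u. (\<integral>\<^sup>+y. F (u + y, y) \<partial>lborel) \<partial>lborel)"
    by (rule lborel_pair.Fubini') measurable
  also have "\<dots> = (\<integral>\<^sup>+u. (\<integral>\<^sup>+s. F (e_plus u + s *\<^sub>R d_plus) \<partial>lborel) \<partial>lborel)"
  proof (rule nn_integral_cong)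
    fix u
    have "(\<integral>\<^sup>+y. F (u + y, y) \<partial>lborel) = ennreal \<bar>-1\<bar> * (\<integral>\<^sup>+s. F (u + ((1/2 - (1 - a) * u) + -1 * s), (1/2 - (1 - a) * u) + -1 * s) \<partial>lborel)"
      by (rule nn_integral_real_affine) auto
    also have "\<dots> = (\<integral>\<^sup>+s. F (e_plus u + s *\<^sub>R d_plus) \<partial>lborel)"
    proof -
      have "(u + ((1/2 - (1 - a) * u) + -1 * s), (1/2 - (1 - a) * u) + -1 * s) = e_plus u + s *\<^sub>R d_plus" for s
        by (simp add: e_plus_def d_plus_def)
      then show ?thesis by simp
    qed
    finally show "(\<integral>\<^sup>+y. F (u + y, y) \<partial>lborel) = (\<integral>\<^sup>+s. F (e_plus u + s *\<^sub>R d_plus) \<partial>lborel)" .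
  qed
  finally show "(\<integral>\<^sup>+p. F p \<partial>lborel) = (\<integral>\<^sup>+u. (\<integral>\<^sup>+s. F (e_plus u + s *\<^sub>R d_plus) \<partial>lborel) \<partial>lborel)" .
qed

lemma lf_base:
  "lf (base n_plus d_plus p) = 1/2" "lf (base n_minus d_minus p) = 1/2"
proof -
  have "lf (base n_plus d_plus p) = lf p + aff n_plus p"
    by (simp add: base_def d_plus_def lf_def algebra_simps)
  then show "lf (base n_plus d_plus p) = 1/2" by (simp add: aff_plus)
  have "lf (base n_minus d_minus p) = lf p - (1 - a) * aff n_minus p"
    by (simp add: base_def d_minus_def lf_def algebra_simps)
  also have "\<dots> = lf p - 2 * ((1 - a) * bb) * (lf p - 1/2)" by (simp add: aff_minus)
  finally show "lf (base n_minus d_minus p) = 1/2" unfolding bc_rel(1) by simp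
qed

lemma fst_on_line:
  assumes "lf q = 1/2" "0 < snd q"
  shows "fst q < bb"
proof -
  have "0 < a * snd q" using assms(2) a_pos by simp
  then have "(1 - a) * fst q < (1 - a) * bb" using assms(1) unfolding lf_def bc_rel(1) by linarith
  then show ?thesis using a_half by simp
qed

lemma chainQ_plus:
  assumes "0 < aff n_plus p" "good_base n_plus d_plus p"
  shows "fst p \<le> 1 \<and> snd p \<le> 1"
proof -
  let ?q = "base n_plus d_plus p"
  have q: "0 < snd ?q" "snd ?q \<le> 1" "fst ?q < bb"
    using assms(2) fst_on_line[OF lf_base(1)] by (auto simp: good_base_def)
  have "fst p = fst ?q - aff n_plus p" "snd p = snd ?q - aff n_plus p" by (simp_all add: base_def d_plus_def)
  then show ?thesis using q bb_less assms(1) by linarith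
qed

text \<open>The relevant part of the folding line has x < \<open>bb\<close>, which leaves a distance
  1 - \<open>bb\<close> to the right edge for the horizontal chain.\<close>

lemma chainQ_minus:
  assumes "aff n_minus p < 1 - bb" "good_base n_minus d_minus p"
  shows "fst p \<le> 1 \<and> snd p \<le> 1"
proof -
  let ?q = "base n_minus d_minus p"
  have q: "0 < snd ?q" "snd ?q \<le> 1" "fst ?q < bb"
    using assms(2) fst_on_line[OF lf_base(2)] by (auto simp: good_base_def)
  have "fst p = fst ?q + aff n_minus p" "snd p = snd ?q" by (simp_all add: base_def d_minus_def)
  then show ?thesis using q bb_less assms(1) by linarith
qed

text \<open>The factors 1/2 and \<open>bb\<close> convert a depth below the top edge into the value
  of \<open>aff n_plus\<close> and \<open>aff n_minus\<close> at the preimage.\<close>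

definition "gplus \<delta> \<tau> = ghost \<delta> (1/2) n_plus d_plus (\<lambda>p. \<tau> (Gm p) :: real)"
definition "gminus \<delta> \<tau> = ghost \<delta> bb n_minus d_minus (\<lambda>p. \<tau> (Gm p) :: real)"

text \<open>The loss term of \<open>ghost_side\<close> with the factor t taken out. It is an
  integral of the density itself, so it can be controlled by mass.\<close>

definition leak :: "real \<Rightarrow> real \<Rightarrow> real \<times> real \<times> real \<Rightarrow> real \<times> real \<Rightarrow> (real \<times> real \<Rightarrow> real) \<Rightarrow> (real \<times> real \<Rightarrow> real) \<Rightarrow> ennreal" where
  "leak \<delta> m n d f \<tau> = (\<integral>\<^sup>+p. ennreal (4 / \<delta> * (m * side_val (\<lambda>p. \<tau> (Gm p)) d (base n d p)) * f p)
      * indicator {p. 0 < aff n p \<and> aff n p < \<delta> \<and> good_base n d p} p \<partial>lborel)"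

definition "leaks \<delta> f \<tau> = leak \<delta> (1/2) n_plus d_plus f \<tau> + leak \<delta> bb n_minus d_minus f \<tau>"

lemma leak_scale:
  assumes f: "f \<in> borel_measurable borel" and \<tau>: "tame \<tau>" and t: "0 < t"
  shows "(\<integral>\<^sup>+p. ennreal (4 * t / \<delta> * (m * side_val (\<lambda>p. \<tau> (Gm p)) d (base n d p)) * f p)
      * indicator {p. 0 < aff n p \<and> aff n p < \<delta> \<and> good_base n d p} p \<partial>lborel) = ennreal t * leak \<delta> m n d f \<tau>"
proof -
  note [measurable] = f
  have [measurable]: "(\<lambda>p. side_val (\<lambda>p. \<tau> (Gm p)) d (base n d p)) \<in> borel_measurable borel"
    by (rule tame_borel[OF tame_affmap[OF tame_side[OF tame_Gm[OF \<tau>]] affmap_base]])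
  show ?thesis unfolding leak_def
  proof (subst nn_integral_cmult[symmetric], measurable, rule nn_integral_cong)
    fix p
    let ?x = "4 / \<delta> * (m * side_val (\<lambda>p. \<tau> (Gm p)) d (base n d p)) * f p"
    have "4 * t / \<delta> * (m * side_val (\<lambda>p. \<tau> (Gm p)) d (base n d p)) * f p
      = t * (4 / \<delta> * (m * side_val (\<lambda>p. \<tau> (Gm p)) d (base n d p)) * f p)" by (simp add: ac_simps)
    then show "ennreal (4 * t / \<delta> * (m * side_val (\<lambda>p. \<tau> (Gm p)) d (base n d p)) * f p) * indicator {p. 0 < aff n p \<and> aff n p < \<delta> \<and> good_base n d p} p
      = ennreal t * (ennreal (4 / \<delta> * (m * side_val (\<lambda>p. \<tau> (Gm p)) d (base n d p)) * f p) * indicator {p. 0 < aff n p \<and> aff n p < \<delta> \<and> good_base n d p} p)"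
      using t ennreal_mult'[of t ?x] by (simp only: mult.assoc less_imp_le)
  qed
qed

text \<open>The new first coordinate is the old second one, so the preimage of a strip at the right
  edge is a strip at the top edge, and nothing is lost.\<close>

lemma RS_step:
  assumes f: "nice f" and r: "tame r"
  shows "RS t (Pop f) r = TS t f (\<lambda>p. r (Gm p))"
proof -
  have [measurable]: "f \<in> borel_measurable borel" and f0: "\<And>p. 0 \<le> f p"
    using f unfolding nice_def by auto
  have [measurable]: "r \<in> borel_measurable borel" by (rule tame_borel[OF r])
  have fG: "fst (Gm p) = snd p" for p by (simp add: Gm_def A1_def A2_def)
  have "(\<lambda>q. indicator {p. 1 - t * r p < fst p \<and> fst p \<le> 1} q :: ennreal) \<in> borel_measurable borel" by measurable
  from push[OF _ f0 this] show ?thesis unfolding RS_def TS_def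
    by (simp add: indicator_def fG)
qed

text \<open>The top edge is the image of the folding line from both sides; its strip pulls back to
  two one-sided strips, each of which is traded for a ghost field.\<close>

lemma TS_step:
  assumes f: "nice f" and \<tau>: "tame \<tau>" and \<tau>0: "\<And>p. 0 \<le> \<tau> p" and \<delta>: "0 < \<delta>" "\<delta> \<le> 1 - bb" and eps: "0 < \<epsilon>"
  shows "eventually (\<lambda>N. TS (tt N) (Pop f) \<tau> \<le> Qt (tt N) f (gplus \<delta> \<tau>) + Qt (tt N) f (gminus \<delta> \<tau>)
     + ennreal (tt N) * leaks \<delta> f \<tau> + ennreal (tt N * \<epsilon>)) sequentially"
proof -
  have fm [measurable]: "f \<in> borel_measurable borel" and f0: "\<And>p. 0 \<le> f p"
    using f unfolding nice_def by auto
  have [measurable]: "\<tau> \<in> borel_measurable borel" by (rule tame_borel[OF \<tau>])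
  have e2: "0 < \<epsilon> / 2" using eps by simp
  have P: "eventually (\<lambda>N. (\<integral>\<^sup>+p. ennreal (f p) * indicator {p. 0 < aff n_plus p \<and> aff n_plus p < tt N * (1/2 * \<tau> (Gm p))} p \<partial>lborel)
    \<le> Qt (tt N) f (gplus \<delta> \<tau>) + ennreal (tt N) * leak \<delta> (1/2) n_plus d_plus f \<tau> + ennreal (tt N * (\<epsilon>/2))) sequentially"
    using ghost_side[OF f adapted_plus \<delta>(1) _ tame_Gm[OF \<tau>] \<tau>0 e2 chainQ_plus, of "1/2"]
    unfolding gplus_def leak_scale[OF fm \<tau> tt_pos] by simp
  have M: "eventually (\<lambda>N. (\<integral>\<^sup>+p. ennreal (f p) * indicator {p. 0 < aff n_minus p \<and> aff n_minus p < tt N * (bb * \<tau> (Gm p))} p \<partial>lborel)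
    \<le> Qt (tt N) f (gminus \<delta> \<tau>) + ennreal (tt N) * leak \<delta> bb n_minus d_minus f \<tau> + ennreal (tt N * (\<epsilon>/2))) sequentially"
  proof -
    have "fst p \<le> 1 \<and> snd p \<le> 1" if "aff n_minus p < \<delta>" "good_base n_minus d_minus p" for p
      by (rule chainQ_minus) (use that \<delta>(2) in auto)
    from ghost_side[OF f adapted_minus \<delta>(1) _ tame_Gm[OF \<tau>] \<tau>0 e2 this, of bb] bb_pos
    show ?thesis unfolding gminus_def leak_scale[OF fm \<tau> tt_pos] by simp
  qed
  from P M show ?thesis
  proof eventually_elim
    case (elim N)
    let ?t = "tt N"
    let ?I1 = "\<lambda>p. ennreal (f p) * indicator {p. 0 < aff n_plus p \<and> aff n_plus p < ?t * (1/2 * \<tau> (Gm p))} p"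
    let ?I2 = "\<lambda>p. ennreal (f p) * indicator {p. 0 < aff n_minus p \<and> aff n_minus p < ?t * (bb * \<tau> (Gm p))} p"
    have [measurable]: "?I1 \<in> borel_measurable borel" "?I2 \<in> borel_measurable borel" by measurable
    have "(\<lambda>q. indicator {p. 1 - ?t * \<tau> p < snd p \<and> snd p \<le> 1} q :: ennreal) \<in> borel_measurable borel" by measurable
    from push[OF _ f0 this] have "TS ?t (Pop f) \<tau> = (\<integral>\<^sup>+p. ennreal (f p) * indicator {p. 1 - ?t * \<tau> p < snd p \<and> snd p \<le> 1} (Gm p) \<partial>lborel)"
      unfolding TS_def by simp
    also have "\<dots> \<le> (\<integral>\<^sup>+p. ?I1 p + ?I2 p \<partial>lborel)"
    proof (rule nn_integral_mono_AE, rule eventually_mono[OF AE_off_line])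
      fix p assume off: "lf p \<noteq> 1/2"
      show "ennreal (f p) * indicator {p. 1 - ?t * \<tau> p < snd p \<and> snd p \<le> 1} (Gm p) \<le> ?I1 p + ?I2 p"
      proof (cases "lf p \<le> 1/2")
        case True
        then have "snd (Gm p) = 2 * lf p" by (simp add: Gm_def A1_def)
        then have "p \<in> {p. 0 < aff n_plus p \<and> aff n_plus p < ?t * (1/2 * \<tau> (Gm p))}" if "1 - ?t * \<tau> (Gm p) < snd (Gm p)"
          using True that off by (simp add: aff_plus)
        then show ?thesis by (auto simp: indicator_def)
      next
        case False
        then have s: "snd (Gm p) = 2 - 2 * lf p" by (simp add: Gm_def A2_def)
        have "p \<in> {p. 0 < aff n_minus p \<and> aff n_minus p < ?t * (bb * \<tau> (Gm p))}" if "1 - ?t * \<tau> (Gm p) < snd (Gm p)"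
        proof -
          have "2 * (lf p - 1/2) < ?t * \<tau> (Gm p)" using that s by simp
          from mult_strict_left_mono[OF this bb_pos] show ?thesis
            using False bb_pos by (simp add: aff_minus ac_simps)
        qed
        then show ?thesis by (auto simp: indicator_def)
      qed
    qed
    also have "\<dots> = (\<integral>\<^sup>+p. ?I1 p \<partial>lborel) + (\<integral>\<^sup>+p. ?I2 p \<partial>lborel)" by (rule nn_integral_add) auto
    also have "\<dots> \<le> (Qt ?t f (gplus \<delta> \<tau>) + ennreal ?t * leak \<delta> (1/2) n_plus d_plus f \<tau> + ennreal (?t * (\<epsilon>/2)))
      + (Qt ?t f (gminus \<delta> \<tau>) + ennreal ?t * leak \<delta> bb n_minus d_minus f \<tau> + ennreal (?t * (\<epsilon>/2)))"
      by (rule add_mono[OF elim])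
    also have "\<dots> = Qt ?t f (gplus \<delta> \<tau>) + Qt ?t f (gminus \<delta> \<tau>) + ennreal ?t * leaks \<delta> f \<tau> + (ennreal (?t * (\<epsilon>/2)) + ennreal (?t * (\<epsilon>/2)))"
      by (simp add: leaks_def distrib_left ac_simps)
    also have "ennreal (?t * (\<epsilon>/2)) + ennreal (?t * (\<epsilon>/2)) = ennreal (?t * \<epsilon>)"
      using eps by (subst ennreal_plus[symmetric]) (auto simp: field_simps)
    finally show ?case .
  qed
qed

lemma tame_ghost:
  assumes "tame \<sigma>"
  shows "tame (ghost \<delta> m n d \<sigma>)"
proof -
  have t1: "tame (\<lambda>p. \<not> aff n p \<le> 0)" by (rule tame_comp[OF tame_aff_le])
  have t2: "tame (\<lambda>p. aff n p < \<delta>)"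
  proof -
    have "(aff n p < \<delta>) = (aff (fst n, fst (snd n), snd (snd n) - \<delta>) p < 0)" for p by (auto simp: aff_def)
    then show ?thesis using tame_aff_less by simp
  qed
  have "tame (\<lambda>q::real\<times>real. \<not> snd q \<le> 0)" "tame (\<lambda>q::real\<times>real. snd q \<le> 1)"
    using tame_comp[OF tame_aff_le[of "(0, 1, 0)"], of Not] tame_aff_le[of "(0, 1, -1)"] by (simp_all add: aff_def)
  from this[THEN tame_affmap, OF affmap_base] have
    t3: "tame (\<lambda>p. \<not> snd (base n d p) \<le> 0)" and t4: "tame (\<lambda>p. snd (base n d p) \<le> 1)" by auto
  have t5: "tame (\<lambda>p. (m * side_val \<sigma> d (base n d p)) *\<^sub>R d)"
    by (rule tame_comp[OF tame_affmap[OF tame_side[OF assms] affmap_base]])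
  have "ghost \<delta> m n d \<sigma> = (\<lambda>p. if (\<not> aff n p \<le> 0 \<and> aff n p < \<delta>) \<and> (\<not> snd (base n d p) \<le> 0 \<and> snd (base n d p) \<le> 1)
     then (m * side_val \<sigma> d (base n d p)) *\<^sub>R d else 0)"
    by (rule ext) (auto simp: ghost_def good_base_def not_less not_le)
  then show ?thesis
    using tame_if[OF tame_comp2[OF tame_comp2[OF t1 t2, of "(\<and>)"] tame_comp2[OF t3 t4, of "(\<and>)"], of "(\<and>)"] t5 tame_const]
    by simp
qed

text \<open>A configuration collects displacement fields, widths of strips at the right edge and widths of strips at the top edge.\<close>

type_synonym config = "(real \<times> real \<Rightarrow> real \<times> real) list \<times> (real \<times> real \<Rightarrow> real) list \<times> (real \<times> real \<Rightarrow> real) list"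

definition Val :: "real \<Rightarrow> (real \<times> real \<Rightarrow> real) \<Rightarrow> config \<Rightarrow> ennreal" where
  "Val t f c = (\<Sum>h\<leftarrow>fst c. Qt t f h) + (\<Sum>r\<leftarrow>fst (snd c). RS t f r) + (\<Sum>\<tau>\<leftarrow>snd (snd c). TS t f \<tau>)"

definition okc :: "config \<Rightarrow> bool" where
  "okc c \<longleftrightarrow> (\<forall>h\<in>set (fst c). tame h) \<and> (\<forall>r\<in>set (fst (snd c)). tame r \<and> (\<forall>p. 0 \<le> r p)) \<and>
     (\<forall>\<tau>\<in>set (snd (snd c)). tame \<tau> \<and> (\<forall>p. 0 \<le> \<tau> p))"

text \<open>The configuration for the density with one application of \<open>Pop\<close> removed:
  fields emit right strips, right strips become top strips, and each top strip becomes two ghost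
  fields.\<close>

definition stepc :: "real \<Rightarrow> config \<Rightarrow> config" where
  "stepc \<delta> c = (map Up (fst c) @ map (gplus \<delta>) (snd (snd c)) @ map (gminus \<delta>) (snd (snd c)),
     map Rr (fst c), map (\<lambda>r p. r (Gm p)) (fst (snd c)))"

definition "Leak \<delta> f c = (\<Sum>\<tau>\<leftarrow>snd (snd (c :: config)). leaks \<delta> f \<tau>)"

lemma nonneg_pair: "\<forall>a b. 0 \<le> r (a, b) \<Longrightarrow> (0::real) \<le> r q"
  by (cases q) simp

lemma okc_stepc: "okc c \<Longrightarrow> okc (stepc \<delta> c)"
  unfolding okc_def stepc_def
  by (auto simp: tame_Up tame_Rr tame_Gm gplus_def gminus_def intro!: tame_ghost) (auto simp: Rr_def intro: nonneg_pair)

lemma config_step: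
  assumes f: "nice f" and c: "okc c" and \<delta>: "0 < \<delta>" "\<delta> \<le> 1 - bb" and eps: "0 < \<epsilon>"
  shows "eventually (\<lambda>N. Val (tt N) (Pop f) c \<le> Val (tt N) f (stepc \<delta> c) + ennreal (tt N) * Leak \<delta> f c + ennreal (tt N * \<epsilon>)) sequentially"
proof -
  obtain hs rs ts where cc: "c = (hs, rs, ts)" by (cases c) auto
  have ok: "\<And>h. h \<in> set hs \<Longrightarrow> tame h" "\<And>r. r \<in> set rs \<Longrightarrow> tame r" "\<And>\<tau>. \<tau> \<in> set ts \<Longrightarrow> tame \<tau>"
    "\<And>\<tau> p. \<tau> \<in> set ts \<Longrightarrow> 0 \<le> \<tau> p" using c by (auto simp: okc_def cc)
  have e2: "0 < \<epsilon>/2" using eps by simp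
  have Q: "eventually (\<lambda>N. (\<Sum>h\<leftarrow>hs. Qt (tt N) (Pop f) h) \<le> (\<Sum>h\<leftarrow>hs. Qt (tt N) f (Up h) + RS (tt N) f (Rr h)) + ennreal (tt N * (\<epsilon>/2))) sequentially"
  proof (rule sum_list_eventually_le[OF _ e2])
    fix h \<epsilon> assume h: "h \<in> set hs" and "0 < (\<epsilon>::real)"
    have fin: "finite (range h)" by (rule tame_finite_range[OF ok(1)[OF h]])
    define C where "C = Max ((\<lambda>v. \<bar>fst (B1 v)\<bar>) ` range h)"
    have C: "\<bar>fst (B1 (h p))\<bar> \<le> C" for p unfolding C_def using fin by (intro Max_ge) auto
    have "eventually (\<lambda>N. tt N * C \<le> 1 - bb) sequentially" using bb_less by (intro eventually_tt_mult_le) simp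
    then show "eventually (\<lambda>N. Qt (tt N) (Pop f) h \<le> Qt (tt N) f (Up h) + RS (tt N) f (Rr h) + ennreal (tt N * \<epsilon>)) sequentially"
    proof eventually_elim
      case (elim N)
      have "tt N * \<bar>fst (B1 (h p))\<bar> \<le> 1 - bb" for p
        using mult_left_mono[OF C[of p] tt_nonneg, of N] elim by linarith
      from Qt_step[OF f ok(1)[OF h] tt_pos this] show ?case by (simp add: add_increasing2)
    qed
  qed
  have T: "eventually (\<lambda>N. (\<Sum>\<tau>\<leftarrow>ts. TS (tt N) (Pop f) \<tau>) \<le> (\<Sum>\<tau>\<leftarrow>ts. Qt (tt N) f (gplus \<delta> \<tau>) + Qt (tt N) f (gminus \<delta> \<tau>)
     + ennreal (tt N) * leaks \<delta> f \<tau>) + ennreal (tt N * (\<epsilon>/2))) sequentially"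
    by (rule sum_list_eventually_le[OF _ e2]) (rule TS_step[OF f ok(3,4) \<delta>])
  from Q T show ?thesis
  proof eventually_elim
    case (elim N)
    have R: "(\<Sum>r\<leftarrow>rs. RS (tt N) (Pop f) r) = (\<Sum>r\<leftarrow>rs. TS (tt N) f (\<lambda>p. r (Gm p)))"
      by (intro arg_cong[of _ _ sum_list] map_cong refl RS_step f ok)
    have e: "ennreal (tt N * \<epsilon>) = ennreal (tt N * (\<epsilon>/2)) + ennreal (tt N * (\<epsilon>/2))"
      using eps by (subst ennreal_plus[symmetric]) (auto simp: field_simps)
    show ?case
      unfolding Val_def stepc_def Leak_def cc fst_conv snd_conv R e
      using add_mono[OF elim]
      by (simp add: sum_list_addf sum_list_const_mult comp_def ac_simps)
  qed
qed

text \<open>The outermost application of \<open>Pop\<close> is moved onto the configuration first,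
  so the j-th configuration meets the density that still has n - j - 1 applications left.\<close>

lemma config_iterate:
  assumes f: "nice f" and c: "okc c" and \<delta>: "0 < \<delta>" "\<delta> \<le> 1 - bb" and eps: "0 < \<epsilon>"
  shows "eventually (\<lambda>N. Val (tt N) ((Pop ^^ n) f) c \<le> Val (tt N) f ((stepc \<delta> ^^ n) c)
    + ennreal (tt N) * (\<Sum>j<n. Leak \<delta> ((Pop ^^ (n - Suc j)) f) ((stepc \<delta> ^^ j) c)) + ennreal (tt N * \<epsilon>)) sequentially"
  using c eps
proof (induction n arbitrary: c \<epsilon>)
  case (Suc n)
  have nf: "nice ((Pop ^^ n) f)" by (induction n) (auto simp: f nice_Pop)
  have e2: "0 < \<epsilon>/2" using Suc.prems by simp
  have 1: "eventually (\<lambda>N. Val (tt N) (Pop ((Pop ^^ n) f)) c \<le> Val (tt N) ((Pop ^^ n) f) (stepc \<delta> c) + ennreal (tt N) * Leak \<delta> ((Pop ^^ n) f) c + ennreal (tt N * (\<epsilon>/2))) sequentially"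
    by (rule config_step[OF nf Suc.prems(1) \<delta> e2])
  have 2: "eventually (\<lambda>N. Val (tt N) ((Pop ^^ n) f) (stepc \<delta> c) \<le> Val (tt N) f ((stepc \<delta> ^^ n) (stepc \<delta> c))
    + ennreal (tt N) * (\<Sum>j<n. Leak \<delta> ((Pop ^^ (n - Suc j)) f) ((stepc \<delta> ^^ j) (stepc \<delta> c))) + ennreal (tt N * (\<epsilon>/2))) sequentially"
    by (rule Suc.IH[OF okc_stepc[OF Suc.prems(1)] e2])
  from 1 2 show ?case
  proof eventually_elim
    case (elim N)
    have e: "ennreal (tt N * \<epsilon>) = ennreal (tt N * (\<epsilon>/2)) + ennreal (tt N * (\<epsilon>/2))"
      using Suc.prems(2) by (subst ennreal_plus[symmetric]) (auto simp: field_simps)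
    have s: "(\<Sum>j<Suc n. Leak \<delta> ((Pop ^^ (Suc n - Suc j)) f) ((stepc \<delta> ^^ j) c))
      = Leak \<delta> ((Pop ^^ n) f) c + (\<Sum>j<n. Leak \<delta> ((Pop ^^ (n - Suc j)) f) ((stepc \<delta> ^^ j) (stepc \<delta> c)))"
      by (subst sum.lessThan_Suc_shift) (simp add: funpow_swap1)
    have st: "(stepc \<delta> ^^ Suc n) c = (stepc \<delta> ^^ n) (stepc \<delta> c)" by (simp add: funpow_swap1)
    have P: "(Pop ^^ Suc n) f = Pop ((Pop ^^ n) f)" by simp
    show ?case unfolding s st P e
      using order_trans[OF elim(1) add_right_mono[OF add_right_mono[OF elim(2)]]]
      by (simp add: distrib_left ac_simps)
  qed
qed (simp add: Val_def)

end

section \<open>The contraction certificate\<close>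

text \<open>The states record where a point is relative to the folding line: \<open>T\<close>, \<open>TD\<close>, \<open>Tx\<close>, \<open>T3\<close> are pieces of the top edge
  (images of the folding line), \<open>R\<close>, \<open>RD\<close>, \<open>Rx\<close>, \<open>R3\<close> the subsequent pieces of the right edge, and \<open>F0\<close> to \<open>F3\<close> count
  consecutive visits to the first branch; the other states follow the orbit after the right edge. The unit ball of the norm on displacement vectors in a state is cut out by the covectors in \<open>covs\<close>
  and their negatives; the table was found numerically by iterating the contraction condition.\<close>

datatype state = F0 | F1 | F2 | F3 | T | TD | RD | D3 | D4 | D5 | D6 | D7 | R | S3 | S4a | S4b | S5a | S6a | S5b | S6b | S7b | S8b | Tx | Rx | S3x | T3 | R3 | W0 | W1 | W2 | W3

fun covs :: "state \<Rightarrow> (int \<times> int) list" where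
  "covs F0 = [(38, -737), (466, -475), (561, -373), (734, -112), (786, 80), (762, 296), (723, 456), (596, 608), (480, 714), (367, 749)]"
| "covs F1 = [(91, -707), (597, -394), (662, -327), (786, 80), (367, 749)]"
| "covs F2 = [(531, -530), (632, -419), (750, -64), (786, 80), (367, 749)]"
| "covs F3 = [(651, -463), (867, -253), (556, 738)]"
| "covs T = [(333, -912), (914, -382), (1071, -91), (1229, 478), (1165, 669), (490, 1055)]"
| "covs TD = [(984, -906), (1353, -10), (1534, 559), (277, 1816), (0, 1895)]"
| "covs RD = [(793, -1213), (2000, 93), (1302, 690), (541, 949), (0, 1085)]"
| "covs D3 = [(264, -874), (779, -363), (1200, 119), (1537, 556), (680, 1413)]"
| "covs D4 = [(351, -841), (673, -546), (986, -185), (1205, 468), (0, 1109)]"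
| "covs D5 = [(574, -692), (815, -472), (987, -246), (1322, 373), (0, 845)]"
| "covs D6 = [(625, -799), (990, -315), (1047, 519), (0, 1038)]"
| "covs D7 = [(113, -734), (651, -463), (1018, -80), (1068, 51), (1053, 438), (707, 694)]"
| "covs R = [(623, -801), (1118, -146), (1256, 534), (454, 768), (0, 862)]"
| "covs S3 = [(88, -880), (625, -305), (1058, 232), (1054, 437), (586, 784), (347, 862)]"
| "covs S4a = [(130, -784), (553, -438), (1085, 107), (1205, 468), (439, 1181)]"
| "covs S4b = [(91, -707), (597, -394), (755, -233), (1030, 263), (119, 817)]"
| "covs S5a = [(318, -761), (660, -388), (842, -91), (1047, 294), (0, 845)]"
| "covs S6a = [(113, -734), (422, -591), (651, -463), (867, -253), (1018, -80), (707, 694), (0, 759)]"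
| "covs S5b = [(139, -722), (531, -530), (632, -419), (750, -64), (786, 80), (367, 749)]"
| "covs S6b = [(651, -463), (867, -253), (556, 738)]"
| "covs S7b = [(625, -799), (990, -315), (689, 871)]"
| "covs S8b = [(113, -734), (651, -463), (1053, 438), (707, 694)]"
| "covs Tx = [(363, -1679), (681, -1172), (1095, -24), (1300, 793), (277, 1816)]"
| "covs Rx = [(436, -937), (986, -1004), (2000, 93), (1839, 254), (1451, 477), (454, 768)]"
| "covs S3x = [(625, -305), (1117, 306), (1402, 692), (680, 1413), (159, 1127), (0, 974)]"
| "covs T3 = [(1031, -785), (1959, 135), (348, 1745)]"
| "covs R3 = [(413, -1583), (741, -1270), (1198, -723), (1715, 378)]"
| "covs W0 = [(1761, 290), (1573, 520), (1200, 840), (261, 1215)]"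
| "covs W1 = [(450, -806), (1140, -175), (398, 1235), (0, 1064)]"
| "covs W2 = [(625, -799), (990, -315), (1053, -141), (1115, 267)]"
| "covs W3 = [(651, -463), (1053, 438), (707, 694), (556, 738), (167, 782)]"

text \<open>Transitions along the two branches; \<open>event_next\<close> applies instead of them within \<open>dl\<close> of the folding line, where
  \<open>None\<close> means that the state cannot occur there.\<close>

fun plus_next :: "state \<Rightarrow> state option" where
  "plus_next F0 = Some F1"
| "plus_next F1 = Some F2"
| "plus_next F2 = Some F3"
| "plus_next T = Some R"
| "plus_next D3 = Some D4"
| "plus_next D4 = Some D5"
| "plus_next D5 = Some D6"
| "plus_next S3 = Some S4a"
| "plus_next S4a = Some S5a"
| "plus_next S4b = Some S5b"
| "plus_next S5a = Some S6a"
| "plus_next S5b = Some S6b"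
| "plus_next S6b = Some S7b"
| "plus_next S3x = Some S4a"
| "plus_next T3 = Some R3"
| "plus_next W1 = Some W2"
| "plus_next _ = None"

fun minus_next :: "state \<Rightarrow> state option" where
  "minus_next F0 = Some F0"
| "minus_next F1 = Some F0"
| "minus_next F2 = Some F0"
| "minus_next F3 = Some F0"
| "minus_next T = Some R"
| "minus_next TD = Some RD"
| "minus_next RD = Some D3"
| "minus_next D5 = Some D6"
| "minus_next D6 = Some D7"
| "minus_next D7 = Some F0"
| "minus_next R = Some S3"
| "minus_next S3 = Some S4b"
| "minus_next S5a = Some S6a"
| "minus_next S6a = Some F0"
| "minus_next S5b = Some F0"
| "minus_next S6b = Some F0"
| "minus_next S7b = Some S8b"
| "minus_next S8b = Some F0"
| "minus_next Tx = Some Rx"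
| "minus_next Rx = Some S3x"
| "minus_next R3 = Some W0"
| "minus_next W0 = Some W1"
| "minus_next W2 = Some W3"
| "minus_next W3 = Some F0"
| "minus_next _ = None"

fun event_next :: "state \<Rightarrow> state option" where
  "event_next F0 = Some T"
| "event_next F1 = Some T"
| "event_next F2 = Some T"
| "event_next T = Some TD"
| "event_next D5 = Some Tx"
| "event_next S3 = Some T3"
| "event_next S5a = Some Tx"
| "event_next S5b = Some T"
| "event_next S6b = Some Tx"
| "event_next _ = None"

text \<open>The piece of the right edge that contains the image of a piece of the top edge,
  whichever branch applies.\<close>

fun right_of :: "state \<Rightarrow> state" where
  "right_of T = R" | "right_of TD = RD" | "right_of Tx = Rx" | "right_of T3 = R3" | "right_of s = s"

fun inner_of :: "state \<Rightarrow> state" where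
  "inner_of R = S3" | "inner_of RD = D3" | "inner_of Rx = S3x" | "inner_of R3 = W0" | "inner_of s = s"

text \<open>The weights \<open>\<kappa>\<close>, in units of \<open>1/10000000\<close>: in the states near the edges of the square a budget
  \<open>\<lambda>\<close> for the fields comes with the budget \<open>\<kappa> \<lambda>\<close> for the widths of the strips. The step from a top strip to a
  right strip has to gain the factor \<open>0.999\<close> as well, whence the slightly smaller right weights.\<close>

fun top_weight :: "state \<Rightarrow> int" where
  "top_weight T = 8440" | "top_weight TD = 5186" | "top_weight Tx = 5186" | "top_weight T3 = 6457" | "top_weight _ = 0"

fun right_weight :: "state \<Rightarrow> int" where
  "right_weight R = 8430" | "right_weight RD = 5180" | "right_weight Rx = 5180" | "right_weight R3 = 6450" | "right_weight _ = 0"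

definition det2 :: "int \<times> int \<Rightarrow> int \<times> int \<Rightarrow> int" where
  "det2 u v = fst u * snd v - snd u * fst v"

text \<open>The covector \<open>m / 4000\<close> is dominated by \<open>\<beta> / 200000000000\<close> times the largest of the covectors in \<open>ls\<close>:
  it is a combination of two of them whose coefficients (Cramer's rule) are small.\<close>

definition dominated :: "(int \<times> int) list \<Rightarrow> int \<times> int \<Rightarrow> int \<Rightarrow> bool" where
  "dominated ls m \<beta> \<longleftrightarrow> list_ex (\<lambda>u. list_ex (\<lambda>v. det2 u v \<noteq> 0 \<and>
     200000000000 * (\<bar>det2 m v\<bar> + \<bar>det2 u m\<bar>) \<le> 4000 * \<beta> * \<bar>det2 u v\<bar>) ls) ls"

text \<open>With \<open>c = C / 2000\<close> the parameter range is \<open>658 \<le> C \<le> 777\<close>; all conditions are affine in \<open>C\<close>.\<close>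

definition pull_cov :: "int \<Rightarrow> int \<Rightarrow> int \<times> int \<Rightarrow> int \<times> int" where
  "pull_cov e C l = (4000 * snd l - 2 * C * fst l, e * (2000 + C) * fst l)"

text \<open>199800000000 stands for 0.999 in the units of \<open>dominated\<close>;
  \<open>loss\<close> reserves the room that ghost fields will fill.\<close>

definition contracts :: "int \<Rightarrow> state \<Rightarrow> state \<Rightarrow> (int \<times> int \<Rightarrow> int) \<Rightarrow> bool" where
  "contracts e s s' loss \<longleftrightarrow> list_all (\<lambda>l. dominated (covs s') (pull_cov e 658 l) (199800000000 - loss l)
     \<and> dominated (covs s') (pull_cov e 777 l) (199800000000 - loss l)) (covs s)"

text \<open>The losses are 20000 times the weight times the chain factor, 20000 being the ratio of
  the two units. The factor is 1/2 for the first branch, and for the second 0.69425, the largest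
  value of (1 + c) / 2 in the range.\<close>

definition check_state :: "state \<Rightarrow> bool" where
  "check_state s \<longleftrightarrow>
     (case plus_next s of None \<Rightarrow> True | Some s' \<Rightarrow> contracts 1 s s' (\<lambda>l. 0)) \<and>
     (case minus_next s of None \<Rightarrow> True | Some s' \<Rightarrow> contracts (-1) s s' (\<lambda>l. 0)) \<and>
     (case event_next s of None \<Rightarrow> True | Some s' \<Rightarrow>
        contracts 1 s s' (\<lambda>l. 10000 * top_weight s' * \<bar>fst l + snd l\<bar>) \<and>
        contracts (-1) s s' (\<lambda>l. 13885 * top_weight s' * \<bar>fst l\<bar>))"

text \<open>The covector is 4000 times (c, (1 + c) / 2), which occurs in \<open>Rr\<close>; 19980 is
  0.999 times the ratio 20000 of the units.\<close>

definition check_right :: "state \<Rightarrow> bool" where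
  "check_right s \<longleftrightarrow> (\<forall>C\<in>{658, 777}. dominated (covs (inner_of s)) (2 * C, 2000 + C) (19980 * right_weight s))"

lemma check_right: "list_all check_right [R, RD, Rx, R3]"
  by code_simp

lemma check_states_1: "list_all check_state [F0]"
  by code_simp

lemma check_states_2: "list_all check_state [F1, F2, F3, T, TD]"
  by code_simp

lemma check_states_3: "list_all check_state [RD, D3, D4, D5, D6, D7]"
  by code_simp

lemma check_states_4: "list_all check_state [R, S3, S4a, S4b]"
  by code_simp

lemma check_states_5: "list_all check_state [S5a, S6a, S5b, S6b]"
  by code_simp

lemma check_states_6: "list_all check_state [S7b, S8b, Tx, Rx, S3x, T3]"
  by code_simp

lemma check_states_7: "list_all check_state [R3, W0, W1, W2, W3]"
  by code_simp

lemma check_all: "check_state s"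
  using check_states_1 check_states_2 check_states_3 check_states_4 check_states_5 check_states_6 check_states_7
  by (cases s) simp_all

section \<open>From the integer checks to real inequalities\<close>

definition dot :: "int \<times> int \<Rightarrow> real \<times> real \<Rightarrow> real" where
  "dot l x = of_int (fst l) * fst x + of_int (snd l) * snd x"

text \<open>All fields are added up for one covector, before any maximum over covectors is taken.
  This keeps the number of fields, which may grow from step to step, out of the estimates.\<close>

definition cov_sum :: "int \<times> int \<Rightarrow> (real \<times> real) list \<Rightarrow> real" where
  "cov_sum l xs = (\<Sum>x\<leftarrow>xs. \<bar>dot l x\<bar>)"

lemma cov_sum_nonneg: "0 \<le> cov_sum l xs"
  unfolding cov_sum_def by (rule sum_list_nonneg) auto

text \<open>Cramer's identity det(u, v) m = det(m, v) u + det(u, m) v is applied to each vector of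
  the list; the triangle inequality is summed.\<close>

lemma dominated_sum:
  assumes d: "dominated ls m \<beta>" and b: "\<And>l. l \<in> set ls \<Longrightarrow> cov_sum l xs \<le> lam"
  shows "cov_sum m xs \<le> 4000 * (of_int \<beta> / 200000000000) * lam"
proof -
  obtain u v where uv: "u \<in> set ls" "v \<in> set ls" "det2 u v \<noteq> 0"
    "200000000000 * (\<bar>det2 m v\<bar> + \<bar>det2 u m\<bar>) \<le> 4000 * \<beta> * \<bar>det2 u v\<bar>"
    using d unfolding dominated_def list_ex_iff by blast
  have lam0: "0 \<le> lam" using order_trans[OF cov_sum_nonneg b[OF uv(1)]] .
  have pt: "\<bar>real_of_int (det2 u v)\<bar> * \<bar>dot m x\<bar> \<le> \<bar>real_of_int (det2 m v)\<bar> * \<bar>dot u x\<bar> + \<bar>real_of_int (det2 u m)\<bar> * \<bar>dot v x\<bar>" for x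
  proof -
    have "real_of_int (det2 u v) * dot m x = real_of_int (det2 m v) * dot u x + real_of_int (det2 u m) * dot v x"
      by (simp add: det2_def dot_def algebra_simps)
    then show ?thesis by (metis abs_mult abs_triangle_ineq)
  qed
  have "\<bar>real_of_int (det2 u v)\<bar> * cov_sum m xs = (\<Sum>x\<leftarrow>xs. \<bar>real_of_int (det2 u v)\<bar> * \<bar>dot m x\<bar>)"
    by (simp add: cov_sum_def sum_list_const_mult)
  also have "\<dots> \<le> (\<Sum>x\<leftarrow>xs. \<bar>real_of_int (det2 m v)\<bar> * \<bar>dot u x\<bar> + \<bar>real_of_int (det2 u m)\<bar> * \<bar>dot v x\<bar>)"
    by (rule sum_list_mono) (rule pt)
  also have "\<dots> = \<bar>real_of_int (det2 m v)\<bar> * cov_sum u xs + \<bar>real_of_int (det2 u m)\<bar> * cov_sum v xs"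
    by (simp add: cov_sum_def sum_list_addf sum_list_const_mult)
  also have "\<dots> \<le> \<bar>real_of_int (det2 m v)\<bar> * lam + \<bar>real_of_int (det2 u m)\<bar> * lam"
    by (intro add_mono mult_left_mono b uv) auto
  also have "\<dots> = (\<bar>real_of_int (det2 m v)\<bar> + \<bar>real_of_int (det2 u m)\<bar>) * lam" by (simp add: algebra_simps)
  also have "\<dots> \<le> 4000 * (of_int \<beta> / 200000000000) * \<bar>real_of_int (det2 u v)\<bar> * lam"
  proof (rule mult_right_mono[OF _ lam0])
    have "real_of_int (200000000000 * (\<bar>det2 m v\<bar> + \<bar>det2 u m\<bar>)) \<le> real_of_int (4000 * \<beta> * \<bar>det2 u v\<bar>)"
      using uv(4) by (rule of_int_le_iff[THEN iffD2])
    then show "\<bar>real_of_int (det2 m v)\<bar> + \<bar>real_of_int (det2 u m)\<bar> \<le> 4000 * (of_int \<beta> / 200000000000) * \<bar>real_of_int (det2 u v)\<bar>"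
      by simp
  qed
  finally have "\<bar>real_of_int (det2 u v)\<bar> * cov_sum m xs \<le> \<bar>real_of_int (det2 u v)\<bar> * (4000 * (of_int \<beta> / 200000000000) * lam)"
    by (simp add: ac_simps)
  then show ?thesis using uv(3) by simp
qed

text \<open>Each summand is the absolute value of an affine function of C, hence convex, so the two
  end points of the parameter range suffice.\<close>

lemma interpolate_sum:
  fixes c u1 v1 u2 v2 :: real
  assumes c: "658 \<le> C" "C \<le> 777"
    and "(\<Sum>x\<leftarrow>xs. \<bar>F 658 x\<bar>) \<le> B" "(\<Sum>x\<leftarrow>xs. \<bar>F 777 x\<bar>) \<le> B"
    and affine: "\<And>x. F C x = (777 - C) / 119 * F 658 x + (C - 658) / 119 * F 777 x"
  shows "(\<Sum>x\<leftarrow>xs. \<bar>F C x\<bar>) \<le> (B::real)"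
proof -
  have "(\<Sum>x\<leftarrow>xs. \<bar>F C x\<bar>) \<le> (\<Sum>x\<leftarrow>xs. (777 - C) / 119 * \<bar>F 658 x\<bar> + (C - 658) / 119 * \<bar>F 777 x\<bar>)"
  proof (rule sum_list_mono)
    fix x
    show "\<bar>F C x\<bar> \<le> (777 - C) / 119 * \<bar>F 658 x\<bar> + (C - 658) / 119 * \<bar>F 777 x\<bar>"
      unfolding affine[of x] using c
      by (intro order_trans[OF abs_triangle_ineq]) (simp add: abs_mult)
  qed
  also have "\<dots> = (777 - C) / 119 * (\<Sum>x\<leftarrow>xs. \<bar>F 658 x\<bar>) + (C - 658) / 119 * (\<Sum>x\<leftarrow>xs. \<bar>F 777 x\<bar>)"
    by (simp only: sum_list_addf sum_list_const_mult)
  also have "\<dots> \<le> (777 - C) / 119 * B + (C - 658) / 119 * B"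
    using assms by (intro add_mono mult_left_mono) auto
  also have "\<dots> = B" by (simp add: field_simps)
  finally show ?thesis .
qed

lemma contracts_sum:
  assumes ct: "contracts e s s' loss" and l: "l \<in> set (covs s)"
    and c: "658 / 2000 \<le> c" "c \<le> 777 / 2000" and b: "\<And>l. l \<in> set (covs s') \<Longrightarrow> cov_sum l xs \<le> lam"
  shows "(\<Sum>x\<leftarrow>xs. \<bar>(of_int (snd l) - c * of_int (fst l)) * fst x + of_int e * ((1 + c) / 2) * of_int (fst l) * snd x\<bar>)
    \<le> (of_int (199800000000 - loss l) / 200000000000) * lam"
proof -
  define F where "F C x = (4000 * of_int (snd l) - 2 * C * of_int (fst l)) * fst x + of_int e * (2000 + C) * of_int (fst l) * snd x" for C and x :: "real \<times> real"
  let ?B = "4000 * (of_int (199800000000 - loss l) / 200000000000) * lam"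
  have ds: "dominated (covs s') (pull_cov e 658 l) (199800000000 - loss l)"
    "dominated (covs s') (pull_cov e 777 l) (199800000000 - loss l)"
    using ct l unfolding contracts_def list_all_iff by blast+
  have cs: "cov_sum (pull_cov e C l) xs = (\<Sum>x\<leftarrow>xs. \<bar>F (of_int C) x\<bar>)" for C
    unfolding cov_sum_def dot_def pull_cov_def F_def by simp
  have 1: "(\<Sum>x\<leftarrow>xs. \<bar>F 658 x\<bar>) \<le> ?B" using dominated_sum[OF ds(1) b] unfolding cs by simp
  have 2: "(\<Sum>x\<leftarrow>xs. \<bar>F 777 x\<bar>) \<le> ?B" using dominated_sum[OF ds(2) b] unfolding cs by simp
  have "(\<Sum>x\<leftarrow>xs. \<bar>F (2000 * c) x\<bar>) \<le> ?B"
    by (rule interpolate_sum[OF _ _ 1 2]) (use c in \<open>auto simp: F_def field_simps\<close>)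
  moreover have "(\<Sum>x\<leftarrow>xs. \<bar>F (2000 * c) x\<bar>) = 4000 * (\<Sum>x\<leftarrow>xs. \<bar>(of_int (snd l) - c * of_int (fst l)) * fst x + of_int e * ((1 + c) / 2) * of_int (fst l) * snd x\<bar>)"
  proof -
    have "\<bar>F (2000 * c) x\<bar> = 4000 * \<bar>(of_int (snd l) - c * of_int (fst l)) * fst x + of_int e * ((1 + c) / 2) * of_int (fst l) * snd x\<bar>" for x
    proof -
      have "F (2000 * c) x = 4000 * ((of_int (snd l) - c * of_int (fst l)) * fst x + of_int e * ((1 + c) / 2) * of_int (fst l) * snd x)"
        unfolding F_def by (simp add: field_simps)
      then show ?thesis by (simp only: abs_mult abs_numeral)
    qed
    then show ?thesis by (simp add: sum_list_const_mult)
  qed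
  ultimately show ?thesis by (simp add: algebra_simps)
qed

lemma right_sum:
  assumes ck: "check_right s" and c: "658 / 2000 \<le> c" "c \<le> 777 / 2000"
    and b: "\<And>l. l \<in> set (covs (inner_of s)) \<Longrightarrow> cov_sum l xs \<le> lam"
  shows "(\<Sum>x\<leftarrow>xs. \<bar>c * fst x + (1 + c) / 2 * snd x\<bar>) \<le> 999 / 1000 * lam * (of_int (right_weight s) / 10000000)"
proof -
  define F where "F C x = 2 * C * fst x + (2000 + C) * snd x" for C :: real and x :: "real \<times> real"
  let ?B = "4000 * (of_int (19980 * right_weight s) / 200000000000) * lam"
  have ds: "dominated (covs (inner_of s)) (2 * 658, 2000 + 658) (19980 * right_weight s)"
    "dominated (covs (inner_of s)) (2 * 777, 2000 + 777) (19980 * right_weight s)"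
    using ck unfolding check_right_def by blast+
  have 1: "(\<Sum>x\<leftarrow>xs. \<bar>F 658 x\<bar>) \<le> ?B" using dominated_sum[OF ds(1) b] by (simp add: cov_sum_def dot_def F_def)
  have 2: "(\<Sum>x\<leftarrow>xs. \<bar>F 777 x\<bar>) \<le> ?B" using dominated_sum[OF ds(2) b] by (simp add: cov_sum_def dot_def F_def)
  have "(\<Sum>x\<leftarrow>xs. \<bar>F (2000 * c) x\<bar>) \<le> ?B"
    by (rule interpolate_sum[OF _ _ 1 2]) (use c in \<open>auto simp: F_def field_simps\<close>)
  moreover have "(\<Sum>x\<leftarrow>xs. \<bar>F (2000 * c) x\<bar>) = 4000 * (\<Sum>x\<leftarrow>xs. \<bar>c * fst x + (1 + c) / 2 * snd x\<bar>)"
  proof -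
    have "\<bar>F (2000 * c) x\<bar> = 4000 * \<bar>c * fst x + (1 + c) / 2 * snd x\<bar>" for x
    proof -
      have "F (2000 * c) x = 4000 * (c * fst x + (1 + c) / 2 * snd x)"
        unfolding F_def by (simp add: field_simps)
      then show ?thesis by (simp only: abs_mult abs_numeral)
    qed
    then show ?thesis by (simp add: sum_list_const_mult)
  qed
  ultimately show ?thesis by (simp add: algebra_simps)
qed

section \<open>The regions of the states\<close>

locale memory_range = memory_map +
  assumes a_lo: "2476 / 10000 \<le> a" and a_hi: "a \<le> 27978 / 100000"
begin

lemma cc_range: "658 / 2000 \<le> cc" "cc \<le> 777 / 2000" and bb_cc: "bb = (1 + cc) / 2"
  using a_lo a_hi by (auto simp: cc_def bb_def field_simps)

text \<open>The chord over the parameter interval and the tangent at its right end enclose a^2. With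
  these, polynomial inequalities in a become linear in a and a * a.\<close>

lemma a_square: "a * a \<le> 52738/100000 * a - 6927/100000" "55956/100000 * a - 7828/100000 \<le> a * a"
  "613/10000 \<le> a * a" "a * a \<le> 783/10000"
proof -
  have "0 \<le> (a - 2476/10000) * (27978/100000 - a)" using a_lo a_hi by simp
  also have "\<dots> = 52738/100000 * a - 2476/10000 * (27978/100000) - a * a" by (simp add: field_simps)
  finally show "a * a \<le> 52738/100000 * a - 6927/100000" by linarith
  have "0 \<le> (27978/100000 - a) * (27978/100000 - a)" by simp
  also have "\<dots> = a * a - 55956/100000 * a + 27978/100000 * (27978/100000)" by (simp add: field_simps)
  finally show "55956/100000 * a - 7828/100000 \<le> a * a" by linarith
  have "(2476/10000) * (2476/10000) \<le> a * a" "a * a \<le> (27978/100000) * (27978/100000)"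
    using a_lo a_hi by (intro mult_mono; simp)+
  then show "613/10000 \<le> a * a" "a * a \<le> 783/10000" by simp_all
qed

text \<open>The common thickness of all neighbourhoods of edges and of the folding line; it has to
  be below the margins of the strict inequalities for the orbits.\<close>

definition dl :: real where "dl = 1 / 100000"

text \<open>A forward invariant set that carries all densities. As the region of \<open>F0\<close>
  it guarantees that every relevant point has a state.\<close>

definition "X0 = {p \<in> square. 2 * a \<le> fst p + snd p}"
definition "plus_img S = A1 ` {p \<in> S. lf p \<le> 1/2}"
definition "minus_img S = A2 ` {p \<in> S. 1/2 < lf p}"
text \<open>\<open>A2\<close> maps the right edge onto the segment from (1, 0) to (0, 2a), on which
  y = 2a (1 - x). This is a thickening of that segment.\<close>

definition "E3 = {p \<in> square. 2 * a * (1 - fst p) \<le> snd p \<and> snd p \<le> 2 * a * (1 - fst p) + 4 * dl}"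
text \<open>The heights reached from top edge points with x between 0.19 and 0.22, with room for the
  thickness of the strip.\<close>

definition "wide y \<longleftrightarrow> 2 * a + 2 * (1 - a) * (19/100) - 4 * dl \<le> y \<and> y \<le> 2 * a + 2 * (1 - a) * (22/100) + 4 * dl"

text \<open>Away from the edges the regions are iterated images, so most transitions hold by
  definition. The letter \<open>S\<close> follows the image of the right edge, with a and b for the
  first and second branch taken from \<open>E3\<close>; \<open>D\<close> follows the corner (1, 1),
  and \<open>W\<close> the piece \<open>R3\<close>.\<close>

primrec region :: "state \<Rightarrow> (real \<times> real) set" where
  "region F0 = X0"
| "region F1 = plus_img X0"
| "region F2 = plus_img (plus_img X0)"
| "region F3 = plus_img (plus_img (plus_img X0))"
| "region T = {p \<in> square. 1 - 2 * dl \<le> snd p}"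
| "region TD = {p \<in> square. 1 - 6 * dl \<le> fst p \<and> 1 - 2 * dl \<le> snd p}"
| "region Tx = {p \<in> square. 7/10 \<le> fst p \<and> 1 - 2 * dl \<le> snd p}"
| "region T3 = {p \<in> square. 19/100 \<le> fst p \<and> fst p \<le> 22/100 \<and> 1 - 2 * dl \<le> snd p}"
| "region R = {p \<in> square. 1 - 2 * dl \<le> fst p}"
| "region RD = {p \<in> square. 1 - 2 * dl \<le> fst p \<and> snd p \<le> 12 * dl}"
| "region Rx = {p \<in> square. 1 - 2 * dl \<le> fst p \<and> snd p \<le> 46/100}"
| "region R3 = {p \<in> square. 1 - 2 * dl \<le> fst p \<and> wide (snd p)}"
| "region S3 = E3"
| "region D3 = {p \<in> E3. fst p \<le> 12 * dl}"
| "region S3x = {p \<in> E3. fst p \<le> 46/100}"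
| "region W0 = {p \<in> E3. wide (fst p)}"
| "region S4a = plus_img E3"
| "region S4b = minus_img E3"
| "region S5a = plus_img (plus_img E3)"
| "region S5b = plus_img (minus_img E3)"
| "region S6a = plus_img (plus_img (plus_img E3)) \<union> minus_img (plus_img (plus_img E3))"
| "region S6b = plus_img (plus_img (minus_img E3))"
| "region S7b = plus_img (plus_img (plus_img (minus_img E3)))"
| "region S8b = minus_img (plus_img (plus_img (plus_img (minus_img E3))))"
| "region D4 = plus_img {p \<in> E3. fst p \<le> 12 * dl}"
| "region D5 = plus_img (plus_img {p \<in> E3. fst p \<le> 12 * dl})"
| "region D6 = plus_img (plus_img (plus_img {p \<in> E3. fst p \<le> 12 * dl})) \<union> minus_img (plus_img (plus_img {p \<in> E3. fst p \<le> 12 * dl}))"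
| "region D7 = minus_img (plus_img (plus_img (plus_img {p \<in> E3. fst p \<le> 12 * dl})) \<union> minus_img (plus_img (plus_img {p \<in> E3. fst p \<le> 12 * dl})))"
| "region W1 = minus_img {p \<in> E3. wide (fst p)}"
| "region W2 = plus_img (minus_img {p \<in> E3. wide (fst p)})"
| "region W3 = minus_img (plus_img (minus_img {p \<in> E3. wide (fst p)}))"

lemma squareD: "p \<in> square \<Longrightarrow> 0 \<le> fst p \<and> fst p \<le> 1 \<and> 0 \<le> snd p \<and> snd p \<le> 1"
  by (auto simp: square_def mem_Times_iff)

lemma squareI: "0 \<le> fst p \<Longrightarrow> fst p \<le> 1 \<Longrightarrow> 0 \<le> snd p \<Longrightarrow> snd p \<le> 1 \<Longrightarrow> p \<in> square"
  by (auto simp: square_def mem_Times_iff)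

lemma lf_square: "p \<in> square \<Longrightarrow> 0 \<le> lf p \<and> lf p \<le> 1"
proof -
  assume "p \<in> square"
  note b = squareD[OF this]
  have "a * snd p \<le> a" "(1 - a) * fst p \<le> 1 - a" using b a_pos a_half by (simp_all add: mult_left_le)
  moreover have "0 \<le> a * snd p" "0 \<le> (1 - a) * fst p" using b a_pos a_half by simp_all
  ultimately have "0 \<le> a * snd p + (1 - a) * fst p" "a * snd p + (1 - a) * fst p \<le> 1" by linarith+
  then show ?thesis unfolding lf_def by (rule conjI)
qed

lemma plus_img_X0: "S \<subseteq> X0 \<Longrightarrow> plus_img S \<subseteq> X0"
proof -
  assume S: "S \<subseteq> X0"
  show ?thesis
  proof
    fix q assume "q \<in> plus_img S"
    then obtain p where p: "p \<in> X0" "lf p \<le> 1/2" "q = A1 p" using S by (auto simp: plus_img_def)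
    have b: "p \<in> square" "2 * a \<le> fst p + snd p" using p(1) by (auto simp: X0_def)
    note bb' = squareD[OF b(1)] lf_square[OF b(1)]
    have "fst p + snd p \<le> snd p + 2 * lf p"
    proof -
      have "0 \<le> 2 * a * snd p" "fst p \<le> 2 * (1 - a) * fst p"
        using bb' a_pos a_half mult_right_mono[of 1 "2 * (1 - a)" "fst p"] by simp_all
      then show ?thesis unfolding lf_def by (simp add: algebra_simps)
    qed
    then show "q \<in> X0" using p b bb' by (auto simp: X0_def A1_def intro!: squareI)
  qed
qed

lemma A2_X0: "p \<in> X0 \<Longrightarrow> 1/2 \<le> lf p \<Longrightarrow> A2 p \<in> X0"
proof -
  assume p: "p \<in> X0" "1/2 \<le> lf p"
  have b: "p \<in> square" using p(1) by (auto simp: X0_def)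
  note bb' = squareD[OF b] lf_square[OF b]
  have "(1 - a) * fst p \<le> (1 - a) * 1" using bb' a_half by (intro mult_left_mono) auto
  moreover have "2 * a * snd p \<le> snd p" using bb' a_pos a_half mult_right_mono[of "2 * a" 1 "snd p"] by simp
  ultimately have "2 * a \<le> snd p + (2 - 2 * lf p)" unfolding lf_def by (simp add: algebra_simps)
  then show ?thesis using p bb' by (auto simp: X0_def A2_def intro!: squareI)
qed

lemma minus_img_X0: "S \<subseteq> X0 \<Longrightarrow> minus_img S \<subseteq> X0"
  by (auto simp: minus_img_def intro!: A2_X0)

lemma E3_X0: "E3 \<subseteq> X0"
proof
  fix p assume p: "p \<in> E3"
  then have b: "p \<in> square" "2 * a * (1 - fst p) \<le> snd p" by (auto simp: E3_def)
  note bb' = squareD[OF b(1)]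
  have "2 * a * fst p \<le> fst p" using bb' a_pos a_half mult_right_mono[of "2 * a" 1 "fst p"] by simp
  then have "2 * a \<le> fst p + snd p" using b(2) by (simp add: algebra_simps)
  then show "p \<in> X0" using b(1) by (simp add: X0_def)
qed

lemma strip_X0:
  assumes "\<And>p. P p \<Longrightarrow> 9/10 \<le> fst p \<or> 9/10 \<le> snd p"
  shows "{p \<in> square. P p} \<subseteq> X0"
proof
  fix p assume "p \<in> {p \<in> square. P p}"
  then have p: "p \<in> square" "9/10 \<le> fst p \<or> 9/10 \<le> snd p" using assms by auto
  have "2 * a \<le> fst p + snd p" using p(2) squareD[OF p(1)] a_hi by linarith
  then show "p \<in> X0" using p(1) by (simp add: X0_def)
qed

lemma E3_sub_X0: "{p \<in> E3. P p} \<subseteq> X0"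
  using E3_X0 by blast

lemma region_X0: "region s \<subseteq> X0"
  by (cases s; simp only: region.simps; (intro plus_img_X0 minus_img_X0 Un_least order_refl E3_X0 E3_sub_X0 | (rule strip_X0, simp add: dl_def)))

section \<open>Position of the regions relative to the folding line\<close>

lemma A1_Pair: "A1 (x, y) = (y, 2 * a * y + 2 * (1 - a) * x)"
  and A2_Pair: "A2 (x, y) = (y, 2 - 2 * a * y - 2 * (1 - a) * x)"
  and lf_Pair: "lf (x, y) = a * y + (1 - a) * x"
  by (simp_all add: A1_def A2_def lf_def algebra_simps)

text \<open>The slope of \<open>lf\<close> along the segment y = 2a (1 - x), where \<open>lf\<close>
  is 2a^2 + \<open>quad\<close> x; it factors as (1 - 2a)(1 + a).\<close>

definition "quad = 1 - a - 2 * (a * a)"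

lemma quad_bounds: "5635/10000 \<le> quad" "2 * a \<le> quad" "quad \<le> 1"
  using a_square a_lo a_hi unfolding quad_def by linarith+

lemma E3_cases:
  assumes "p \<in> E3"
  obtains y z e where "p = (y, z)" "z = 2 * a * (1 - y) + e" "0 \<le> e" "e \<le> 4 * dl" "0 \<le> y" "y \<le> 1" "0 \<le> z" "z \<le> 1"
proof (rule that)
  show "p = (fst p, snd p)" by simp
  show "snd p = 2 * a * (1 - fst p) + (snd p - 2 * a * (1 - fst p))" by simp
qed (use assms squareD[of p] in \<open>auto simp: E3_def\<close>)

text \<open>Eliminating y expresses the height z through \<open>lf\<close>. The segment itself meets
  the folding line at z = a / (1 + a), which lies in the window from 0.19 to 0.22 that defines
  \<open>T3\<close>.\<close>

lemma E3_quad: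
  assumes z: "z = 2 * a * (1 - y) + e"
  shows "z * quad = 2 * a - 2 * (a * a) + (1 - a) * e - 2 * a * lf (y, z)"
  unfolding lf_Pair z quad_def by (simp add: algebra_simps)

lemma small_mult: "0 \<le> e \<Longrightarrow> e \<le> 4 * dl \<Longrightarrow> 0 \<le> (1 - a) * e \<and> (1 - a) * e \<le> 4 * dl"
  using a_pos a_half mult_right_mono[of "1 - a" 1 e] by auto

lemma E3_z_upper:
  assumes "p \<in> E3" "1/2 - dl \<le> lf p" shows "snd p \<le> 2199/10000"
proof (rule ccontr)
  assume n: "\<not> snd p \<le> 2199/10000"
  obtain y z e where p: "p = (y, z)" and z: "z = 2 * a * (1 - y) + e" and e: "0 \<le> e" "e \<le> 4 * dl"
    using E3_cases[OF assms(1)] by metis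
  have "2199/10000 * quad \<le> z * quad" using n p quad_bounds by (intro mult_right_mono) auto
  moreover have "a * (1/2 - dl) \<le> a * lf (y, z)" using assms(2) a_pos p by (intro mult_left_mono) auto
  then have "a / 2 - a * dl \<le> a * lf (y, z)" unfolding right_diff_distrib by simp
  moreover have "a * dl \<le> dl" using a_half by (simp add: dl_def)
  moreover note E3_quad[OF z] small_mult[OF e]
  ultimately have "2199/10000 * (1 - a - 2 * (a * a)) \<le> a - 2 * (a * a) + 6 * dl" unfolding quad_def by linarith
  then show False using a_square a_hi unfolding dl_def right_diff_distrib by linarith
qed

lemma E3_z_lower:
  assumes "p \<in> E3" "lf p \<le> 1/2 + dl" shows "1901/10000 \<le> snd p"
proof (rule ccontr)
  assume n: "\<not> 1901/10000 \<le> snd p"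
  obtain y z e where p: "p = (y, z)" and z: "z = 2 * a * (1 - y) + e" and e: "0 \<le> e" "e \<le> 4 * dl"
    using E3_cases[OF assms(1)] by metis
  have "z * quad \<le> 1901/10000 * quad" using n p quad_bounds by (intro mult_right_mono) auto
  moreover have "a * lf (y, z) \<le> a * (1/2 + dl)" using assms(2) a_pos p by (intro mult_left_mono) auto
  then have "a * lf (y, z) \<le> a / 2 + a * dl" unfolding distrib_left by simp
  moreover have "a * dl \<le> dl" using a_half by (simp add: dl_def)
  moreover note E3_quad[OF z] small_mult[OF e]
  ultimately have "a - 2 * (a * a) - 2 * dl \<le> 1901/10000 * (1 - a - 2 * (a * a))" unfolding quad_def by linarith
  then show False using a_square a_lo a_hi unfolding dl_def right_diff_distrib by linarith
qed

lemma lf_ge_fst: "p \<in> square \<Longrightarrow> v \<le> fst p \<Longrightarrow> 0 \<le> v \<Longrightarrow> 72/100 * v \<le> lf p"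
proof -
  assume p: "p \<in> square" "v \<le> fst p" "0 \<le> v"
  have "72/100 * v \<le> (1 - a) * fst p" using p a_hi by (intro mult_mono) auto
  moreover have "0 \<le> a * snd p" using squareD[OF p(1)] a_pos by simp
  ultimately show ?thesis unfolding lf_def by linarith
qed

lemma X0_square: "p \<in> X0 \<Longrightarrow> p \<in> square" by (simp add: X0_def)

text \<open>Along the branch \<open>A1\<close> the sum of the coordinates grows by a factor \<open>1.44\<close>, so three such steps
  in a row leave the half plane where a fourth would be possible.\<close>

lemma A1_sum: "p \<in> square \<Longrightarrow> s \<le> fst p + snd p \<Longrightarrow> 144/100 * s \<le> fst (A1 p) + snd (A1 p)"
proof -
  assume p: "p \<in> square" "s \<le> fst p + snd p"
  have "144/100 * fst p \<le> 2 * (1 - a) * fst p" "144/100 * snd p \<le> (1 + 2 * a) * snd p"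
    using squareD[OF p(1)] a_lo a_hi by (intro mult_right_mono; simp)+
  then show ?thesis using p(2) by (simp add: A1_def lf_def algebra_simps)
qed

lemma F3_large: "p \<in> region F3 \<Longrightarrow> 6/10 \<le> lf p"
proof -
  assume "p \<in> region F3"
  then obtain q where q: "q \<in> X0" "lf q \<le> 1/2" "lf (A1 q) \<le> 1/2" "p = A1 (A1 (A1 q))"
    by (auto simp: plus_img_def)
  have q1: "A1 q \<in> X0" using q plus_img_X0[of X0] by (auto simp: plus_img_def)
  have q2: "A1 (A1 q) \<in> X0" using q q1 plus_img_X0[of X0] by (auto simp: plus_img_def)
  have p: "p \<in> square" using \<open>p \<in> region F3\<close> region_X0[of F3] X0_square by blast
  have "2 * a \<le> fst q + snd q" using q(1) by (simp add: X0_def)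
  from A1_sum[OF X0_square[OF q(1)] this] have "144/100 * (2 * a) \<le> fst (A1 q) + snd (A1 q)" .
  from A1_sum[OF X0_square[OF q1] this] have "144/100 * (144/100 * (2 * a)) \<le> fst (A1 (A1 q)) + snd (A1 (A1 q))" .
  from A1_sum[OF X0_square[OF q2] this] have "144/100 * (144/100 * (144/100 * (2 * a))) \<le> fst p + snd p" unfolding q(4) .
  \<comment> \<open>The constant is 2 * 1.44^3, rounded down.\<close>
  then have "59719/10000 * a \<le> fst p + snd p" using a_pos by linarith
  then have "(1 - a) * (59719/10000 * a) \<le> (1 - a) * (fst p + snd p)" using a_half by (intro mult_left_mono) auto
  moreover have "(1 - 2 * a) * snd p \<le> 1 - 2 * a" using squareD[OF p] a_half by (intro mult_left_le) auto
  moreover have "lf p = (1 - a) * (fst p + snd p) - (1 - 2 * a) * snd p" by (simp add: lf_def algebra_simps)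
  moreover have "(1 - a) * (59719/10000 * a) = 59719/10000 * a - 59719/10000 * (a * a)" by (simp add: field_simps)
  ultimately show ?thesis using a_square a_lo a_hi by linarith
qed

text \<open>The extreme case of the upper bound is the end (0, 2a) of the segment; the bound keeps
  \<open>S4a\<close> and \<open>D4\<close> off the folding line. The lower bound concerns the first
  coordinate two steps later and places events there in \<open>Tx\<close>.\<close>

lemma S4a_lf:
  assumes "p \<in> E3" "lf p \<le> 1/2"
  shows "lf (A1 p) \<le> 4912/10000" and "745/1000 \<le> 2 * lf (A1 p)"
proof -
  obtain y z e where p: "p = (y, z)" and z: "z = 2 * a * (1 - y) + e" and e: "0 \<le> e" "e \<le> 4 * dl" and y: "0 \<le> y" and z0: "0 \<le> z"
    using E3_cases[OF assms(1)] by metis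
  have eq: "lf (A1 p) = 2 * (a * a) * z + (1 - a) * (2 * a + e)"
    unfolding p A1_Pair lf_Pair z by (simp add: algebra_simps)
  have "0 \<le> a * y" using y a_pos by simp
  then have "z \<le> 2 * a + e" unfolding z by (simp add: algebra_simps)
  then have "2 * (a * a) * z \<le> 2 * (a * a) * (2 * a + e)" using a_pos by (intro mult_left_mono) auto
  then have "lf (A1 p) \<le> (2 * (a * a) + (1 - a)) * (2 * a + e)" unfolding eq by (simp add: algebra_simps)
  also have "\<dots> \<le> (877/1000) * (56/100)"
    using a_square a_lo a_hi e by (intro mult_mono) (auto simp: dl_def)
  finally show "lf (A1 p) \<le> 4912/10000" by simp
  have "0 \<le> 2 * (a * a) * z" using z0 by simp
  moreover have "0 \<le> (1 - a) * e" using small_mult[OF e] by simp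
  moreover have "(1 - a) * (2 * a + e) = 2 * a - 2 * (a * a) + (1 - a) * e" by (simp add: algebra_simps)
  ultimately have "3725/10000 \<le> lf (A1 p)" unfolding eq using a_square a_lo by linarith
  then show "745/1000 \<le> 2 * lf (A1 p)" by simp
qed

text \<open>The second branch takes its part of \<open>E3\<close> back to the left of the folding
  line, so the next branch is forced. The last identity again eliminates the first coordinate and
  feeds \<open>W2_facts\<close>.\<close>

lemma S4b_facts:
  assumes "p \<in> E3" "1/2 < lf p"
  shows "lf (A2 p) \<le> 47/100" and "245/1000 \<le> 2 * lf (A2 p)" and "2 * a - 17 * dl \<le> fst (A1 (A2 p))"
    and "fst (A1 (A2 p)) = 2 - 2 * lf p"
    and "a * fst (A1 (A2 p)) = 2 * (a * a) + snd p * quad - (1 - a) * (snd p - 2 * a * (1 - fst p))"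
proof -
  obtain y z e where p: "p = (y, z)" and z: "z = 2 * a * (1 - y) + e" and e: "0 \<le> e" "e \<le> 4 * dl" and z0: "0 \<le> z"
    using E3_cases[OF assms(1)] by metis
  have z1: "z \<le> 22/100" using E3_z_upper[OF assms(1)] assms(2) p by (simp add: dl_def)
  have eq: "lf (A2 p) = 2 * (a * a) + z * (2 * (1 - a) - 2 * (a * a)) - (1 - a) * e"
    unfolding p A2_Pair lf_Pair z by (simp add: algebra_simps)
  have c: "0 \<le> 2 * (1 - a) - 2 * (a * a)" "2 * (1 - a) - 2 * (a * a) \<le> 1383/1000"
    using a_square a_lo a_hi by (simp_all add: algebra_simps)
  have "z * (2 * (1 - a) - 2 * (a * a)) \<le> 22/100 * (1383/1000)"
    using z1 c by (intro mult_mono) auto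
  then show "lf (A2 p) \<le> 47/100" unfolding eq using small_mult[OF e] a_square by linarith
  have "0 \<le> z * (2 * (1 - a) - 2 * (a * a))" using z0 c by simp
  then show "245/1000 \<le> 2 * lf (A2 p)" unfolding eq using small_mult[OF e] a_square by (simp add: dl_def)
  show f: "fst (A1 (A2 p)) = 2 - 2 * lf p" by (simp add: A1_def A2_def)
  have g: "a * (2 - 2 * lf p) = 2 * (a * a) + z * quad - (1 - a) * e"
    unfolding E3_quad[OF z] p by (simp add: algebra_simps)
  then show "a * fst (A1 (A2 p)) = 2 * (a * a) + snd p * quad - (1 - a) * (snd p - 2 * a * (1 - fst p))"
    unfolding f by (simp add: p z)
  have "4 * dl * 1 \<le> 4 * dl * (17/4 * a)" using a_lo by (intro mult_left_mono) (auto simp: dl_def)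
  moreover have "0 \<le> z * quad" using z0 quad_bounds by simp
  ultimately have "2 * (a * a) - 4 * dl * (17/4 * a) \<le> a * (2 - 2 * lf p)" unfolding g using small_mult[OF e] by linarith
  then have "a * (2 * a - 17 * dl) \<le> a * (2 - 2 * lf p)" by (simp add: algebra_simps)
  then show "2 * a - 17 * dl \<le> fst (A1 (A2 p))" unfolding f using a_pos by simp
qed

lemma X0_step: "p \<in> X0 \<Longrightarrow> lf p \<le> 1/2 \<Longrightarrow> A1 p \<in> X0" "p \<in> X0 \<Longrightarrow> 1/2 < lf p \<Longrightarrow> A2 p \<in> X0"
  using plus_img_X0[of X0] minus_img_X0[of X0] by (auto simp: plus_img_def minus_img_def)

lemma S6b_facts:
  assumes p: "p \<in> E3" "1/2 < lf p" and q: "lf (A1 (A2 p)) \<le> 1/2"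
  shows "86/100 \<le> 2 * lf (A1 (A2 p))" and "lf (A1 (A1 (A2 p))) \<le> 1/2 \<Longrightarrow> 77/100 \<le> 2 * lf (A1 (A1 (A2 p)))"
proof -
  note fs = S4b_facts[OF p]
  let ?q = "A1 (A2 p)"
  have s: "snd ?q = 2 * lf (A2 p)" by (simp add: A1_def)
  have "2 * (2476/10000) * (245/1000) \<le> 2 * a * snd ?q" using fs(2) a_lo s by (intro mult_mono) auto
  moreover have "2 * (1 - a) * (2 * a - 17 * dl) \<le> 2 * (1 - a) * fst ?q" using fs(3) a_half by (intro mult_left_mono) auto
  moreover have "2 * (1 - a) * (2 * a - 17 * dl) = 4 * a - 4 * (a * a) - 34 * dl * (1 - a)" by (simp add: algebra_simps)
  moreover have "34 * dl * (1 - a) \<le> 34 * dl" using a_pos by (simp add: dl_def)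
  moreover have "2 * lf ?q = 2 * a * snd ?q + 2 * (1 - a) * fst ?q" by (simp add: lf_def algebra_simps)
  ultimately show x6: "86/100 \<le> 2 * lf ?q" using a_square a_lo unfolding dl_def by linarith
  have "2 * (2476/10000) * (86/100) \<le> 2 * a * snd (A1 ?q)" using x6 a_lo by (intro mult_mono) (auto simp: A1_def)
  moreover have "2 * (72/100) * (245/1000) \<le> 2 * (1 - a) * fst (A1 ?q)" using fs(2) a_hi s by (intro mult_mono) (auto simp: A1_def)
  moreover have "2 * lf (A1 ?q) = 2 * a * snd (A1 ?q) + 2 * (1 - a) * fst (A1 ?q)" by (simp add: lf_def algebra_simps)
  ultimately show "77/100 \<le> 2 * lf (A1 ?q)" by linarith
qed

lemma S3x_lf: "p \<in> E3 \<Longrightarrow> fst p \<le> 46/100 \<Longrightarrow> lf p \<le> 44/100"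
proof -
  assume p3: "p \<in> E3" and y46: "fst p \<le> 46/100"
  obtain y z e where p: "p = (y, z)" and z: "z = 2 * a * (1 - y) + e" and e: "0 \<le> e" "e \<le> 4 * dl"
    using E3_cases[OF p3] by metis
  have "lf p = 2 * (a * a) + y * quad + a * e" unfolding p lf_Pair z quad_def by (simp add: algebra_simps)
  moreover have "y * quad \<le> 46/100 * quad" using y46 p quad_bounds by (intro mult_right_mono) auto
  moreover have "a * e \<le> 1 * (4 * dl)" using a_half e by (intro mult_mono) auto
  ultimately show ?thesis using a_square a_lo unfolding quad_def dl_def right_diff_distrib by linarith
qed

text \<open>These points are close to (0, 2a), where \<open>lf\<close> is 2a^2.\<close>

lemma D3_lf: "p \<in> E3 \<Longrightarrow> fst p \<le> 12 * dl \<Longrightarrow> lf p \<le> 157/1000 \<and> 122/1000 \<le> lf p"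
proof -
  assume p3: "p \<in> E3" and y: "fst p \<le> 12 * dl"
  obtain y z e where p: "p = (y, z)" and z: "z = 2 * a * (1 - y) + e" and e: "0 \<le> e" "e \<le> 4 * dl" and y0: "0 \<le> y"
    using E3_cases[OF p3] by metis
  have "lf p = 2 * (a * a) + y * quad + a * e" unfolding p lf_Pair z quad_def by (simp add: algebra_simps)
  moreover have "y * quad \<le> 12 * dl * 1" using y p quad_bounds by (intro mult_mono) (auto simp: dl_def)
  moreover have "0 \<le> y * quad" "0 \<le> a * e" using y0 quad_bounds e a_pos by auto
  moreover have "a * e \<le> 1 * (4 * dl)" using a_half e by (intro mult_mono) auto
  ultimately show ?thesis using a_square a_lo unfolding dl_def by (intro conjI; linarith)
qed

text \<open>For (0, 2a) itself the value is 8a^4 - 8a^3 + 8a^2, which equals 1/2 at the upper end of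
  the parameter range. The bounds lie on both sides of 1/2, so both branches and an event are
  allowed in \<open>D5\<close>; they are used to locate \<open>D7\<close>.\<close>

lemma D5_lf:
  assumes p: "p \<in> E3" "fst p \<le> 12 * dl" and h: "lf (A1 p) \<le> 1/2"
  shows "36/100 \<le> lf (A1 (A1 p))" "lf (A1 (A1 p)) \<le> 52/100"
proof -
  note l = D3_lf[OF p]
  have eq: "lf (A1 (A1 p)) = a * (2 * lf (A1 p)) + (1 - a) * (2 * lf p)" by (simp add: A1_def lf_def)
  have "2476/10000 * (745/1000) \<le> a * (2 * lf (A1 p))" using S4a_lf[OF p(1)] l a_lo by (intro mult_mono) auto
  moreover have "72/100 * (244/1000) \<le> (1 - a) * (2 * lf p)" using l a_hi by (intro mult_mono) auto
  ultimately show "36/100 \<le> lf (A1 (A1 p))" unfolding eq by linarith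
  have "a * (2 * lf (A1 p)) \<le> a" using h a_pos by (intro mult_left_le) auto
  moreover have "(1 - a) * (2 * lf p) \<le> (7524/10000) * (314/1000)" using l a_lo by (intro mult_mono) auto
  ultimately show "lf (A1 (A1 p)) \<le> 52/100" unfolding eq using a_hi by linarith
qed

lemma wide_lo: "wide y \<Longrightarrow> 78/100 \<le> y"
  using a_lo unfolding wide_def dl_def left_diff_distrib right_diff_distrib by linarith

text \<open>From the wide part of \<open>E3\<close> the branches are forced for four steps: second,
  first, second, second.\<close>

lemma W2_facts:
  assumes p: "p \<in> E3" "wide (fst p)"
  shows "51/100 \<le> lf p" and "51/100 \<le> lf (A1 (A2 p))" and "503/1000 \<le> lf (A2 (A1 (A2 p)))"
proof -
  have sq: "p \<in> square" using p(1) by (simp add: E3_def)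
  show l1: "51/100 \<le> lf p" using lf_ge_fst[OF sq wide_lo[OF p(2)]] by simp
  then have l: "1/2 < lf p" by simp
  obtain y z e where pp: "p = (y, z)" and z: "z = 2 * a * (1 - y) + e" and e: "0 \<le> e" "e \<le> 4 * dl" and y0: "0 \<le> y" and z0: "0 \<le> z"
    using E3_cases[OF p(1)] by metis
  have y1: "56/100 - 156/100 * a - 4 * dl \<le> 1 - y" using p(2) pp unfolding wide_def left_diff_distrib right_diff_distrib by (auto simp: field_simps)
  have zl: "2 * a * (56/100 - 156/100 * a - 4 * dl) \<le> z"
  proof -
    have "2 * a * (56/100 - 156/100 * a - 4 * dl) \<le> 2 * a * (1 - y)" using y1 a_pos by (intro mult_left_mono) auto
    then show ?thesis using z e by simp
  qed
  define x4 where "x4 = 2 - 2 * lf p"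
  define x5 where "x5 = 2 * lf (A2 p)"
  have q: "A1 (A2 p) = (x4, x5)" by (simp add: A1_def A2_def x4_def x5_def)
  have g: "a * x4 = 2 * (a * a) + z * quad - (1 - a) * e"
    using S4b_facts(4,5)[OF p(1) l] unfolding q by (simp add: pp z)
  have x5: "x5 = 4 * (a * a) + z * (4 * (1 - a) - 4 * (a * a)) - 2 * (1 - a) * e"
    unfolding x5_def pp A2_Pair lf_Pair z by (simp add: algebra_simps)
  have x5l: "245/1000 \<le> x5" using S4b_facts(2)[OF p(1) l] by (simp add: x5_def)
  have z6: "6/100 \<le> z"
  proof -
    have "2 * a * (56/100 - 156/100 * a - 4 * dl) = 112/100 * a - 312/100 * (a * a) - 8 * dl * a" by (simp add: algebra_simps)
    moreover have "8 * dl * a \<le> 8 * dl" using a_half by (simp add: dl_def)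
    ultimately show ?thesis using zl a_square a_lo a_hi unfolding dl_def by linarith
  qed
  have x4l: "2 * a + 11/100 \<le> x4"
  proof -
    have "z * (2 * a) \<le> z * quad" using quad_bounds z0 by (intro mult_left_mono) auto
    moreover have "6/100 * (2 * a) \<le> z * (2 * a)" using z6 a_pos by (intro mult_right_mono) auto
    moreover have "4 * dl * 1 \<le> 4 * dl * (17/4 * a)" using a_lo by (intro mult_left_mono) (auto simp: dl_def)
    ultimately have "2 * (a * a) + 6/100 * (2 * a) - 4 * dl * (17/4 * a) \<le> a * x4"
      unfolding g using small_mult[OF e] by linarith
    then have "a * (2 * a + 12/100 - 17 * dl) \<le> a * x4" by (simp add: algebra_simps)
    then show ?thesis using a_pos by (simp add: dl_def)
  qed
  have "2476/10000 * (245/1000) \<le> a * x5" using x5l a_lo by (intro mult_mono) auto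
  moreover have "(1 - a) * (2 * a + 11/100) \<le> (1 - a) * x4" using x4l a_half by (intro mult_left_mono) auto
  moreover have "(1 - a) * (2 * a + 11/100) = 11/100 + 189/100 * a - 2 * (a * a)" by (simp add: field_simps)
  ultimately show "51/100 \<le> lf (A1 (A2 p))" unfolding q lf_Pair using a_square a_lo by linarith
  \<comment> \<open>The remaining margin is only 0.003, too small for separate bounds on
    \<open>x4\<close> and \<open>x5\<close>. Both are replaced by their exact expressions in z and e
    before estimating.\<close>
  have "lf (A2 (x4, x5)) = 2 * a - 2 * a * (a * x5) - 2 * (1 - a) * (a * x4) + (1 - a) * x5"
    by (simp add: A2_Pair lf_Pair algebra_simps)
  also have "\<dots> = 2 * a - 8 * (a * a) * (a * a) + 2 * z * (quad * quad) + 4 * (a * a) * (1 - a) * e"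
    unfolding g unfolding x5 quad_def by (simp add: algebra_simps)
  finally have w: "lf (A2 (A1 (A2 p))) = 2 * a - 8 * (a * a) * (a * a) + 2 * z * (quad * quad) + 4 * (a * a) * (1 - a) * e"
    unfolding q .
  have "0 \<le> 4 * (a * a) * (1 - a) * e" using e a_half by simp
  moreover have "8 * (a * a) * (a * a) \<le> 8 * (783/10000) * (a * a)" using a_square by (intro mult_mono) auto
  moreover have "2 * z * (5635/10000 * (5635/10000)) \<le> 2 * z * (quad * quad)" using z0 quad_bounds by (intro mult_left_mono mult_mono) auto
  moreover have "2 * a * (56/100 - 156/100 * a - 4 * dl) = 112/100 * a - 312/100 * (a * a) - 8 * dl * a" by (simp add: algebra_simps)
  moreover have "8 * dl * a \<le> 8 * dl" using a_half by (simp add: dl_def)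
  ultimately show "503/1000 \<le> lf (A2 (A1 (A2 p)))" using zl w a_square a_lo a_hi unfolding dl_def by linarith
qed

lemma region_square: "p \<in> region s \<Longrightarrow> p \<in> square"
  using region_X0[of s] X0_square by blast

text \<open>The margin \<open>dl\<close> rules out events as well as the first branch in these
  states.\<close>

lemma minus_only:
  assumes "s \<in> {F3, R, S6a, S7b, S8b, Tx, Rx, R3, W0, W2, W3, TD, RD, D6, D7}" and p: "p \<in> region s"
  shows "1/2 + dl \<le> lf p"
proof -
  have big: ?thesis if "7/10 \<le> fst p"
    using lf_ge_fst[OF region_square[OF p] that] by (simp add: dl_def)
  show ?thesis
  proof (cases s)
    case F3 then show ?thesis using F3_large[of p] p by (simp add: dl_def)
  next
    case S6a
    then obtain q where "q \<in> E3" "lf q \<le> 1/2" "fst p = snd (A1 (A1 q))" using p by (auto simp: plus_img_def minus_img_def A1_def A2_def)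
    then show ?thesis using S4a_lf(2)[of q] by (intro big) (simp add: A1_def)
  next
    case D6
    then obtain q where "q \<in> E3" "lf q \<le> 1/2" "fst p = snd (A1 (A1 q))" using p by (auto simp: plus_img_def minus_img_def A1_def A2_def)
    then show ?thesis using S4a_lf(2)[of q] by (intro big) (simp add: A1_def)
  next
    case D7
    then obtain q where q: "q \<in> E3" "fst q \<le> 12 * dl" "lf (A1 q) \<le> 1/2"
      "fst p = 2 * lf (A1 (A1 q)) \<or> fst p = 2 - 2 * lf (A1 (A1 q))"
      using p by (auto simp: plus_img_def minus_img_def A1_def A2_def)
    then show ?thesis using D5_lf[OF q(1-3)] by (intro big) auto
  next
    case S7b
    then obtain q where q: "q \<in> E3" "1/2 < lf q" "lf (A1 (A2 q)) \<le> 1/2" "p = A1 (A1 (A1 (A2 q)))"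
      using p by (auto simp: plus_img_def minus_img_def)
    then show ?thesis using S6b_facts(1)[OF q(1-3)] by (intro big) (simp add: A1_def)
  next
    case S8b
    then obtain q where q: "q \<in> E3" "1/2 < lf q" "lf (A1 (A2 q)) \<le> 1/2" "lf (A1 (A1 (A2 q))) \<le> 1/2" "p = A2 (A1 (A1 (A1 (A2 q))))"
      using p by (auto simp: plus_img_def minus_img_def)
    then show ?thesis using S6b_facts(2)[OF q(1-4)] by (intro big) (simp add: A1_def A2_def)
  next
    case W0
    then show ?thesis using p W2_facts(1)[of p] by (simp add: dl_def)
  next
    case W2
    then obtain q where q: "q \<in> E3" "wide (fst q)" "p = A1 (A2 q)" using p by (auto simp: plus_img_def minus_img_def)
    then show ?thesis using W2_facts(2)[OF q(1-2)] by (simp add: dl_def)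
  next
    case W3
    then obtain q where q: "q \<in> E3" "wide (fst q)" "p = A2 (A1 (A2 q))" using p by (auto simp: plus_img_def minus_img_def)
    then show ?thesis using W2_facts(3)[OF q(1-2)] by (simp add: dl_def)
  next
    case Tx
    have "2476/10000 * (1 - 2 * dl) \<le> a * snd p" "72/100 * (7/10) \<le> (1 - a) * fst p"
      using p Tx a_lo a_hi by (intro mult_mono; simp add: dl_def)+
    then show ?thesis by (simp add: lf_def dl_def)
  qed (use p big assms(1) in \<open>auto simp: dl_def\<close>)
qed

lemma plus_only:
  assumes "s \<in> {S4a, S4b, S3x, T3, W1, D3, D4}" and p: "p \<in> region s"
  shows "lf p \<le> 1/2 - dl"
proof (cases s)
  case S4a
  then obtain q where "q \<in> E3" "lf q \<le> 1/2" "p = A1 q" using p by (auto simp: plus_img_def)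
  then show ?thesis using S4a_lf(1)[of q] by (simp add: dl_def)
next
  case D4
  then obtain q where "q \<in> E3" "lf q \<le> 1/2" "p = A1 q" using p by (auto simp: plus_img_def)
  then show ?thesis using S4a_lf(1)[of q] by (simp add: dl_def)
next
  case S4b
  then obtain q where "q \<in> E3" "1/2 < lf q" "p = A2 q" using p by (auto simp: minus_img_def)
  then show ?thesis using S4b_facts(1)[of q] by (simp add: dl_def)
next
  case W1
  then obtain q where "q \<in> E3" "1/2 < lf q" "p = A2 q" using p by (auto simp: minus_img_def)
  then show ?thesis using S4b_facts(1)[of q] by (simp add: dl_def)
next
  case S3x
  then show ?thesis using p S3x_lf[of p] by (simp add: dl_def)
next
  case D3
  then show ?thesis using p D3_lf[of p] by (simp add: dl_def)
next
  case T3
  have "a * snd p \<le> a" using squareD[OF region_square[OF p]] a_pos by (intro mult_left_le) auto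
  moreover have "(1 - a) * fst p \<le> 7524/10000 * (22/100)"
    using p T3 a_lo a_hi squareD[OF region_square[OF p]] by (intro mult_mono) auto
  ultimately show ?thesis using a_hi unfolding lf_def dl_def by linarith
qed (use assms(1) in auto)

lemma A_square: "p \<in> square \<Longrightarrow> lf p \<le> 1/2 \<Longrightarrow> A1 p \<in> square" "p \<in> square \<Longrightarrow> 1/2 \<le> lf p \<Longrightarrow> A2 p \<in> square"
  using squareD[of p] lf_square[of p] by (auto simp: A1_def A2_def intro!: squareI)

lemma A2_E3: "p \<in> square \<Longrightarrow> 1 - 2 * dl \<le> fst p \<Longrightarrow> A2 p \<in> E3"
proof -
  assume p: "p \<in> square" "1 - 2 * dl \<le> fst p"
  have "1/2 \<le> lf p" using lf_ge_fst[OF p] by (simp add: dl_def)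
  from A_square(2)[OF p(1) this] have "A2 p \<in> square" .
  moreover have "0 \<le> (1 - a) * (1 - fst p)" using squareD[OF p(1)] a_half by simp
  moreover have "(1 - a) * (1 - fst p) \<le> 1 * (2 * dl)" using p squareD[OF p(1)] a_pos by (intro mult_mono) auto
  moreover have "snd (A2 p) = 2 * a * (1 - snd p) + 2 * ((1 - a) * (1 - fst p))" by (simp add: A2_def lf_def algebra_simps)
  moreover have "fst (A2 p) = snd p" by (simp add: A2_def)
  ultimately show ?thesis by (simp add: E3_def)
qed

lemma fst_A: "fst (A1 p) = snd p" "fst (A2 p) = snd p"
  by (simp_all add: A1_def A2_def)

lemma Tx_A2: "p \<in> region Tx \<Longrightarrow> A2 p \<in> region Rx"
proof -
  assume p: "p \<in> region Tx"
  have l: "1/2 \<le> lf p" using minus_only[of Tx p] p by (simp add: dl_def)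
  have "a * (1 - 2 * dl) \<le> a * snd p" "(1 - a) * (7/10) \<le> (1 - a) * fst p"
    using p a_lo a_hi by (intro mult_left_mono; simp add: dl_def)+
  then have "7/10 + 3/10 * a - 2 * (a * dl) \<le> lf p" unfolding lf_def by (simp add: field_simps)
  moreover have "a * dl \<le> dl" using a_half by (simp add: dl_def)
  ultimately have "snd (A2 p) \<le> 46/100" using a_lo by (simp add: A2_def dl_def)
  then show ?thesis using A_square(2)[OF region_square[OF p] l] p by (simp add: fst_A)
qed

lemma TD_A2: "p \<in> region TD \<Longrightarrow> A2 p \<in> region RD"
proof -
  assume p: "p \<in> region TD"
  have l: "1/2 \<le> lf p" using minus_only[of TD p] p by (simp add: dl_def)
  have "a * (1 - 2 * dl) \<le> a * snd p" "(1 - a) * (1 - 6 * dl) \<le> (1 - a) * fst p"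
    using p a_lo a_hi by (intro mult_left_mono; simp add: dl_def)+
  then have "1 - 6 * dl + 4 * (a * dl) \<le> lf p" unfolding lf_def by (simp add: algebra_simps)
  moreover have "0 \<le> a * dl" using a_pos by (simp add: dl_def)
  ultimately have "snd (A2 p) \<le> 12 * dl" by (simp add: A2_def)
  then show ?thesis using A_square(2)[OF region_square[OF p] l] p by (simp add: fst_A)
qed

lemma T3_A1: "p \<in> region T3 \<Longrightarrow> A1 p \<in> region R3"
proof -
  assume p: "p \<in> region T3"
  have l: "lf p \<le> 1/2" using plus_only[of T3 p] p by (simp add: dl_def)
  have "a * (1 - 2 * dl) \<le> a * snd p" "a * snd p \<le> a"
    using p a_pos squareD[OF region_square[OF p]] by (intro mult_left_mono mult_left_le; simp)+
  moreover have "(1 - a) * (19/100) \<le> (1 - a) * fst p" "(1 - a) * fst p \<le> (1 - a) * (22/100)"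
    using p a_half by (intro mult_left_mono; simp)+
  moreover have "a * dl \<le> dl" "0 \<le> dl" using a_half by (simp_all add: dl_def)
  moreover have "a * (1 - 2 * dl) = a - 2 * (a * dl)" by (simp add: algebra_simps)
  moreover have "snd (A1 p) = 2 * (a * snd p) + 2 * ((1 - a) * fst p)" by (simp add: A1_def lf_def)
  ultimately have "wide (snd (A1 p))" unfolding wide_def by linarith
  then show ?thesis using A_square(1)[OF region_square[OF p] l] p by (simp add: fst_A)
qed

section \<open>Transitions of the automaton\<close>

lemma plus_step:
  assumes p: "p \<in> region s" "lf p \<le> 1/2"
  shows "\<exists>s'. plus_next s = Some s' \<and> A1 p \<in> region s'"
proof (cases "plus_next s")
  case None
  then have "s \<in> {F3, R, S6a, S7b, S8b, Tx, Rx, R3, W0, W2, W3, TD, RD, D6, D7}" by (cases s) auto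
  from minus_only[OF this p(1)] p(2) show ?thesis by (simp add: dl_def)
next
  case (Some s')
  have "A1 p \<in> region s'"
  proof (cases s)
    case T
    then show ?thesis using Some p A_square(1)[OF region_square[OF p(1)] p(2)] by (auto simp: fst_A)
  next
    case T3
    then show ?thesis using Some p T3_A1[of p] by auto
  qed (use Some p in \<open>auto simp: plus_img_def\<close>)
  with Some show ?thesis by blast
qed

lemma minus_step:
  assumes p: "p \<in> region s" "1/2 < lf p"
  shows "\<exists>s'. minus_next s = Some s' \<and> A2 p \<in> region s'"
proof (cases "minus_next s")
  case None
  then have "s \<in> {S4a, S4b, S3x, T3, W1, D3, D4}" by (cases s) auto
  from plus_only[OF this p(1)] p(2) show ?thesis by (simp add: dl_def)
next
  case (Some s')
  have sq: "A2 p \<in> square" using A_square(2)[OF region_square[OF p(1)]] p(2) by simp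
  have F: "A2 p \<in> X0" using A2_X0[of p] region_X0[of s] p by auto
  have E: "A2 p \<in> E3" if "1 - 2 * dl \<le> fst p" using A2_E3[OF region_square[OF p(1)] that] .
  have "A2 p \<in> region s'"
  proof (cases s)
    case TD then show ?thesis using Some p TD_A2[of p] by auto
  next
    case Tx then show ?thesis using Some p Tx_A2[of p] by auto
  qed (use Some p sq F E in \<open>auto simp: fst_A minus_img_def\<close>)
  with Some show ?thesis by blast
qed

text \<open>A whole rectangle at the top edge, not just the image of p, has to lie in the new
  region: the width of a ghost is read off near the base of p, whose height differs by up to
  \<open>dl\<close>, and as a one-sided limit, which accounts for another \<open>dl\<close>.\<close>

lemma event_step:
  assumes p: "p \<in> region s" and n: "\<bar>lf p - 1/2\<bar> < dl"
  shows "\<exists>s'. event_next s = Some s' \<and> s' \<in> {T, TD, Tx, T3} \<and>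
    (\<forall>x z. 0 \<le> x \<longrightarrow> x \<le> 1 \<longrightarrow> \<bar>x - snd p\<bar> \<le> 2 * dl \<longrightarrow> 1 - 2 * dl \<le> z \<longrightarrow> z \<le> 1 \<longrightarrow> (x, z) \<in> region s')"
proof (cases "event_next s")
  case None
  then have "s \<in> {F3, R, S6a, S7b, S8b, Tx, Rx, R3, W0, W2, W3, TD, RD, D6, D7} \<union> {S4a, S4b, S3x, T3, W1, D3, D4}" by (cases s) auto
  then show ?thesis using minus_only[OF _ p] plus_only[OF _ p] n by fastforce
next
  case (Some s')
  have ax: "7/10 \<le> x" if "74/100 \<le> y" "\<bar>x - y\<bar> \<le> 2 * dl" for x y :: real
    using that unfolding dl_def by linarith
  have at: "1 - 6 * dl \<le> x" if "1 - 2 * dl \<le> y" "\<bar>x - y\<bar> \<le> 2 * dl" for x y :: real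
    using that unfolding dl_def by linarith
  have a3: "19/100 \<le> x \<and> x \<le> 22/100" if "1901/10000 \<le> y" "y \<le> 2199/10000" "\<bar>x - y\<bar> \<le> 2 * dl" for x y :: real
    using that unfolding dl_def by (intro conjI; linarith)
  have d0: "0 \<le> 1 - 2 * dl" by (simp add: dl_def)
  have tx: "region s' \<supseteq> {(x, z). 0 \<le> x \<and> x \<le> 1 \<and> \<bar>x - snd p\<bar> \<le> 2 * dl \<and> 1 - 2 * dl \<le> z \<and> z \<le> 1}"
    if "s' = Tx" "74/100 \<le> snd p"
    using that ax[of "snd p"] d0 by (auto simp: square_def)
  have "region s' \<supseteq> {(x, z). 0 \<le> x \<and> x \<le> 1 \<and> \<bar>x - snd p\<bar> \<le> 2 * dl \<and> 1 - 2 * dl \<le> z \<and> z \<le> 1}"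
  proof (cases s)
    case T
    then show ?thesis using Some p d0 at[of "snd p"] by (auto simp: square_def)
  next
    case S3
    then have "snd p \<le> 2199/10000" "1901/10000 \<le> snd p" using p n E3_z_upper[of p] E3_z_lower[of p] by auto
    then show ?thesis using Some S3 d0 a3[of "snd p"] by (auto simp: square_def)
  next
    case D5
    then obtain q where "q \<in> E3" "lf q \<le> 1/2" "p = A1 (A1 q)" using p by (auto simp: plus_img_def)
    then show ?thesis using S4a_lf(2)[of q] Some D5 by (intro tx) (auto simp: A1_def)
  next
    case S5a
    then obtain q where "q \<in> E3" "lf q \<le> 1/2" "p = A1 (A1 q)" using p by (auto simp: plus_img_def)
    then show ?thesis using S4a_lf(2)[of q] Some S5a by (intro tx) (auto simp: A1_def)
  next
    case S6b
    then obtain q where q: "q \<in> E3" "1/2 < lf q" "lf (A1 (A2 q)) \<le> 1/2" "p = A1 (A1 (A2 q))"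
      using p by (auto simp: plus_img_def minus_img_def)
    then show ?thesis using S6b_facts(1)[OF q(1-3)] Some S6b by (intro tx) (auto simp: A1_def)
  qed (use Some in \<open>auto simp: dl_def square_def\<close>)
  moreover have "s' \<in> {T, TD, Tx, T3}" using Some by (cases s) auto
  ultimately show ?thesis using Some by auto
qed

section \<open>Contraction of configurations\<close>

lemma snd_Gm: "snd (Gm p) = 1 - 2 * \<bar>lf p - 1/2\<bar>"
  by (simp add: Gm_def A1_def A2_def)

lemma fst_Gm: "fst (Gm p) = snd p"
  by (simp add: Gm_def A1_def A2_def)

lemma lf_shift: "lf (p + r *\<^sub>R d) = lf p + r * lf d"
  by (simp add: lf_def algebra_simps)

text \<open>Regions overlap, and a point has to obey the bounds of every state whose region contains
  it; so any admissible successor can be chosen afterwards. Widths are constrained only on the edge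
  pieces to which they matter.\<close>

definition budget :: "real \<Rightarrow> config \<Rightarrow> bool" where
  "budget lam c \<longleftrightarrow> (\<forall>s. \<forall>p\<in>region s.
     (\<forall>l\<in>set (covs s). cov_sum l (map (\<lambda>h. h p) (fst c)) \<le> lam) \<and>
     (s \<in> {R, RD, Rx, R3} \<longrightarrow> (\<Sum>r\<leftarrow>fst (snd c). r p) \<le> lam * (of_int (right_weight s) / 10000000)) \<and>
     (s \<in> {T, TD, Tx, T3} \<longrightarrow> (\<Sum>\<tau>\<leftarrow>snd (snd c). \<tau> p) \<le> lam * (of_int (top_weight s) / 10000000)))"

text \<open>The side value is attained at q + r d for small r > 0. Since q is on the folding line,
  the image of that point lies just below the top edge above a point close to
  \<open>snd q\<close>.\<close>

lemma side_sum:
  assumes ts: "\<forall>\<tau>\<in>set ts. tame \<tau>" and q: "lf q = 1/2" "0 < snd q" "snd q \<le> 1" and d: "\<bar>lf d\<bar> \<le> 1" "-1 \<le> snd d" "snd d \<le> 0"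
    and B: "\<And>x z. 0 \<le> x \<Longrightarrow> x \<le> 1 \<Longrightarrow> \<bar>x - snd q\<bar> \<le> dl \<Longrightarrow> 1 - 2 * dl \<le> z \<Longrightarrow> z \<le> 1 \<Longrightarrow> (\<Sum>\<tau>\<leftarrow>ts. \<tau> (x, z)) \<le> B"
  shows "(\<Sum>\<tau>\<leftarrow>ts. side_val (\<lambda>p. \<tau> (Gm p)) d q) \<le> (B :: real)"
proof -
  have "eventually (\<lambda>r. \<forall>\<tau>\<in>set ts. \<tau> (Gm (q + r *\<^sub>R d)) = side_val (\<lambda>p. \<tau> (Gm p)) d q) (at_right (0::real))"
    by (intro eventually_ball_finite ballI side_val tame_Gm) (use ts in auto)
  moreover have "eventually (\<lambda>r. 0 < r \<and> r < min dl (snd q)) (at_right (0::real))"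
    using q(2) by (intro eventually_at_rightI[of 0 "min dl (snd q)"]) (auto simp: dl_def)
  ultimately have "eventually (\<lambda>r. (\<Sum>\<tau>\<leftarrow>ts. side_val (\<lambda>p. \<tau> (Gm p)) d q) \<le> B) (at_right (0::real))"
  proof eventually_elim
    case (elim r)
    let ?x = "q + r *\<^sub>R d"
    have g: "Gm ?x = (snd q + r * snd d, 1 - 2 * (r * \<bar>lf d\<bar>))"
      using elim(2) by (intro prod_eqI) (simp_all add: snd_Gm fst_Gm lf_shift q(1) abs_mult)
    have "r * (- snd d) \<le> r * 1" using elim(2) d by (intro mult_left_mono) auto
    moreover have "r * \<bar>lf d\<bar> \<le> dl" using elim(2) d mult_mono[of r dl "\<bar>lf d\<bar>" 1] by simp
    moreover have "r * snd d \<le> 0" "0 \<le> r * \<bar>lf d\<bar>"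
      using elim(2) d by (auto intro: mult_left_le simp: mult_nonneg_nonpos simp del: mult_minus_right)
    ultimately have "(\<Sum>\<tau>\<leftarrow>ts. \<tau> (Gm ?x)) \<le> B" unfolding g using elim(2) q by (intro B) auto
    moreover have "(\<Sum>\<tau>\<leftarrow>ts. side_val (\<lambda>p. \<tau> (Gm p)) d q) = (\<Sum>\<tau>\<leftarrow>ts. \<tau> (Gm ?x))"
      using elim(1) by (intro arg_cong[of _ _ sum_list] map_cong) auto
    ultimately show ?case by simp
  qed
  then show ?thesis by (simp add: eventually_const_iff)
qed

lemma side_sum_event:
  assumes ts: "\<forall>\<tau>\<in>set ts. tame \<tau>" and b: "budget lam (hs, rs, ts)" and p: "p \<in> region s" and s': "s' \<in> {T, TD, Tx, T3}"
    and reg: "\<forall>x z. 0 \<le> x \<longrightarrow> x \<le> 1 \<longrightarrow> \<bar>x - snd p\<bar> \<le> 2 * dl \<longrightarrow> 1 - 2 * dl \<le> z \<longrightarrow> z \<le> 1 \<longrightarrow> (x, z) \<in> region s'"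
    and q: "lf q = 1/2" "0 < snd q" "snd q \<le> 1" "\<bar>snd q - snd p\<bar> \<le> dl" and d: "\<bar>lf d\<bar> \<le> 1" "-1 \<le> snd d" "snd d \<le> 0"
  shows "(\<Sum>\<tau>\<leftarrow>ts. side_val (\<lambda>p. \<tau> (Gm p)) d q) \<le> lam * (of_int (top_weight s') / 10000000)"
proof (rule side_sum[OF ts q(1-3) d])
  fix x z assume x: "0 \<le> x" "x \<le> 1" "\<bar>x - snd q\<bar> \<le> dl" "1 - 2 * dl \<le> z" "z \<le> 1"
  have "\<bar>x - snd p\<bar> \<le> 2 * dl" using x(3) q(4) by linarith
  with reg x have "(x, z) \<in> region s'" by blast
  then show "(\<Sum>\<tau>\<leftarrow>ts. \<tau> (x, z)) \<le> lam * (of_int (top_weight s') / 10000000)"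
    using b s' unfolding budget_def by fastforce
qed

lemma base_facts:
  "snd (base n_plus d_plus p) = snd p + (1/2 - lf p)" "snd (base n_minus d_minus p) = snd p"
  "\<bar>lf d_plus\<bar> \<le> 1" "\<bar>lf d_minus\<bar> \<le> 1"
  unfolding base_def aff_plus using a_pos a_half by (simp_all add: d_plus_def d_minus_def lf_def)

lemma bb_small: "bb \<le> 69425 / 100000"
  unfolding bb_cc using cc_range by simp

lemma near_minus:
  assumes "0 < aff n_minus p" "aff n_minus p < \<delta>"
  shows "\<bar>lf p - 1/2\<bar> < \<delta>"
proof -
  have l: "0 < lf p - 1/2"
  proof (rule ccontr)
    assume "\<not> 0 < lf p - 1/2"
    then have "2 * bb * (lf p - 1/2) \<le> 0" using bb_pos by (intro mult_nonneg_nonpos) auto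
    then show False using assms(1) unfolding aff_minus by linarith
  qed
  have "1 \<le> 2 * bb" using bb_cc cc_range by simp
  then have "1 * (lf p - 1/2) \<le> 2 * bb * (lf p - 1/2)" using l by (intro mult_right_mono) auto
  also have "\<dots> < \<delta>" using assms(2) by (simp only: aff_minus)
  finally show ?thesis using l by simp
qed

lemma dot_scale: "dot l (k *\<^sub>R v) = k * dot l v"
  by (simp add: dot_def algebra_simps)

lemma side_val_nonneg:
  assumes "tame h" "\<forall>p. 0 \<le> h p"
  shows "(0::real) \<le> side_val h d p"
proof -
  obtain r where "h (p + r *\<^sub>R d) = side_val h d p"
    using eventually_happens'[OF _ side_val[OF assms(1)], of p d] by auto
  then show ?thesis using assms(2) by metis
qed

text \<open>At a given point all ghosts of one side are multiples of the single vector d, so the sum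
  splits into the value of the covector at d and a sum of widths.\<close>

lemma ghost_sum:
  assumes ts: "\<forall>\<tau>\<in>set ts. tame \<tau> \<and> (\<forall>p. 0 \<le> \<tau> p)" and m: "0 \<le> m"
    and on: "0 < aff n p \<Longrightarrow> aff n p < \<delta> \<Longrightarrow> good_base n d p \<Longrightarrow> (\<Sum>\<tau>\<leftarrow>ts. side_val (\<lambda>p. \<tau> (Gm p)) d (base n d p)) \<le> B"
    and off: "\<not> (0 < aff n p \<and> aff n p < \<delta> \<and> good_base n d p) \<Longrightarrow> 0 \<le> B"
  shows "cov_sum l (map (\<lambda>h. h p) (map (\<lambda>\<tau>. ghost \<delta> m n d (\<lambda>p. \<tau> (Gm p))) ts)) \<le> m * \<bar>dot l d\<bar> * B"
proof (cases "0 < aff n p \<and> aff n p < \<delta> \<and> good_base n d p")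
  case True
  have nn: "0 \<le> side_val (\<lambda>p. \<tau> (Gm p)) d q" if "\<tau> \<in> set ts" for \<tau> q
    using side_val_nonneg[OF tame_Gm[of \<tau>], of d q] ts that by blast
  have "cov_sum l (map (\<lambda>h. h p) (map (\<lambda>\<tau>. ghost \<delta> m n d (\<lambda>p. \<tau> (Gm p))) ts))
    = (\<Sum>\<tau>\<leftarrow>ts. m * \<bar>dot l d\<bar> * side_val (\<lambda>p. \<tau> (Gm p)) d (base n d p))"
    unfolding cov_sum_def map_map using True m nn
    by (intro arg_cong[of _ _ sum_list] map_cong) (auto simp: ghost_def dot_scale abs_mult)
  also have "\<dots> = m * \<bar>dot l d\<bar> * (\<Sum>\<tau>\<leftarrow>ts. side_val (\<lambda>p. \<tau> (Gm p)) d (base n d p))" by (rule sum_list_const_mult)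
  also have "\<dots> \<le> m * \<bar>dot l d\<bar> * B" using True on m by (intro mult_left_mono) auto
  finally show ?thesis .
next
  case False
  then have "ghost \<delta> m n d \<sigma> p = 0" for \<sigma> by (auto simp: ghost_def)
  then have "cov_sum l (map (\<lambda>h. h p) (map (\<lambda>\<tau>. ghost \<delta> m n d (\<lambda>p. \<tau> (Gm p))) ts)) = 0"
    by (simp add: cov_sum_def dot_def comp_def)
  then show ?thesis using m off[OF False] by simp
qed

lemma cov_sum_append: "cov_sum l (xs @ ys) = cov_sum l xs + cov_sum l ys"
  by (simp add: cov_sum_def)

lemma dot_B: "dot l (B1 v) = (of_int (snd l) - cc * of_int (fst l)) * fst v + of_int 1 * ((1 + cc) / 2) * of_int (fst l) * snd v"
  "dot l (B2 v) = (of_int (snd l) - cc * of_int (fst l)) * fst v + of_int (- 1) * ((1 + cc) / 2) * of_int (fst l) * snd v"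
  by (simp_all add: dot_def B1_def B2_def bb_cc field_simps)

lemma pull_sum:
  assumes b: "budget lam (hs, rs, ts)" and q: "q \<in> region s'" and l: "l \<in> set (covs s)"
  shows "contracts 1 s s' loss \<Longrightarrow> cov_sum l (map (\<lambda>h. B1 (h q)) hs) \<le> (of_int (199800000000 - loss l) / 200000000000) * lam"
    and "contracts (- 1) s s' loss \<Longrightarrow> cov_sum l (map (\<lambda>h. B2 (h q)) hs) \<le> (of_int (199800000000 - loss l) / 200000000000) * lam"
proof -
  have bq: "cov_sum l (map (\<lambda>h. h q) hs) \<le> lam" if "l \<in> set (covs s')" for l
    using b q that unfolding budget_def by auto
  show "cov_sum l (map (\<lambda>h. B1 (h q)) hs) \<le> (of_int (199800000000 - loss l) / 200000000000) * lam" if "contracts 1 s s' loss"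
    using contracts_sum[OF that l cc_range bq] by (simp add: cov_sum_def dot_B comp_def)
  show "cov_sum l (map (\<lambda>h. B2 (h q)) hs) \<le> (of_int (199800000000 - loss l) / 200000000000) * lam" if "contracts (- 1) s s' loss"
    using contracts_sum[OF that l cc_range bq] by (simp add: cov_sum_def dot_B comp_def)
qed

lemma budget_nonneg: assumes b: "budget lam c" shows "0 \<le> lam"
proof -
  have "(1, 1) \<in> region T" by (simp add: square_def dl_def)
  moreover have "(333, -912) \<in> set (covs T)" by simp
  ultimately have "cov_sum (333, -912) (map (\<lambda>h. h (1, 1)) (fst c)) \<le> lam" using b unfolding budget_def by blast
  with cov_sum_nonneg show ?thesis by (rule order_trans)
qed

text \<open>Next to the folding line the pulled back fields use the factor 0.999 minus the reserved
  loss, and the ghosts fill exactly this loss. Elsewhere the ghosts vanish and the ordinary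
  transition applies.\<close>

lemma field_step_plus:
  assumes ok: "okc (hs, rs, ts)" and b: "budget lam (hs, rs, ts)" and p: "p \<in> region s" and l: "l \<in> set (covs s)" and lf: "lf p \<le> 1/2"
  shows "cov_sum l (map (\<lambda>h. h p) (fst (stepc dl (hs, rs, ts)))) \<le> 999/1000 * lam"
proof -
  have ts: "\<forall>\<tau>\<in>set ts. tame \<tau> \<and> (\<forall>p. 0 \<le> \<tau> p)" using ok by (auto simp: okc_def)
  have "0 < bb * 2" using bb_pos by simp
  then have am: "\<not> 0 < aff n_minus p" unfolding aff_minus using lf by (simp add: not_less mult_nonneg_nonpos)
  have M: "cov_sum l (map (\<lambda>h. h p) (map (gminus dl) ts)) \<le> bb * \<bar>dot l d_minus\<bar> * 0"
    unfolding gminus_def by (rule ghost_sum[OF ts]) (use bb_pos am in auto)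
  have U: "map (\<lambda>h. h p) (map Up hs) = map (\<lambda>h. B1 (h (A1 p))) hs" using lf by (simp add: Up_def)
  have ch: "check_state s" by (rule check_all)
  have G: "Gm p = A1 p" using lf by (simp add: Gm_def)
  have dp: "\<bar>dot l d_plus\<bar> = of_int \<bar>fst l + snd l\<bar>" by (simp add: dot_def d_plus_def)
  show ?thesis
  proof (cases "0 < aff n_plus p \<and> aff n_plus p < dl \<and> good_base n_plus d_plus p")
    case True
    then have near: "\<bar>lf p - 1/2\<bar> < dl" by (simp add: aff_plus)
    obtain s' where s': "event_next s = Some s'" "s' \<in> {T, TD, Tx, T3}"
      and reg: "\<forall>x z. 0 \<le> x \<longrightarrow> x \<le> 1 \<longrightarrow> \<bar>x - snd p\<bar> \<le> 2 * dl \<longrightarrow> 1 - 2 * dl \<le> z \<longrightarrow> z \<le> 1 \<longrightarrow> (x, z) \<in> region s'"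
      using event_step[OF p near] by blast
    have sq: "0 \<le> snd p" "snd p \<le> 1" using squareD[OF region_square[OF p]] by auto
    have "(snd p, snd (A1 p)) \<in> region s'"
      using reg sq near lf by (auto simp: A1_def dl_def)
    then have q: "A1 p \<in> region s'" by (simp add: A1_def)
    have ct: "contracts 1 s s' (\<lambda>l. 10000 * top_weight s' * \<bar>fst l + snd l\<bar>)"
      using ch s'(1) by (simp add: check_state_def)
    have P: "cov_sum l (map (\<lambda>h. h p) (map (gplus dl) ts)) \<le> 1/2 * \<bar>dot l d_plus\<bar> * (lam * (of_int (top_weight s') / 10000000))"
      unfolding gplus_def
    proof (rule ghost_sum[OF ts])
      show "(\<Sum>\<tau>\<leftarrow>ts. side_val (\<lambda>p. \<tau> (Gm p)) d_plus (base n_plus d_plus p)) \<le> lam * (of_int (top_weight s') / 10000000)"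
        by (rule side_sum_event[OF _ b p s'(2) reg lf_base(1)])
           (use True near ts in \<open>auto simp: base_facts good_base_def d_plus_def[THEN arg_cong, of snd]\<close>)
    qed (use True in auto)
    have "cov_sum l (map (\<lambda>h. h p) (fst (stepc dl (hs, rs, ts)))) \<le>
      (of_int (199800000000 - 10000 * top_weight s' * \<bar>fst l + snd l\<bar>) / 200000000000) * lam
      + 1/2 * \<bar>dot l d_plus\<bar> * (lam * (of_int (top_weight s') / 10000000)) + bb * \<bar>dot l d_minus\<bar> * 0"
      unfolding stepc_def fst_conv snd_conv map_append cov_sum_append U
      using pull_sum(1)[OF b q l ct] P M by linarith
    also have "\<dots> = 999/1000 * lam" unfolding dp by (simp add: field_simps)
    finally show ?thesis .
  next
    case False
    obtain s' where s': "plus_next s = Some s'" and q: "A1 p \<in> region s'" using plus_step[OF p lf] by blast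
    have ct: "contracts 1 s s' (\<lambda>l. 0)" using ch s'(1) by (simp add: check_state_def)
    have P: "cov_sum l (map (\<lambda>h. h p) (map (gplus dl) ts)) \<le> 1/2 * \<bar>dot l d_plus\<bar> * 0"
      unfolding gplus_def by (rule ghost_sum[OF ts]) (use False in auto)
    show ?thesis
      unfolding stepc_def fst_conv snd_conv map_append cov_sum_append U
      using pull_sum(1)[OF b q l ct] P M by simp
  qed
qed

lemma field_step_minus:
  assumes ok: "okc (hs, rs, ts)" and b: "budget lam (hs, rs, ts)" and p: "p \<in> region s" and l: "l \<in> set (covs s)" and lf: "1/2 < lf p"
  shows "cov_sum l (map (\<lambda>h. h p) (fst (stepc dl (hs, rs, ts)))) \<le> 999/1000 * lam"
proof -
  have ts: "\<forall>\<tau>\<in>set ts. tame \<tau> \<and> (\<forall>p. 0 \<le> \<tau> p)" using ok by (auto simp: okc_def)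
  have lam0: "0 \<le> lam" by (rule budget_nonneg[OF b])
  have P: "cov_sum l (map (\<lambda>h. h p) (map (gplus dl) ts)) \<le> 1/2 * \<bar>dot l d_plus\<bar> * 0"
    unfolding gplus_def by (rule ghost_sum[OF ts]) (use lf in \<open>auto simp: aff_plus\<close>)
  have U: "map (\<lambda>h. h p) (map Up hs) = map (\<lambda>h. B2 (h (A2 p))) hs" using lf by (simp add: Up_def)
  have ch: "check_state s" by (rule check_all)
  have dm: "\<bar>dot l d_minus\<bar> = of_int \<bar>fst l\<bar>" by (simp add: dot_def d_minus_def)
  show ?thesis
  proof (cases "0 < aff n_minus p \<and> aff n_minus p < dl \<and> good_base n_minus d_minus p")
    case True
    have near: "\<bar>lf p - 1/2\<bar> < dl" using near_minus True by blast
    obtain s' where s': "event_next s = Some s'" "s' \<in> {T, TD, Tx, T3}"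
      and reg: "\<forall>x z. 0 \<le> x \<longrightarrow> x \<le> 1 \<longrightarrow> \<bar>x - snd p\<bar> \<le> 2 * dl \<longrightarrow> 1 - 2 * dl \<le> z \<longrightarrow> z \<le> 1 \<longrightarrow> (x, z) \<in> region s'"
      using event_step[OF p near] by blast
    have sq: "0 \<le> snd p" "snd p \<le> 1" using squareD[OF region_square[OF p]] by auto
    have "(snd p, snd (A2 p)) \<in> region s'"
      using reg sq near lf by (auto simp: A2_def dl_def)
    then have q: "A2 p \<in> region s'" by (simp add: A2_def)
    have ct: "contracts (- 1) s s' (\<lambda>l. 13885 * top_weight s' * \<bar>fst l\<bar>)"
      using ch s'(1) by (simp add: check_state_def)
    have M: "cov_sum l (map (\<lambda>h. h p) (map (gminus dl) ts)) \<le> bb * \<bar>dot l d_minus\<bar> * (lam * (of_int (top_weight s') / 10000000))"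
      unfolding gminus_def
    proof (rule ghost_sum[OF ts])
      show "(\<Sum>\<tau>\<leftarrow>ts. side_val (\<lambda>p. \<tau> (Gm p)) d_minus (base n_minus d_minus p)) \<le> lam * (of_int (top_weight s') / 10000000)"
        by (rule side_sum_event[OF _ b p s'(2) reg lf_base(2)])
           (use True near ts in \<open>auto simp: base_facts good_base_def dl_def d_minus_def[THEN arg_cong, of snd]\<close>)
    qed (use True bb_pos in auto)
    have w0: "0 \<le> top_weight s'" using s'(2) by auto
    have M': "bb * \<bar>dot l d_minus\<bar> * (lam * (of_int (top_weight s') / 10000000))
      \<le> 69425 / 100000 * \<bar>dot l d_minus\<bar> * (lam * (of_int (top_weight s') / 10000000))"
      using bb_small lam0 w0 by (intro mult_right_mono) auto
    have "cov_sum l (map (\<lambda>h. h p) (fst (stepc dl (hs, rs, ts)))) \<le>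
      (of_int (199800000000 - 13885 * top_weight s' * \<bar>fst l\<bar>) / 200000000000) * lam
      + 69425 / 100000 * \<bar>dot l d_minus\<bar> * (lam * (of_int (top_weight s') / 10000000)) + 1/2 * \<bar>dot l d_plus\<bar> * 0"
      unfolding stepc_def fst_conv snd_conv map_append cov_sum_append U
      using pull_sum(2)[OF b q l ct] P M M' by linarith
    also have "\<dots> = 999/1000 * lam" unfolding dm by (simp add: field_simps)
    finally show ?thesis .
  next
    case False
    obtain s' where s': "minus_next s = Some s'" and q: "A2 p \<in> region s'" using minus_step[OF p lf] by blast
    have ct: "contracts (- 1) s s' (\<lambda>l. 0)" using ch s'(1) by (simp add: check_state_def)
    have M: "cov_sum l (map (\<lambda>h. h p) (map (gminus dl) ts)) \<le> bb * \<bar>dot l d_minus\<bar> * 0"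
      unfolding gminus_def by (rule ghost_sum[OF ts]) (use False bb_pos in auto)
    show ?thesis
      unfolding stepc_def fst_conv snd_conv map_append cov_sum_append U
      using pull_sum(2)[OF b q l ct] P M by simp
  qed
qed

lemma budget_step:
  assumes ok: "okc c" and b: "budget lam c"
  shows "budget (999/1000 * lam) (stepc dl c)"
proof -
  obtain hs rs ts where c: "c = (hs, rs, ts)" by (cases c) auto
  note ok = ok[unfolded c] and b = b[unfolded c]
  have lam0: "0 \<le> lam" by (rule budget_nonneg[OF b])
  have R: "(\<Sum>r\<leftarrow>map Rr hs. r p) \<le> 999/1000 * lam * (of_int (right_weight s) / 10000000)"
    if s: "s \<in> {R, RD, Rx, R3}" and p: "p \<in> region s" for s p
  proof -
    have l: "1/2 < lf p" using minus_only[OF _ p] s by (auto simp: dl_def)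
    obtain s' where s': "minus_next s = Some s'" "A2 p \<in> region s'" using minus_step[OF p l] by blast
    have i: "s' = inner_of s" using s s'(1) by auto
    have bq: "cov_sum l (map (\<lambda>h. h (A2 p)) hs) \<le> lam" if "l \<in> set (covs (inner_of s))" for l
      using b s'(2) that unfolding budget_def i by auto
    have ck: "check_right s" using check_right s by auto
    from right_sum[OF ck cc_range bq] show ?thesis by (simp add: Rr_def bb_cc comp_def)
  qed
  have Tt: "(\<Sum>\<tau>\<leftarrow>map (\<lambda>r p. r (Gm p)) rs. \<tau> p) \<le> 999/1000 * lam * (of_int (top_weight s) / 10000000)"
    if s: "s \<in> {T, TD, Tx, T3}" and p: "p \<in> region s" for s p
  proof -
    have q: "Gm p \<in> region (right_of s)"
    proof (cases "lf p \<le> 1/2")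
      case True
      obtain s' where s': "plus_next s = Some s'" "A1 p \<in> region s'" using plus_step[OF p True] by blast
      have "s' = right_of s" using s s'(1) by auto
      then show ?thesis using s' True by (simp add: Gm_def)
    next
      case False
      obtain s' where s': "minus_next s = Some s'" "A2 p \<in> region s'" using minus_step[OF p] False by auto
      have "s' = right_of s" using s s'(1) by auto
      then show ?thesis using s' False by (simp add: Gm_def)
    qed
    have rs: "right_of s \<in> {R, RD, Rx, R3}" using s by auto
    then have "(\<Sum>r\<leftarrow>rs. r (Gm p)) \<le> lam * (of_int (right_weight (right_of s)) / 10000000)"
      using b[unfolded budget_def, rule_format, OF q] rs by (simp only: fst_conv snd_conv)
    also have "\<dots> \<le> lam * (999/1000 * of_int (top_weight s) / 10000000)"
      using s lam0 by (intro mult_left_mono) auto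
    finally show ?thesis by (simp add: comp_def mult_ac)
  qed
  have F: "cov_sum l (map (\<lambda>h. h p) (fst (stepc dl (hs, rs, ts)))) \<le> 999/1000 * lam"
    if "p \<in> region s" "l \<in> set (covs s)" for p s l
    using field_step_plus[OF ok b that] field_step_minus[OF ok b that] by linarith
  have st: "fst (snd (stepc dl (hs, rs, ts))) = map Rr hs" "snd (snd (stepc dl (hs, rs, ts))) = map (\<lambda>r p. r (Gm p)) rs"
    by (simp_all add: stepc_def)
  show ?thesis unfolding budget_def c st using F R Tt by blast
qed

lemma budget_iterate:
  assumes "okc c" "budget lam c"
  shows "okc ((stepc dl ^^ n) c) \<and> budget ((999/1000) ^ n * lam) ((stepc dl ^^ n) c)"
proof (induction n)
  case (Suc n)
  then show ?case using okc_stepc budget_step[of "(stepc dl ^^ n) c" "(999/1000) ^ n * lam"] by (simp add: mult.assoc)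
qed (use assms in simp)

end

section \<open>Uniform bounds for the iterated densities\<close>

lemma nn_integral_sum_list:
  assumes "\<And>x. x \<in> set xs \<Longrightarrow> F x \<in> borel_measurable M"
  shows "(\<Sum>x\<leftarrow>xs. \<integral>\<^sup>+p. F x p \<partial>M) = (\<integral>\<^sup>+p. (\<Sum>x\<leftarrow>xs. F x p) \<partial>M)"
  using assms
proof (induction xs)
  case (Cons x xs)
  have [measurable]: "(\<lambda>p. \<Sum>x\<leftarrow>xs. F x p) \<in> borel_measurable M" "F x \<in> borel_measurable M"
  proof -
    have "(\<lambda>p. \<Sum>x\<leftarrow>ys. F x p) \<in> borel_measurable M" if "set ys \<subseteq> set (x # xs)" for ys
      using that Cons.prems by (induction ys) auto
    from this[of xs] show "(\<lambda>p. \<Sum>x\<leftarrow>xs. F x p) \<in> borel_measurable M" by auto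
    show "F x \<in> borel_measurable M" using Cons.prems by simp
  qed
  show ?case using Cons by (simp add: nn_integral_add)
qed simp

lemma ennreal_sum_list:
  "(\<And>x. x \<in> set xs \<Longrightarrow> 0 \<le> f x) \<Longrightarrow> (\<Sum>x\<leftarrow>xs. ennreal (f x)) = ennreal (\<Sum>x\<leftarrow>xs. f x)"
proof (induction xs)
  case (Cons x xs)
  have "0 \<le> (\<Sum>x\<leftarrow>xs. f x)" using Cons.prems by (intro sum_list_nonneg) auto
  then show ?case using Cons by (simp add: ennreal_plus)
qed simp

lemma emeasure_square: "emeasure lborel square = 1"
proof -
  have "emeasure (lborel \<Otimes>\<^sub>M lborel) square = emeasure lborel {0..1::real} * emeasure lborel {0..1::real}"
    unfolding square_def by (rule lborel.emeasure_pair_measure_Times) auto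
  then show ?thesis by (simp add: lborel_prod)
qed

context memory_range
begin

text \<open>A pyramid over a small diamond around the centre: Lipschitz, away from the edges, and
  inside \<open>X0\<close> because x + y > 3/4 there while 2a < 3/4.\<close>

definition bump :: "real \<times> real \<Rightarrow> real" where
  "bump p = max 0 (1 - 4 * \<bar>fst p - 1/2\<bar> - 4 * \<bar>snd p - 1/2\<bar>)"

definition "carried f \<longleftrightarrow> nice f \<and> (\<forall>p. p \<notin> X0 \<longrightarrow> f p = 0)"

lemma carried_Pop: assumes "carried f" shows "carried (Pop f)"
proof -
  have f: "nice f" "\<And>p. p \<notin> X0 \<Longrightarrow> f p = 0" using assms unfolding carried_def by auto
  have "Pop f q = 0" if q: "q \<notin> X0" for q
  proof (cases "snd q \<le> 1")
    case True
    have "psi1 q \<notin> X0" using X0_step(1)[of "psi1 q"] q True by (auto simp: A_psi lf_psi)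
    moreover have "psi2 q \<notin> X0" using A2_X0[of "psi2 q"] q True by (auto simp: A_psi lf_psi)
    ultimately show ?thesis by (simp add: Pop_def f)
  qed (simp add: Pop_def)
  then show ?thesis using nice_Pop[OF f(1)] unfolding carried_def by blast
qed

lemma carried_bump: "carried bump"
proof -
  have "bump \<in> borel_measurable borel" unfolding bump_def by measurable
  moreover have "0 \<le> bump p" "bump p \<le> 1" for p by (auto simp: bump_def)
  moreover have "p \<in> X0" if "bump p \<noteq> 0" for p
  proof -
    have "\<bar>fst p - 1/2\<bar> + \<bar>snd p - 1/2\<bar> < 1/4" using that by (auto simp: bump_def max_def split: if_splits)
    then have "1/4 \<le> fst p" "fst p \<le> 1" "1/4 \<le> snd p" "snd p \<le> 1" "3/4 \<le> fst p + snd p" by linarith+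
    then show ?thesis using a_hi by (auto simp: X0_def intro!: squareI)
  qed
  moreover have "p \<in> square" if "p \<in> X0" for p using that by (rule X0_square)
  ultimately show ?thesis unfolding carried_def nice_def by metis
qed

lemma carried_iterate: "carried ((Pop ^^ n) bump)"
  by (induction n) (auto simp: carried_bump carried_Pop)

definition "mass = (\<integral>\<^sup>+p. ennreal (bump p) \<partial>lborel)"

lemma mass_iterate: "(\<integral>\<^sup>+p. ennreal ((Pop ^^ n) bump p) \<partial>lborel) = mass"
proof (induction n)
  case (Suc n)
  have [measurable]: "(Pop ^^ n) bump \<in> borel_measurable borel" and n0: "\<And>p. 0 \<le> (Pop ^^ n) bump p"
    using carried_iterate[of n] by (auto simp: carried_def nice_def)
  from push[OF _ n0, where F = "\<lambda>_. 1"] show ?case using Suc by simp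
qed (simp add: mass_def)

lemma mass_le: "mass \<le> 1"
proof -
  have "mass \<le> (\<integral>\<^sup>+p. indicator square p \<partial>lborel)"
    unfolding mass_def
  proof (rule nn_integral_mono)
    fix p
    have "p \<notin> square \<Longrightarrow> bump p = 0" using carried_bump unfolding carried_def nice_def by blast
    then show "ennreal (bump p) \<le> indicator square p" by (cases "p \<in> square") (auto simp: bump_def)
  qed
  then show ?thesis by (simp add: emeasure_square)
qed

lemma bump_lipschitz: "\<bar>bump q - bump p\<bar> \<le> 4 * (\<bar>fst q - fst p\<bar> + \<bar>snd q - snd p\<bar>)"
proof -
  have m: "\<bar>max 0 u - max 0 v\<bar> \<le> \<bar>u - v\<bar>" for u v :: real by (simp add: max_def)
  have tri: "\<bar>\<bar>u - 1/2\<bar> - \<bar>v - 1/2\<bar>\<bar> \<le> \<bar>u - v\<bar>" for u v :: real by linarith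
  have fin: "\<bar>1 - 4 * A - 4 * B - (1 - 4 * C - 4 * D)\<bar> \<le> 4 * E + 4 * F"
    if "\<bar>A - C\<bar> \<le> E" "\<bar>B - D\<bar> \<le> F" for A B C D E F :: real using that by linarith
  show ?thesis unfolding bump_def distrib_left by (rule order_trans[OF m fin[OF tri tri]])
qed

text \<open>A point of \<open>X0\<close> near the folding line is in state \<open>F0\<close>, so the
  widths beside it are bounded by the budget on the top edge, and the weights there are below 1.
  What is left is a multiple of the density.\<close>

lemma leak_sum:
  assumes ts: "\<forall>\<tau>\<in>set ts. tame \<tau> \<and> (\<forall>p. 0 \<le> \<tau> p)" and b: "budget lam (hs, rs, ts)" and f: "carried f"
    and m: "0 \<le> m" "m \<le> 1" and q: "\<And>p. lf (base n d p) = 1/2" and d: "\<bar>lf d\<bar> \<le> 1" "-1 \<le> snd d" "snd d \<le> 0"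
    and near: "\<And>p. 0 < aff n p \<Longrightarrow> aff n p < dl \<Longrightarrow> \<bar>lf p - 1/2\<bar> < dl \<and> \<bar>snd (base n d p) - snd p\<bar> \<le> dl"
  shows "(\<Sum>\<tau>\<leftarrow>ts. leak dl m n d f \<tau>) \<le> ennreal (4 / dl * lam) * (\<integral>\<^sup>+p. ennreal (f p) \<partial>lborel)"
proof -
  have fm [measurable]: "f \<in> borel_measurable borel" and f0: "\<And>p. 0 \<le> f p" and fX: "\<And>p. p \<notin> X0 \<Longrightarrow> f p = 0"
    using f by (auto simp: carried_def nice_def)
  have lam0: "0 \<le> lam" by (rule budget_nonneg[OF b])
  have dl0: "0 < dl" by (simp add: dl_def)
  define S where "S \<tau> p = side_val (\<lambda>p. \<tau> (Gm p)) d (base n d p)" for \<tau> :: "real \<times> real \<Rightarrow> real" and p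
  have S0: "0 \<le> S \<tau> p" if "\<tau> \<in> set ts" for \<tau> p
    unfolding S_def using side_val_nonneg[OF tame_Gm[of \<tau>], of d "base n d p"] ts that by blast
  have Sm: "S \<tau> \<in> borel_measurable borel" if "\<tau> \<in> set ts" for \<tau>
    unfolding S_def[abs_def] using ts that by (intro tame_borel[OF tame_affmap[OF tame_side[OF tame_Gm] affmap_base]]) auto
  let ?I = "indicator {p. 0 < aff n p \<and> aff n p < dl \<and> good_base n d p} :: real \<times> real \<Rightarrow> ennreal"
  have "(\<Sum>\<tau>\<leftarrow>ts. leak dl m n d f \<tau>) = (\<integral>\<^sup>+p. (\<Sum>\<tau>\<leftarrow>ts. ennreal (4 / dl * (m * S \<tau> p) * f p) * ?I p) \<partial>lborel)"
    unfolding leak_def S_def[symmetric]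
  proof (rule nn_integral_sum_list)
    fix \<tau> assume "\<tau> \<in> set ts"
    note [measurable] = Sm[OF this]
    show "(\<lambda>p. ennreal (4 / dl * (m * S \<tau> p) * f p) * ?I p) \<in> borel_measurable lborel" by measurable
  qed
  also have "\<dots> \<le> (\<integral>\<^sup>+p. ennreal (4 / dl * lam) * ennreal (f p) \<partial>lborel)"
  proof (rule nn_integral_mono)
    fix p
    show "(\<Sum>\<tau>\<leftarrow>ts. ennreal (4 / dl * (m * S \<tau> p) * f p) * ?I p) \<le> ennreal (4 / dl * lam) * ennreal (f p)"
    proof (cases "p \<in> X0 \<and> 0 < aff n p \<and> aff n p < dl \<and> good_base n d p")
      case True
      have pF: "p \<in> region F0" using True by simp
      have nr: "\<bar>lf p - 1/2\<bar> < dl" "\<bar>snd (base n d p) - snd p\<bar> \<le> dl" using near True by auto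
      obtain s' where s': "event_next F0 = Some s'" "s' \<in> {T, TD, Tx, T3}"
        and reg: "\<forall>x z. 0 \<le> x \<longrightarrow> x \<le> 1 \<longrightarrow> \<bar>x - snd p\<bar> \<le> 2 * dl \<longrightarrow> 1 - 2 * dl \<le> z \<longrightarrow> z \<le> 1 \<longrightarrow> (x, z) \<in> region s'"
        using event_step[OF pF nr(1)] by blast
      have tam: "\<forall>\<tau>\<in>set ts. tame \<tau>" using ts by auto
      have "(\<Sum>\<tau>\<leftarrow>ts. S \<tau> p) \<le> lam * (of_int (top_weight s') / 10000000)"
        unfolding S_def
        by (rule side_sum_event[OF tam b pF s'(2) reg q]) (use True nr d in \<open>auto simp: good_base_def\<close>)
      also have "\<dots> \<le> lam" using s'(2) lam0 by (intro mult_left_le) auto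
      finally have Sl: "(\<Sum>\<tau>\<leftarrow>ts. S \<tau> p) \<le> lam" .
      have "(\<Sum>\<tau>\<leftarrow>ts. ennreal (4 / dl * (m * S \<tau> p) * f p) * ?I p) = (\<Sum>\<tau>\<leftarrow>ts. ennreal (4 / dl * (m * S \<tau> p) * f p))"
        using True by simp
      also have "\<dots> = ennreal (\<Sum>\<tau>\<leftarrow>ts. 4 / dl * (m * S \<tau> p) * f p)"
        by (rule ennreal_sum_list) (use S0 m f0 dl0 in auto)
      also have "(\<Sum>\<tau>\<leftarrow>ts. 4 / dl * (m * S \<tau> p) * f p) = (4 / dl * f p) * (m * (\<Sum>\<tau>\<leftarrow>ts. S \<tau> p))"
        unfolding sum_list_const_mult[symmetric] by (intro arg_cong[of _ _ sum_list] map_cong) auto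
      also have "ennreal \<dots> \<le> ennreal ((4 / dl * f p) * (1 * lam))"
        using m f0 dl0 Sl lam0 by (intro ennreal_leI mult_left_mono mult_mono sum_list_nonneg) (use S0[of _ p] in auto)
      also have "\<dots> = ennreal (4 / dl * lam) * ennreal (f p)"
        using f0 lam0 dl0 by (simp add: ennreal_mult'[symmetric] mult_ac)
      finally show ?thesis .
    next
      case False
      have z: "ennreal (4 / dl * (m * S \<tau> p) * f p) * ?I p = 0" for \<tau>
        using False fX[of p] by (auto simp: indicator_def)
      then show ?thesis by (simp only: z) simp
    qed
  qed
  also have "\<dots> = ennreal (4 / dl * lam) * (\<integral>\<^sup>+p. ennreal (f p) \<partial>lborel)" by (rule nn_integral_cmult) auto
  finally show ?thesis .
qed

lemma Leak_bound:
  assumes ok: "okc c" and b: "budget lam c" and f: "carried f"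
  shows "Leak dl f c \<le> ennreal (8 / dl * lam) * (\<integral>\<^sup>+p. ennreal (f p) \<partial>lborel)"
proof -
  obtain hs rs ts where c: "c = (hs, rs, ts)" by (cases c) auto
  have ts: "\<forall>\<tau>\<in>set ts. tame \<tau> \<and> (\<forall>p. 0 \<le> \<tau> p)" using ok by (auto simp: okc_def c)
  note b = b[unfolded c]
  have dl0: "0 < dl" by (simp add: dl_def)
  have 1: "(\<Sum>\<tau>\<leftarrow>ts. leak dl (1/2) n_plus d_plus f \<tau>) \<le> ennreal (4 / dl * lam) * (\<integral>\<^sup>+p. ennreal (f p) \<partial>lborel)"
    by (rule leak_sum[OF ts b f _ _ lf_base(1)]) (use base_facts in \<open>auto simp: aff_plus d_plus_def\<close>)
  have 2: "(\<Sum>\<tau>\<leftarrow>ts. leak dl bb n_minus d_minus f \<tau>) \<le> ennreal (4 / dl * lam) * (\<integral>\<^sup>+p. ennreal (f p) \<partial>lborel)"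
    by (rule leak_sum[OF ts b f _ _ lf_base(2)])
       (use base_facts bb_pos bb_less dl0 in \<open>auto simp: near_minus d_minus_def\<close>)
  have "Leak dl f c = (\<Sum>\<tau>\<leftarrow>ts. leak dl (1/2) n_plus d_plus f \<tau>) + (\<Sum>\<tau>\<leftarrow>ts. leak dl bb n_minus d_minus f \<tau>)"
    by (simp add: Leak_def leaks_def c sum_list_addf)
  also have "\<dots> \<le> ennreal (4 / dl * lam) * (\<integral>\<^sup>+p. ennreal (f p) \<partial>lborel) + ennreal (4 / dl * lam) * (\<integral>\<^sup>+p. ennreal (f p) \<partial>lborel)"
    by (rule add_mono[OF 1 2])
  also have "\<dots> = ennreal (8 / dl * lam) * (\<integral>\<^sup>+p. ennreal (f p) \<partial>lborel)"
    using budget_nonneg[OF b] by (simp add: distrib_right[symmetric] ennreal_plus[symmetric] dl_def del: ennreal_plus)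
  finally show ?thesis .
qed

text \<open>Every density has the same mass, at most 1, and the budgets decay like 0.999^j; the
  geometric series contributes the factor 1000.\<close>

lemma sum_leaks:
  assumes ok: "okc c" and b: "budget lam c"
  shows "(\<Sum>j<n. Leak dl ((Pop ^^ (n - Suc j)) bump) ((stepc dl ^^ j) c)) \<le> ennreal (8000 / dl * lam)"
proof -
  have lam0: "0 \<le> lam" by (rule budget_nonneg[OF b])
  have "(\<Sum>j<n. Leak dl ((Pop ^^ (n - Suc j)) bump) ((stepc dl ^^ j) c)) \<le> (\<Sum>j<n. ennreal (8 / dl * ((999/1000) ^ j * lam)))"
  proof (rule sum_mono)
    fix j
    have "Leak dl ((Pop ^^ (n - Suc j)) bump) ((stepc dl ^^ j) c) \<le> ennreal (8 / dl * ((999/1000) ^ j * lam)) * mass"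
      using Leak_bound[OF _ _ carried_iterate, of "(stepc dl ^^ j) c" "(999/1000) ^ j * lam" "n - Suc j"] budget_iterate[OF ok b, of j]
      unfolding mass_iterate by blast
    also have "\<dots> \<le> ennreal (8 / dl * ((999/1000) ^ j * lam)) * 1" using mass_le by (intro mult_left_mono) auto
    finally show "Leak dl ((Pop ^^ (n - Suc j)) bump) ((stepc dl ^^ j) c) \<le> ennreal (8 / dl * ((999/1000) ^ j * lam))" by simp
  qed
  also have "\<dots> = ennreal (\<Sum>j<n. 8 / dl * ((999/1000) ^ j * lam))"
    using lam0 by (intro sum_ennreal) (auto simp: dl_def)
  also have "(\<Sum>j<n. 8 / dl * ((999/1000) ^ j * lam)) = 8 / dl * lam * (\<Sum>j<n. (999/1000) ^ j)"
    by (simp add: sum_distrib_left sum_distrib_right mult_ac)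
  also have "(\<Sum>j<n. (999/1000 :: real) ^ j) = 1000 * (1 - (999/1000) ^ n)"
    by (simp add: sum_gp_strict)
  also have "ennreal (8 / dl * lam * (1000 * (1 - (999/1000) ^ n))) \<le> ennreal (8 / dl * lam * 1000)"
    using lam0 by (intro ennreal_leI mult_left_mono) (auto simp: dl_def)
  finally show ?thesis by (simp add: mult_ac)
qed

lemma budget_size:
  assumes b: "budget lam (hs, rs, ts)" and p: "p \<in> X0"
  shows "(\<Sum>h\<leftarrow>hs. \<bar>fst (h p)\<bar> + \<bar>snd (h p)\<bar>) \<le> 2 * lam"
proof -
  \<comment> \<open>In the units of \<open>dominated\<close>, 50000000 is the bound 1 once the
    factor 4000 is included.\<close>
  have d: "dominated (covs F0) (1, 0) 50000000" "dominated (covs F0) (0, 1) 50000000"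
    by (simp_all add: dominated_def det2_def)
  have bq: "cov_sum l (map (\<lambda>h. h p) hs) \<le> lam" if "l \<in> set (covs F0)" for l
    using b[unfolded budget_def, rule_format, of p F0] p that by auto
  have 1: "cov_sum (1, 0) (map (\<lambda>h. h p) hs) \<le> lam" using dominated_sum[OF d(1) bq] by simp
  have 2: "cov_sum (0, 1) (map (\<lambda>h. h p) hs) \<le> lam" using dominated_sum[OF d(2) bq] by simp
  show ?thesis using 1 2 by (simp add: cov_sum_def dot_def comp_def sum_list_addf)
qed

lemma tame_eventually_small:
  assumes "tame h" "0 < \<eta>"
  shows "eventually (\<lambda>N. \<forall>p. tt N * (h p :: real) \<le> \<eta>) sequentially"
proof -
  have fin: "finite (range h)" by (rule tame_finite_range[OF assms(1)])
  have h: "h p \<le> Max (range h)" for p using fin by (intro Max_ge) auto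
  show ?thesis using eventually_tt_mult_le[OF assms(2), of "Max (range h)"]
  proof eventually_elim
    case (elim N)
    show ?case using mult_left_mono[OF h tt_nonneg, of N] elim order_trans by blast
  qed
qed

lemma tame_pair_abs: "tame h \<Longrightarrow> tame (\<lambda>p. \<bar>fst (h p)\<bar> + \<bar>snd (h p :: real \<times> real)\<bar> :: real)"
  by (rule tame_comp)

lemma bump_support: "bump p \<noteq> 0 \<Longrightarrow> \<bar>fst p - 1/2\<bar> + \<bar>snd p - 1/2\<bar> < 1/4"
  by (auto simp: bump_def max_def split: if_splits)

text \<open>The support enlarged by 1/8 still lies in \<open>X0\<close>, where the budget controls
  the size of the fields.\<close>

lemma bump_shift:
  assumes "\<bar>fst v\<bar> + \<bar>snd v\<bar> \<le> 1/8"
  shows "\<bar>bump (p + v) - bump p\<bar> \<le> indicator X0 p * (4 * (\<bar>fst v\<bar> + \<bar>snd v\<bar>))"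
proof (cases "bump (p + v) = 0 \<and> bump p = 0")
  case False
  have "\<bar>fst p - 1/2\<bar> + \<bar>snd p - 1/2\<bar> < 3/8"
  proof (cases "bump p = 0")
    case True
    then have "\<bar>fst p + fst v - 1/2\<bar> + \<bar>snd p + snd v - 1/2\<bar> < 1/4" using False bump_support[of "p + v"] by simp
    then show ?thesis using assms by linarith
  next
    case False
    then show ?thesis using bump_support[of p] by linarith
  qed
  then have "1/8 \<le> fst p" "fst p \<le> 1" "1/8 \<le> snd p" "snd p \<le> 1" "5/8 \<le> fst p + snd p" by linarith+
  then have "p \<in> X0" using a_hi by (auto simp: X0_def intro!: squareI)
  then show ?thesis using bump_lipschitz[of "p + v" p] by simp
qed simp

lemma X0_measurable [measurable]: "X0 \<in> sets borel"
  unfolding X0_def by measurable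

lemma Qt_bump_sum:
  assumes ok: "\<forall>h\<in>set hs. tame h" and b: "budget lam (hs, rs, ts)" and t: "0 < t"
    and small: "\<forall>h\<in>set hs. \<forall>p. t * (\<bar>fst (h p)\<bar> + \<bar>snd (h p)\<bar>) \<le> 1/8"
  shows "(\<Sum>h\<leftarrow>hs. Qt t bump h) \<le> ennreal (t * (8 * lam))"
proof -
  define w where "w h p = \<bar>fst (h p)\<bar> + \<bar>snd (h p)\<bar>" for h :: "real \<times> real \<Rightarrow> real \<times> real" and p
  have lam0: "0 \<le> lam" by (rule budget_nonneg[OF b])
  have wm: "w h \<in> borel_measurable borel" if "h \<in> set hs" for h
    unfolding w_def[abs_def] using ok that by (intro tame_borel tame_pair_abs) auto
  have "Qt t bump h \<le> (\<integral>\<^sup>+p. indicator X0 p * ennreal (4 * t * w h p) \<partial>lborel)" if h: "h \<in> set hs" for h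
    unfolding Qt_def
  proof (rule nn_integral_mono)
    fix p
    have "t * (\<bar>fst (h p)\<bar> + \<bar>snd (h p)\<bar>) \<le> 1/8" using small h by blast
    then have "\<bar>fst (t *\<^sub>R h p)\<bar> + \<bar>snd (t *\<^sub>R h p)\<bar> \<le> 1/8" using t by (simp add: abs_mult distrib_left)
    from bump_shift[OF this, of p] have "\<bar>bump (p + t *\<^sub>R h p) - bump p\<bar> \<le> indicator X0 p * (4 * t * w h p)"
      using t by (simp add: abs_mult w_def distrib_left mult.assoc)
    then have "ennreal \<bar>bump (p + t *\<^sub>R h p) - bump p\<bar> \<le> indicator X0 p * ennreal (4 * t * w h p)"
      by (auto simp: indicator_def)
    moreover have "indicator A p * x \<le> x" for A :: "(real \<times> real) set" and x :: ennreal by (simp add: indicator_def)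
    ultimately show "indicator {p. fst p \<le> 1 \<and> snd p \<le> 1 \<and> fst (p + t *\<^sub>R h p) \<le> 1 \<and> snd (p + t *\<^sub>R h p) \<le> 1 \<and> h (p + t *\<^sub>R h p) = h p} p
       * ennreal \<bar>bump (p + t *\<^sub>R h p) - bump p\<bar> \<le> indicator X0 p * ennreal (4 * t * w h p)"
      using order_trans by blast
  qed
  then have "(\<Sum>h\<leftarrow>hs. Qt t bump h) \<le> (\<Sum>h\<leftarrow>hs. \<integral>\<^sup>+p. indicator X0 p * ennreal (4 * t * w h p) \<partial>lborel)"
    by (rule sum_list_mono)
  also have "\<dots> = (\<integral>\<^sup>+p. (\<Sum>h\<leftarrow>hs. indicator X0 p * ennreal (4 * t * w h p)) \<partial>lborel)"
  proof (rule nn_integral_sum_list)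
    fix h assume "h \<in> set hs"
    note [measurable] = wm[OF this]
    show "(\<lambda>p. indicator X0 p * ennreal (4 * t * w h p)) \<in> borel_measurable lborel" by measurable
  qed
  also have "\<dots> \<le> (\<integral>\<^sup>+p. ennreal (t * (8 * lam)) * indicator square p \<partial>lborel)"
  proof (rule nn_integral_mono)
    fix p
    show "(\<Sum>h\<leftarrow>hs. indicator X0 p * ennreal (4 * t * w h p)) \<le> ennreal (t * (8 * lam)) * indicator square p"
    proof (cases "p \<in> X0")
      case True
      have "(\<Sum>h\<leftarrow>hs. indicator X0 p * ennreal (4 * t * w h p)) = (\<Sum>h\<leftarrow>hs. ennreal (4 * t * w h p))" using True by simp
      also have "\<dots> = ennreal (\<Sum>h\<leftarrow>hs. 4 * t * w h p)" using t by (intro ennreal_sum_list) (auto simp: w_def)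
      also have "(\<Sum>h\<leftarrow>hs. 4 * t * w h p) = 4 * t * (\<Sum>h\<leftarrow>hs. w h p)" by (rule sum_list_const_mult)
      also have "ennreal \<dots> \<le> ennreal (4 * t * (2 * lam))"
        using budget_size[OF b True] t unfolding w_def by (intro ennreal_leI mult_left_mono) auto
      finally show ?thesis using X0_square[OF True] by (simp add: mult_ac)
    next
      case False
      then have z: "indicator X0 p * ennreal (4 * t * w h p) = 0" for h by simp
      show ?thesis by (simp only: z) simp
    qed
  qed
  also have "\<dots> = ennreal (t * (8 * lam))"
    by (subst nn_integral_cmult_indicator) (auto simp: emeasure_square)
  finally show ?thesis .
qed

text \<open>For small t the strips at the edges miss the support of the bump, so only the difference
  quotients remain, and these are controlled by the Lipschitz constant.\<close>

lemma Val_bump: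
  assumes ok: "okc c" and b: "budget lam c"
  shows "eventually (\<lambda>N. Val (tt N) bump c \<le> ennreal (tt N * (8 * lam))) sequentially"
proof -
  obtain hs rs ts where c: "c = (hs, rs, ts)" by (cases c) auto
  have ok': "\<forall>h\<in>set hs. tame h" "\<forall>r\<in>set rs. tame r" "\<forall>r\<in>set ts. tame r" using ok by (auto simp: okc_def c)
  have 1: "eventually (\<lambda>N. \<forall>h\<in>set hs. \<forall>p. tt N * (\<bar>fst (h p)\<bar> + \<bar>snd (h p)\<bar>) \<le> 1/8) sequentially"
    using ok' by (intro eventually_ball_finite ballI tame_eventually_small tame_pair_abs) auto
  have 2: "eventually (\<lambda>N. \<forall>r\<in>set rs. \<forall>p. tt N * r p \<le> 1/4) sequentially"
    using ok' by (intro eventually_ball_finite ballI tame_eventually_small) auto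
  have 3: "eventually (\<lambda>N. \<forall>r\<in>set ts. \<forall>p. tt N * r p \<le> 1/4) sequentially"
    using ok' by (intro eventually_ball_finite ballI tame_eventually_small) auto
  have z: "fst p \<le> 3/4 \<and> snd p \<le> 3/4" if "bump p \<noteq> 0" for p using bump_support[OF that] by linarith
  from 1 2 3 show ?thesis
  proof eventually_elim
    case (elim N)
    have "RS (tt N) bump r = 0" if "r \<in> set rs" for r
    proof -
      have "ennreal (bump p) * indicator {p. 1 - tt N * r p < fst p \<and> fst p \<le> 1} p = 0" for p
        using elim(2)[rule_format, OF that, of p] z[of p] by (cases "bump p = 0") (auto simp: indicator_def)
      then show ?thesis unfolding RS_def by (simp only: nn_integral_const mult_zero_left)
    qed
    moreover have "TS (tt N) bump r = 0" if "r \<in> set ts" for r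
    proof -
      have "ennreal (bump p) * indicator {p. 1 - tt N * r p < snd p \<and> snd p \<le> 1} p = 0" for p
        using elim(3)[rule_format, OF that, of p] z[of p] by (cases "bump p = 0") (auto simp: indicator_def)
      then show ?thesis unfolding TS_def by (simp only: nn_integral_const mult_zero_left)
    qed
    ultimately have "(\<Sum>r\<leftarrow>rs. RS (tt N) bump r) = (\<Sum>r\<leftarrow>rs. 0)" "(\<Sum>r\<leftarrow>ts. TS (tt N) bump r) = (\<Sum>r\<leftarrow>ts. 0)"
      by (intro arg_cong[of _ _ sum_list] map_cong refl; simp)+
    then have "Val (tt N) bump c = (\<Sum>h\<leftarrow>hs. Qt (tt N) bump h)" by (simp add: Val_def c)
    also have "\<dots> \<le> ennreal (tt N * (8 * lam))"
      by (rule Qt_bump_sum[OF ok'(1) b[unfolded c] tt_pos elim(1)])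
    finally show ?case .
  qed
qed

lemma covs_bound: "l \<in> set (covs s) \<Longrightarrow> \<bar>fst l\<bar> \<le> 4000 \<and> \<bar>snd l\<bar> \<le> 4000"
proof -
  assume l: "l \<in> set (covs s)"
  have "list_all (\<lambda>l. \<bar>fst l\<bar> \<le> 4000 \<and> \<bar>snd l\<bar> \<le> 4000) (covs s)" by (cases s) simp_all
  then show ?thesis using l by (simp add: list_all_iff)
qed

text \<open>The 8 stems from the difference quotients of the bump, 8000 / \<open>dl\<close> from the
  leaks; 4000 bounds the entries of the covectors and hence the initial budget, and 1 absorbs the
  o(t) error.\<close>

definition "shift_const = 4000 * (8 + 8000 / dl) + 1"

text \<open>How large \<open>N\<close> has to be depends on n, but the constant does not;
  \<open>shift_bound\<close> then frees the estimate from \<open>N\<close>.\<close>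

lemma Qt_iterate:
  fixes v :: "real \<times> real"
  assumes v: "v \<noteq> 0"
  shows "eventually (\<lambda>N. Qt (tt N) ((Pop ^^ n) bump) (\<lambda>_. v) \<le> ennreal (tt N * (shift_const * (\<bar>fst v\<bar> + \<bar>snd v\<bar>)))) sequentially"
proof -
  define w where "w = \<bar>fst v\<bar> + \<bar>snd v\<bar>"
  define c :: config where "c = ([\<lambda>_. v], [], [])"
  have w: "0 < w" using v by (cases v) (auto simp: w_def zero_prod_def)
  have ok: "okc c" by (simp add: okc_def c_def)
  have b: "budget (4000 * w) c"
    unfolding budget_def
  proof (intro allI ballI conjI impI)
    fix s p l assume "l \<in> set (covs s)"
    from covs_bound[OF this] have l: "\<bar>real_of_int (fst l)\<bar> \<le> 4000" "\<bar>real_of_int (snd l)\<bar> \<le> 4000" by linarith+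
    have "\<bar>dot l v\<bar> \<le> \<bar>real_of_int (fst l)\<bar> * \<bar>fst v\<bar> + \<bar>real_of_int (snd l)\<bar> * \<bar>snd v\<bar>"
      unfolding dot_def by (metis abs_mult abs_triangle_ineq)
    also have "\<dots> \<le> 4000 * \<bar>fst v\<bar> + 4000 * \<bar>snd v\<bar>" using l by (intro add_mono mult_right_mono) auto
    finally show "cov_sum l (map (\<lambda>h. h p) (fst c)) \<le> 4000 * w" by (simp add: cov_sum_def c_def w_def)
  qed (use w in \<open>auto simp: c_def\<close>)
  have nf: "nice bump" using carried_bump by (simp add: carried_def)
  have dl: "0 < dl" "dl \<le> 1 - bb" using bb_small by (auto simp: dl_def)
  have 1: "eventually (\<lambda>N. Val (tt N) ((Pop ^^ n) bump) c \<le> Val (tt N) bump ((stepc dl ^^ n) c)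
    + ennreal (tt N) * (\<Sum>j<n. Leak dl ((Pop ^^ (n - Suc j)) bump) ((stepc dl ^^ j) c)) + ennreal (tt N * w)) sequentially"
    by (rule config_iterate[OF nf ok dl w])
  have 2: "eventually (\<lambda>N. Val (tt N) bump ((stepc dl ^^ n) c) \<le> ennreal (tt N * (8 * ((999/1000) ^ n * (4000 * w))))) sequentially"
    using budget_iterate[OF ok b, of n] by (intro Val_bump) auto
  from 1 2 show ?thesis
  proof eventually_elim
    case (elim N)
    have "Qt (tt N) ((Pop ^^ n) bump) (\<lambda>_. v) = Val (tt N) ((Pop ^^ n) bump) c" by (simp add: Val_def c_def)
    also have "\<dots> \<le> ennreal (tt N * (8 * ((999/1000) ^ n * (4000 * w)))) + ennreal (tt N) * ennreal (8000 / dl * (4000 * w)) + ennreal (tt N * w)"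
      using elim(2) sum_leaks[OF ok b, of n] by (intro order_trans[OF elim(1)] add_mono mult_left_mono) auto
    also have "\<dots> \<le> ennreal (tt N * (8 * (1 * (4000 * w)))) + ennreal (tt N) * ennreal (8000 / dl * (4000 * w)) + ennreal (tt N * w)"
      using w by (intro add_mono ennreal_leI mult_left_mono mult_right_mono power_le_one) auto
    also have "\<dots> = ennreal (tt N * (shift_const * w))"
      using w dl by (simp add: ennreal_mult'[symmetric] ennreal_plus[symmetric] shift_const_def algebra_simps del: ennreal_plus)
    finally show ?case unfolding w_def .
  qed
qed

definition "lower = {p :: real \<times> real. fst p \<le> 1 \<and> snd p \<le> 1}"

lemma lower_measurable [measurable]: "lower \<in> sets borel"
  unfolding lower_def by measurable

definition "dens n = (Pop ^^ n) bump"

lemma dens: "dens n \<in> borel_measurable borel" "0 \<le> dens n p" "p \<notin> square \<Longrightarrow> dens n p = 0"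
    "(\<integral>\<^sup>+p. ennreal (dens n p) \<partial>lborel) = mass"
  using carried_iterate[of n] mass_iterate[of n] unfolding dens_def carried_def nice_def by blast+

section \<open>The invariant measure\<close>

text \<open>The shift by v is composed of 2^N shifts by \<open>tt N\<close> times v. Since v points
  to the lower left, the set \<open>lower\<close> is mapped into itself by each of them, so the same
  estimate applies at every stage.\<close>

lemma shift_bound:
  assumes v: "fst v \<le> 0" "snd v \<le> 0"
  shows "(\<integral>\<^sup>+p. indicator lower p * ennreal \<bar>dens n (p + v) - dens n p\<bar> \<partial>lborel) \<le> ennreal (shift_const * (\<bar>fst v\<bar> + \<bar>snd v\<bar>))"
proof (cases "v = 0")
  case False
  note [measurable] = dens(1)[of n]
  obtain N where N: "Qt (tt N) (dens n) (\<lambda>_. v) \<le> ennreal (tt N * (shift_const * (\<bar>fst v\<bar> + \<bar>snd v\<bar>)))"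
    using eventually_happens'[OF _ Qt_iterate[OF False, of n]] unfolding dens_def by auto
  let ?t = "tt N"
  have low: "p + s *\<^sub>R v \<in> lower" if "p \<in> lower" "0 \<le> s" for p s
    using that v mult_nonneg_nonpos[of s "fst v"] mult_nonneg_nonpos[of s "snd v"]
    unfolding lower_def by auto
  have Q: "Qt ?t (dens n) (\<lambda>_. v) = (\<integral>\<^sup>+p. indicator lower p * ennreal \<bar>dens n (p + ?t *\<^sub>R v) - dens n p\<bar> \<partial>lborel)"
    unfolding Qt_def
  proof (rule nn_integral_cong)
    fix p
    show "indicator {p. fst p \<le> 1 \<and> snd p \<le> 1 \<and> fst (p + ?t *\<^sub>R v) \<le> 1 \<and> snd (p + ?t *\<^sub>R v) \<le> 1 \<and> v = v} p * ennreal \<bar>dens n (p + ?t *\<^sub>R v) - dens n p\<bar>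
      = indicator lower p * ennreal \<bar>dens n (p + ?t *\<^sub>R v) - dens n p\<bar>"
      using low[of p ?t] by (auto simp: indicator_def lower_def)
  qed
  have I: "(\<integral>\<^sup>+p. indicator lower p * ennreal \<bar>dens n (p + (real k * ?t) *\<^sub>R v) - dens n p\<bar> \<partial>lborel) \<le> of_nat k * Qt ?t (dens n) (\<lambda>_. v)" for k
  proof (induction k)
    case (Suc k)
    let ?x = "(real k * ?t) *\<^sub>R v"
    let ?F = "\<lambda>p. indicator lower p * ennreal \<bar>dens n (p + ?t *\<^sub>R v) - dens n p\<bar>"
    have "(\<integral>\<^sup>+p. indicator lower p * ennreal \<bar>dens n (p + (real (Suc k) * ?t) *\<^sub>R v) - dens n p\<bar> \<partial>lborel)
      \<le> (\<integral>\<^sup>+p. ?F (p + ?x) + indicator lower p * ennreal \<bar>dens n (p + ?x) - dens n p\<bar> \<partial>lborel)"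
    proof (rule nn_integral_mono)
      fix p
      have e: "p + (real (Suc k) * ?t) *\<^sub>R v = p + ?x + ?t *\<^sub>R v" by (simp add: algebra_simps)
      have "ennreal \<bar>dens n (p + ?x + ?t *\<^sub>R v) - dens n p\<bar> \<le> ennreal (\<bar>dens n (p + ?x + ?t *\<^sub>R v) - dens n (p + ?x)\<bar> + \<bar>dens n (p + ?x) - dens n p\<bar>)"
        by (rule ennreal_leI) linarith
      then show "indicator lower p * ennreal \<bar>dens n (p + (real (Suc k) * ?t) *\<^sub>R v) - dens n p\<bar>
        \<le> ?F (p + ?x) + indicator lower p * ennreal \<bar>dens n (p + ?x) - dens n p\<bar>"
        unfolding e using low[of p "real k * ?t"] by (auto simp: indicator_def)
    qed
    also have "\<dots> = (\<integral>\<^sup>+p. ?F (p + ?x) \<partial>lborel) + (\<integral>\<^sup>+p. indicator lower p * ennreal \<bar>dens n (p + ?x) - dens n p\<bar> \<partial>lborel)"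
      by (rule nn_integral_add) auto
    also have "(\<integral>\<^sup>+p. ?F (p + ?x) \<partial>lborel) = Qt ?t (dens n) (\<lambda>_. v)"
      unfolding Q by (rule nn_integral_translate) measurable
    also have "Qt ?t (dens n) (\<lambda>_. v) + (\<integral>\<^sup>+p. indicator lower p * ennreal \<bar>dens n (p + ?x) - dens n p\<bar> \<partial>lborel)
      \<le> Qt ?t (dens n) (\<lambda>_. v) + of_nat k * Qt ?t (dens n) (\<lambda>_. v)"
      by (rule add_left_mono[OF Suc.IH])
    also have "\<dots> = of_nat (Suc k) * Qt ?t (dens n) (\<lambda>_. v)" by (simp add: distrib_right)
    finally show ?case .
  qed simp
  have t1: "real (2 ^ N) * ?t = 1" by (simp add: tt_def power_one_over)
  have "(\<integral>\<^sup>+p. indicator lower p * ennreal \<bar>dens n (p + v) - dens n p\<bar> \<partial>lborel) \<le> of_nat (2 ^ N) * Qt ?t (dens n) (\<lambda>_. v)"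
    using I[of "2 ^ N"] unfolding t1 by simp
  also have "\<dots> \<le> ennreal (real (2 ^ N)) * ennreal (?t * (shift_const * (\<bar>fst v\<bar> + \<bar>snd v\<bar>)))"
    unfolding ennreal_of_nat_eq_real_of_nat[symmetric] by (rule mult_left_mono[OF N]) simp
  also have "\<dots> = ennreal (real (2 ^ N) * ?t * (shift_const * (\<bar>fst v\<bar> + \<bar>snd v\<bar>)))"
    by (subst ennreal_mult'[symmetric]) (simp_all add: mult.assoc)
  finally show ?thesis unfolding t1 by simp
qed simp

lemma KK_nonneg: "0 \<le> shift_const" by (simp add: shift_const_def dl_def)

text \<open>Average over the shifts w in a square of side r. Each shift changes the integral over A
  by at most the shift bound, and by Fubini the averaged term is the mass times the area of
  A.\<close>

lemma density_bound:
  assumes A [measurable]: "A \<in> sets borel" and As: "A \<subseteq> square" and r: "0 < r"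
  shows "ennreal (r * r) * (\<integral>\<^sup>+p. ennreal (dens n p) * indicator A p \<partial>lborel) \<le> emeasure lborel A + ennreal (r * r * (shift_const * (2 * r)))"
proof -
  note [measurable] = dens(1)[of n]
  define W where "W = {-r..0} \<times> {-r..0}"
  have Wm [measurable]: "W \<in> sets borel" unfolding W_def by (auto intro!: borel_closed closed_Times)
  have eW: "emeasure lborel W = ennreal (r * r)"
  proof -
    have "emeasure (lborel \<Otimes>\<^sub>M lborel) W = emeasure lborel {-r..0} * emeasure lborel {-r..0}"
      unfolding W_def by (rule lborel.emeasure_pair_measure_Times) auto
    then show ?thesis using r by (simp add: lborel_prod ennreal_mult'[symmetric])
  qed
  let ?J = "(\<integral>\<^sup>+p. ennreal (dens n p) * indicator A p \<partial>lborel)"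
  have pw: "?J \<le> (\<integral>\<^sup>+p. ennreal (dens n (p + w)) * indicator A p \<partial>lborel) + ennreal (shift_const * (2 * r))" if w: "w \<in> W" for w
  proof -
    have "?J \<le> (\<integral>\<^sup>+p. ennreal (dens n (p + w)) * indicator A p + indicator lower p * ennreal \<bar>dens n (p + w) - dens n p\<bar> \<partial>lborel)"
    proof (rule nn_integral_mono)
      fix p
      have "ennreal (dens n p) \<le> ennreal (dens n (p + w) + \<bar>dens n (p + w) - dens n p\<bar>)" by (rule ennreal_leI) linarith
      then show "ennreal (dens n p) * indicator A p \<le> ennreal (dens n (p + w)) * indicator A p + indicator lower p * ennreal \<bar>dens n (p + w) - dens n p\<bar>"
        using As dens(2) by (auto simp: indicator_def lower_def square_def)
    qed
    also have "\<dots> = (\<integral>\<^sup>+p. ennreal (dens n (p + w)) * indicator A p \<partial>lborel) + (\<integral>\<^sup>+p. indicator lower p * ennreal \<bar>dens n (p + w) - dens n p\<bar> \<partial>lborel)"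
      by (rule nn_integral_add) auto
    also have "(\<integral>\<^sup>+p. indicator lower p * ennreal \<bar>dens n (p + w) - dens n p\<bar> \<partial>lborel) \<le> ennreal (shift_const * (\<bar>fst w\<bar> + \<bar>snd w\<bar>))"
      using w by (intro shift_bound) (auto simp: W_def)
    also have "\<dots> \<le> ennreal (shift_const * (2 * r))" using w KK_nonneg by (intro ennreal_leI mult_left_mono) (auto simp: W_def)
    finally show ?thesis by (simp add: add_left_mono)
  qed
  have "ennreal (r * r) * ?J = (\<integral>\<^sup>+w. ?J * indicator W w \<partial>lborel)"
    by (subst nn_integral_cmult_indicator) (auto simp: eW mult.commute)
  also have "\<dots> \<le> (\<integral>\<^sup>+w. (\<integral>\<^sup>+p. ennreal (dens n (p + w)) * indicator A p \<partial>lborel) + ennreal (shift_const * (2 * r)) * indicator W w \<partial>lborel)"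
    by (rule nn_integral_mono) (use pw in \<open>auto simp: indicator_def\<close>)
  also have "\<dots> = (\<integral>\<^sup>+w. (\<integral>\<^sup>+p. ennreal (dens n (p + w)) * indicator A p \<partial>lborel) \<partial>lborel) + (\<integral>\<^sup>+w. ennreal (shift_const * (2 * r)) * indicator W w \<partial>lborel)"
    by (rule nn_integral_add) auto
  also have "(\<integral>\<^sup>+w. ennreal (shift_const * (2 * r)) * indicator W w \<partial>lborel) = ennreal (r * r * (shift_const * (2 * r)))"
    using KK_nonneg r by (subst nn_integral_cmult_indicator) (auto simp: eW ennreal_mult'[symmetric] mult_ac)
  also have "(\<integral>\<^sup>+w. (\<integral>\<^sup>+p. ennreal (dens n (p + w)) * indicator A p \<partial>lborel) \<partial>lborel)
    = (\<integral>\<^sup>+p. (\<integral>\<^sup>+w. ennreal (dens n (p + w)) * indicator A p \<partial>lborel) \<partial>lborel)"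
    by (rule lborel_pair.Fubini') measurable
  also have "\<dots> = (\<integral>\<^sup>+p. mass * indicator A p \<partial>lborel)"
  proof (rule nn_integral_cong)
    fix p
    have "(\<integral>\<^sup>+w. ennreal (dens n (p + w)) * indicator A p \<partial>lborel) = (\<integral>\<^sup>+w. ennreal (dens n (w + p)) \<partial>lborel) * indicator A p"
      by (subst nn_integral_multc[symmetric]) (auto simp: add.commute)
    also have "(\<integral>\<^sup>+w. ennreal (dens n (w + p)) \<partial>lborel) = mass"
      unfolding dens(4)[of n, symmetric] by (rule nn_integral_translate) measurable
    finally show "(\<integral>\<^sup>+w. ennreal (dens n (p + w)) * indicator A p \<partial>lborel) = mass * indicator A p" .
  qed
  also have "\<dots> = mass * emeasure lborel A" by (simp add: nn_integral_cmult_indicator)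
  also have "\<dots> \<le> 1 * emeasure lborel A" by (rule mult_right_mono[OF mass_le]) simp
  finally show ?thesis by (simp add: add_right_mono)
qed

lemma mass_pos: "0 < mass"
proof -
  define U where "U = {7/16..9/16::real} \<times> {7/16..9/16::real}"
  have "emeasure (lborel \<Otimes>\<^sub>M lborel) U = emeasure lborel {7/16..9/16::real} * emeasure lborel {7/16..9/16::real}"
    unfolding U_def by (rule lborel.emeasure_pair_measure_Times) auto
  then have U: "emeasure lborel U = ennreal (1/64)" by (simp add: lborel_prod ennreal_mult'[symmetric])
  have [measurable]: "U \<in> sets borel" unfolding U_def by (intro borel_closed closed_Times) auto
  have "0 < ennreal (1/2) * emeasure lborel U" unfolding U by (subst ennreal_mult'[symmetric]) simp_all
  also have "\<dots> = (\<integral>\<^sup>+p. ennreal (1/2) * indicator U p \<partial>lborel)" by (simp add: nn_integral_cmult_indicator)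
  also have "\<dots> \<le> mass"
    unfolding mass_def
  proof (rule nn_integral_mono)
    fix p
    have "1/2 \<le> bump p" if "p \<in> U"
    proof -
      have "7/16 \<le> fst p" "fst p \<le> 9/16" "7/16 \<le> snd p" "snd p \<le> 9/16" using that by (auto simp: U_def)
      then have "\<bar>fst p - 1/2\<bar> \<le> 1/16" "\<bar>snd p - 1/2\<bar> \<le> 1/16" unfolding abs_le_iff by linarith+
      then show ?thesis by (simp add: bump_def)
    qed
    then show "ennreal (1/2) * indicator U p \<le> ennreal (bump p)" by (auto simp: indicator_def intro!: ennreal_leI simp del: ennreal_half)
  qed
  finally show ?thesis .
qed

definition "pushed n A = measure (density lborel (\<lambda>p. ennreal (dens n p))) A"

lemma emeasure_pushed:
  assumes [measurable]: "A \<in> sets borel"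
  shows "ennreal (pushed n A) = (\<integral>\<^sup>+p. ennreal (dens n p) * indicator A p \<partial>lborel)"
proof -
  note [measurable] = dens(1)[of n]
  have e: "emeasure (density lborel (\<lambda>p. ennreal (dens n p))) A = (\<integral>\<^sup>+p. ennreal (dens n p) * indicator A p \<partial>lborel)"
    by (rule emeasure_density) auto
  also have "\<dots> \<le> (\<integral>\<^sup>+p. ennreal (dens n p) \<partial>lborel)" by (rule nn_integral_mono) (auto simp: indicator_def)
  also have "\<dots> \<le> 1" using dens(4) mass_le by simp
  finally have "emeasure (density lborel (\<lambda>p. ennreal (dens n p))) A \<noteq> \<infinity>" by (auto simp: top_unique)
  then show ?thesis unfolding pushed_def e[symmetric] by (intro emeasure_eq_ennreal_measure[symmetric]) auto
qed

lemma pushed_finite: "finite_measure (density lborel (\<lambda>p. ennreal (dens n p)))"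
proof
  note [measurable] = dens(1)[of n]
  have "emeasure (density lborel (\<lambda>p. ennreal (dens n p))) UNIV = mass"
    by (subst emeasure_density) (auto simp: dens(4))
  then show "emeasure (density lborel (\<lambda>p. ennreal (dens n p))) (space (density lborel (\<lambda>p. ennreal (dens n p)))) \<noteq> \<infinity>"
    using mass_le by (auto simp: top_unique)
qed

lemma pushed_bounds: "0 \<le> pushed n A" "pushed n A \<le> 1"
proof -
  show "0 \<le> pushed n A" by (simp add: pushed_def)
  have "pushed n A \<le> pushed n UNIV"
    unfolding pushed_def using finite_measure.bounded_measure[OF pushed_finite] by simp
  moreover have "ennreal (pushed n UNIV) \<le> 1" using emeasure_pushed[of UNIV n] dens(4)[of n] mass_le by simp
  then have "pushed n UNIV \<le> 1" by simp
  ultimately show "pushed n A \<le> 1" by simp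
qed

lemma pushed_Un: "A \<in> sets borel \<Longrightarrow> B \<in> sets borel \<Longrightarrow> A \<inter> B = {} \<Longrightarrow> pushed n (A \<union> B) = pushed n A + pushed n B"
  unfolding pushed_def by (rule finite_measure.finite_measure_Union[OF pushed_finite]) auto

lemma pushed_Gm: assumes [measurable]: "A \<in> sets borel" shows "pushed n (Gm -` A) = pushed (Suc n) A"
proof -
  have [measurable]: "Gm -` A \<in> sets borel" using measurable_sets[OF Gm_measurable assms] by simp
  have "ennreal (pushed (Suc n) A) = (\<integral>\<^sup>+p. ennreal (Pop (dens n) p) * indicator A p \<partial>lborel)"
    by (subst emeasure_pushed) (auto simp: dens_def)
  also have "\<dots> = (\<integral>\<^sup>+p. ennreal (dens n p) * indicator A (Gm p) \<partial>lborel)"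
    by (rule push) (auto simp: dens)
  also have "\<dots> = (\<integral>\<^sup>+p. ennreal (dens n p) * indicator (Gm -` A) p \<partial>lborel)"
    by (rule nn_integral_cong) (simp add: indicator_def)
  also have "\<dots> = ennreal (pushed n (Gm -` A))" by (subst emeasure_pushed) auto
  finally show ?thesis by (simp add: pushed_bounds)
qed

lemma pushed_square: "pushed n (- square) = 0" "pushed n square = enn2real mass"
proof -
  have "ennreal (pushed n (- square)) = 0"
  proof -
    have z: "ennreal (dens n p) * indicator (- square) p = 0" for p using dens(3)[of p n] by (auto simp: indicator_def)
    have "- square \<in> sets borel" by measurable
    from emeasure_pushed[OF this, of n] show ?thesis by (simp only: z nn_integral_const mult_zero_left)
  qed
  then show "pushed n (- square) = 0" by (simp add: pushed_bounds)
  have "ennreal (pushed n square) = (\<integral>\<^sup>+p. ennreal (dens n p) \<partial>lborel)"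
    using dens(3)[of _ n] by (subst emeasure_pushed) (auto simp: indicator_def intro!: nn_integral_cong)
  then show "pushed n square = enn2real mass" using pushed_bounds(1)[of n square] dens(4)[of n] by (metis enn2real_ennreal)
qed

lemma pushed_small:
  assumes A: "A \<in> sets borel" "A \<subseteq> square" and r: "0 < r"
  shows "pushed n A \<le> measure lborel A / (r * r) + shift_const * (2 * r)"
proof -
  have fin: "emeasure lborel A \<noteq> \<infinity>"
    using emeasure_mono[OF A(2), of lborel] by (auto simp: emeasure_square top_unique)
  have "ennreal (r * r * pushed n A) \<le> ennreal (measure lborel A + r * r * (shift_const * (2 * r)))"
    using density_bound[OF A r, of n] emeasure_pushed[OF A(1), of n] fin r KK_nonneg
    by (simp add: ennreal_mult' emeasure_eq_ennreal_measure ennreal_plus)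
  then have "r * r * pushed n A \<le> measure lborel A + r * r * (shift_const * (2 * r))"
    using r KK_nonneg by (subst (asm) ennreal_le_iff) auto
  then have "pushed n A \<le> (measure lborel A + r * r * (shift_const * (2 * r))) / (r * r)"
    using r by (simp add: pos_le_divide_eq mult.commute)
  also have "\<dots> = measure lborel A / (r * r) + shift_const * (2 * r)" using r by (simp add: field_simps)
  finally show ?thesis .
qed

end

section \<open>Cluster points of the Cesaro means\<close>

text \<open>The cube is compact by Tychonoff, but for an uncountable index set there need be no
  convergent subsequence. A filter finer than \<open>sequentially\<close>, pulled back from a
  cluster point, takes its place.\<close>

lemma cluster_point:
  fixes c :: "nat \<Rightarrow> 'i \<Rightarrow> real"
  assumes "\<And>n i. 0 \<le> c n i" "\<And>n i. c n i \<le> 1"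
  obtains F L where "F \<noteq> bot" "F \<le> sequentially" "\<And>i. ((\<lambda>n. c n i) \<longlongrightarrow> L i) F"
proof -
  define K where "K = PiE UNIV (\<lambda>_::'i. {0..1::real})"
  have "compactin (product_topology (\<lambda>_. euclidean) UNIV) K"
    unfolding K_def compactin_PiE by simp
  then have K: "compact K" unfolding euclidean_product_topology by simp
  have "c n \<in> K" for n using assms by (auto simp: K_def)
  then have "eventually (\<lambda>g. g \<in> K) (filtermap c sequentially)" by (simp add: eventually_filtermap)
  moreover have "filtermap c sequentially \<noteq> bot" by (simp add: filtermap_bot_iff)
  ultimately obtain L where L: "inf (nhds L) (filtermap c sequentially) \<noteq> bot"
    using K unfolding compact_filter by blast
  define F where "F = inf (filtercomap c (nhds L)) sequentially"
  have "F \<noteq> bot"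
  proof
    assume "F = bot"
    then have "eventually (\<lambda>_. False) F" by simp
    then obtain P Q where PQ: "eventually P (filtercomap c (nhds L))" "eventually Q sequentially" "\<And>n. P n \<Longrightarrow> Q n \<Longrightarrow> False"
      unfolding F_def eventually_inf by blast
    then obtain P' where P': "eventually P' (nhds L)" "\<And>n. P' (c n) \<Longrightarrow> P n" unfolding eventually_filtercomap by blast
    have "eventually (\<lambda>g. \<not> P' g) (filtermap c sequentially)"
      unfolding eventually_filtermap by (rule eventually_mono[OF PQ(2)]) (use PQ(3) P'(2) in blast)
    then have "eventually (\<lambda>_. False) (inf (nhds L) (filtermap c sequentially))"
      using P'(1) unfolding eventually_inf by blast
    then show False using L by (simp add: eventually_False)
  qed
  moreover have "F \<le> sequentially" by (simp add: F_def)
  moreover have "((\<lambda>n. c n i) \<longlongrightarrow> L i) F" for i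
  proof -
    have "((\<lambda>g. g i) \<longlongrightarrow> L i) (nhds L)"
    proof (rule topological_tendstoI)
      fix S :: "real set" assume "open S" "L i \<in> S"
      then have "open ((\<lambda>g. g i) -` S)" "L \<in> (\<lambda>g. g i) -` S"
        by (auto intro!: open_vimage)
      then show "eventually (\<lambda>g. g i \<in> S) (nhds L)" unfolding eventually_nhds by (intro exI[of _ "(\<lambda>g. g i) -` S"]) auto
    qed
    moreover have "filterlim c (nhds L) F"
      unfolding F_def by (rule filterlim_mono[OF filterlim_filtercomap]) auto
    ultimately show ?thesis by (rule filterlim_compose)
  qed
  ultimately show thesis by (rule that)
qed

context memory_range
begin

text \<open>N + 1 terms are averaged, so the denominator is never zero.\<close>

definition "cesaro N A = (\<Sum>n<Suc N. pushed n A) / real (Suc N)"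

lemma cesaro_bounds: "0 \<le> cesaro N A" "cesaro N A \<le> 1"
proof -
  show "0 \<le> cesaro N A" unfolding cesaro_def by (intro divide_nonneg_nonneg sum_nonneg pushed_bounds) auto
  have "(\<Sum>n<Suc N. pushed n A) \<le> (\<Sum>n<Suc N. 1)" by (intro sum_mono pushed_bounds)
  then show "cesaro N A \<le> 1" unfolding cesaro_def by (simp add: divide_le_eq_1)
qed

lemma cesaro_invariant:
  assumes "A \<in> sets borel"
  shows "(\<lambda>N. cesaro N (Gm -` A) - cesaro N A) \<longlonglongrightarrow> 0"
proof (rule tendsto_rabs_zero_cancel, rule tendsto_sandwich[OF _ _ tendsto_const])
  show "\<forall>\<^sub>F N in sequentially. 0 \<le> \<bar>cesaro N (Gm -` A) - cesaro N A\<bar>" by simp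
  show "\<forall>\<^sub>F N in sequentially. \<bar>cesaro N (Gm -` A) - cesaro N A\<bar> \<le> inverse (real (Suc N))"
  proof (rule always_eventually, rule allI)
    fix N
    have "(\<Sum>n<Suc N. pushed n (Gm -` A)) - (\<Sum>n<Suc N. pushed n A) = (\<Sum>n<Suc N. pushed (Suc n) A - pushed n A)"
      by (simp only: pushed_Gm[OF assms] sum_subtractf)
    also have "\<dots> = pushed (Suc N) A - pushed 0 A" by (rule sum_lessThan_telescope)
    finally have d: "cesaro N (Gm -` A) - cesaro N A = (pushed (Suc N) A - pushed 0 A) / real (Suc N)"
      unfolding cesaro_def by (simp only: diff_divide_distrib[symmetric])
    have "\<bar>pushed (Suc N) A - pushed 0 A\<bar> \<le> 1"
      using pushed_bounds[of "Suc N" A] pushed_bounds[of 0 A] by linarith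
    then show "\<bar>cesaro N (Gm -` A) - cesaro N A\<bar> \<le> inverse (real (Suc N))"
      unfolding d by (simp add: abs_divide divide_simps)
  qed
  show "(\<lambda>N. inverse (real (Suc N))) \<longlonglongrightarrow> 0" by (rule LIMSEQ_inverse_real_of_nat)
qed

lemma cesaro_Un: "A \<in> sets borel \<Longrightarrow> B \<in> sets borel \<Longrightarrow> A \<inter> B = {} \<Longrightarrow> cesaro N (A \<union> B) = cesaro N A + cesaro N B"
  by (simp add: cesaro_def pushed_Un sum.distrib add_divide_distrib)

lemma cesaro_le:
  assumes "\<And>n. pushed n A \<le> B" shows "cesaro N A \<le> B"
proof -
  have "(\<Sum>n<Suc N. pushed n A) \<le> (\<Sum>n<Suc N. B)" by (intro sum_mono assms)
  then show ?thesis unfolding cesaro_def by (simp add: pos_divide_le_eq mult.commute)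
qed

lemma cesaro_square: "cesaro N (- square) = 0" "cesaro N square = enn2real mass"
  by (simp_all add: cesaro_def pushed_square)

text \<open>Finite additivity, invariance and the bound by area pass to limits along the filter.
  Countable additivity does not pass by itself and is recovered later from the bound by
  area.\<close>

lemma invariant_charge:
  obtains L :: "(real \<times> real) set \<Rightarrow> real" where
    "\<And>A. 0 \<le> L A"
    "\<And>A B. A \<in> sets borel \<Longrightarrow> B \<in> sets borel \<Longrightarrow> A \<inter> B = {} \<Longrightarrow> L (A \<union> B) = L A + L B"
    "\<And>A. A \<in> sets borel \<Longrightarrow> L (Gm -` A) = L A"
    "\<And>A r. A \<in> sets borel \<Longrightarrow> A \<subseteq> square \<Longrightarrow> 0 < r \<Longrightarrow> L A \<le> measure lborel A / (r * r) + shift_const * (2 * r)"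
    "L (- square) = 0" "L square = enn2real mass"
proof -
  obtain F L where F: "F \<noteq> bot" "F \<le> sequentially" and L: "\<And>A. ((\<lambda>N. cesaro N A) \<longlongrightarrow> L A) F"
  proof (rule cluster_point[of cesaro, OF cesaro_bounds])
    fix F L assume "F \<noteq> bot" "F \<le> sequentially" "\<And>A. ((\<lambda>N. cesaro N A) \<longlongrightarrow> L A) F"
    then show thesis by (rule that)
  qed
  show thesis
  proof (rule that[of L])
    show "0 \<le> L A" for A by (rule tendsto_lowerbound[OF L _ F(1)]) (simp add: cesaro_bounds)
    show "L (A \<union> B) = L A + L B" if "A \<in> sets borel" "B \<in> sets borel" "A \<inter> B = {}" for A B
      using tendsto_unique[OF F(1) L[of "A \<union> B"]] tendsto_add[OF L[of A] L[of B]] that by (simp add: cesaro_Un)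
    show "L (Gm -` A) = L A" if "A \<in> sets borel" for A
    proof -
      have "((\<lambda>N. cesaro N (Gm -` A) - cesaro N A) \<longlongrightarrow> 0) F"
        by (rule tendsto_mono[OF F(2) cesaro_invariant[OF that]])
      from tendsto_unique[OF F(1) this tendsto_diff[OF L L]] show ?thesis by simp
    qed
    show "L A \<le> measure lborel A / (r * r) + shift_const * (2 * r)" if "A \<in> sets borel" "A \<subseteq> square" "0 < r" for A r
      by (rule tendsto_upperbound[OF L _ F(1)]) (simp add: cesaro_le[OF pushed_small[OF that]])
    show "L (- square) = 0"
      by (rule tendsto_unique[OF F(1) L]) (simp add: cesaro_square)
    show "L square = enn2real mass"
      by (rule tendsto_unique[OF F(1) L]) (simp add: cesaro_square)
  qed
qed

text \<open>The bound by area reduces to this hypothesis on null sets; letting r tend to 0 yields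
  absolute continuity.\<close>

lemma small_value:
  assumes x: "\<And>r. 0 < r \<Longrightarrow> x \<le> shift_const * (2 * r)" shows "x \<le> (0::real)"
proof (rule field_le_epsilon)
  fix e :: real assume e: "0 < e"
  have "x \<le> shift_const * (2 * (e / (2 * shift_const + 2)))" using e KK_nonneg by (intro x) (auto intro: divide_pos_pos)
  also have "\<dots> \<le> e" using e KK_nonneg by (simp add: divide_simps)
  finally show "x \<le> 0 + e" by simp
qed

lemma sets_leb_square: "sets leb_square = {A \<in> sets borel. A \<subseteq> square}" and space_leb_square: "space leb_square = square"
proof -
  have u: "unit_square = square" by (simp add: unit_square_def square_def)
  show "sets leb_square = {A \<in> sets borel. A \<subseteq> square}"
    unfolding leb_square_def u using sets_restrict_space_iff[of square lborel] by auto
  show "space leb_square = square" unfolding leb_square_def u by (simp add: space_restrict_space)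
qed

lemma emeasure_leb_square: "A \<in> sets borel \<Longrightarrow> A \<subseteq> square \<Longrightarrow> emeasure leb_square A = emeasure lborel A"
  unfolding leb_square_def by (subst emeasure_restrict_space) (auto simp: unit_square_def square_def[symmetric])

theorem acip_exists: "has_acip (G a)"
proof -
  obtain L where L0: "\<And>A. 0 \<le> L A"
    and Ladd: "\<And>A B. A \<in> sets borel \<Longrightarrow> B \<in> sets borel \<Longrightarrow> A \<inter> B = {} \<Longrightarrow> L (A \<union> B) = L A + L B"
    and inv: "\<And>A. A \<in> sets borel \<Longrightarrow> L (Gm -` A) = L A"
    and small: "\<And>A r. A \<in> sets borel \<Longrightarrow> A \<subseteq> square \<Longrightarrow> 0 < r \<Longrightarrow> L A \<le> measure lborel A / (r * r) + shift_const * (2 * r)"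
    and sq: "L (- square) = 0" "L square = enn2real mass"
    by (rule invariant_charge) blast
  define m where "m = enn2real mass"
  have m: "0 < m" unfolding m_def using mass_pos mass_le by (auto simp: enn2real_positive_iff top_unique less_top[symmetric])
  define \<mu> where "\<mu> A = ennreal (L A / m)" for A
  let ?S = "sets leb_square"
  have sig: "sigma_algebra square ?S" unfolding space_leb_square[symmetric] by (rule sets.sigma_algebra_axioms)
  interpret sigma_algebra square ?S by (rule sig)
  have L_empty: "L {} = 0" using Ladd[OF sets.empty_sets sets.empty_sets Int_empty_left] by simp
  have pos: "positive ?S \<mu>" by (simp add: positive_def \<mu>_def L_empty)
  have add: "additive ?S \<mu>"
    unfolding additive_def
    by (auto simp: \<mu>_def sets_leb_square Ladd add_divide_distrib L0 less_imp_le[OF m] intro!: ennreal_plus)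
  have fin_sq: "emeasure lborel A \<noteq> \<infinity>" if "A \<subseteq> square" for A
    using emeasure_mono[OF that, of lborel] by (auto simp: emeasure_square top_unique)
  have cadd: "countably_additive ?S \<mu>"
  proof (rule empty_continuous_imp_countably_additive[OF pos add])
    show "\<forall>A\<in>?S. \<mu> A \<noteq> \<infinity>" by (simp add: \<mu>_def)
    fix A :: "nat \<Rightarrow> (real \<times> real) set" assume A: "range A \<subseteq> ?S" "decseq A" "(\<Inter>i. A i) = {}"
    have Ai: "A i \<in> sets borel" "A i \<subseteq> square" for i using A(1) by (auto simp: sets_leb_square)
    have "(\<lambda>i. emeasure lborel (A i)) \<longlonglongrightarrow> emeasure lborel (\<Inter>i. A i)"
      by (rule Lim_emeasure_decseq) (use Ai A fin_sq in auto)
    then have lim0: "(\<lambda>i. measure lborel (A i)) \<longlonglongrightarrow> 0"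
      unfolding A(3) measure_def by (intro tendsto_enn2real) simp_all
    have "(\<lambda>i. L (A i)) \<longlonglongrightarrow> 0"
    proof (rule decreasing_tendsto)
      show "\<forall>\<^sub>F i in sequentially. 0 \<le> L (A i)" by (simp add: L0)
      fix x :: real assume x: "0 < x"
      \<comment> \<open>First r is chosen so that the shift term is at most x / 2; then the area of
        \<open>A i\<close> makes the other term small.\<close>
      define r where "r = x / (4 * shift_const + 4)"
      have r: "0 < r" "shift_const * (2 * r) \<le> x / 2" using x KK_nonneg by (auto simp: r_def divide_simps)
      have "(\<lambda>i. measure lborel (A i) / (r * r)) \<longlonglongrightarrow> 0" using tendsto_divide_zero[OF lim0] .
      from order_tendstoD(2)[OF this, of "x / 2"] x
      have "\<forall>\<^sub>F i in sequentially. measure lborel (A i) / (r * r) < x / 2" by simp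
      then show "\<forall>\<^sub>F i in sequentially. L (A i) < x"
      proof eventually_elim
        case (elim i)
        then show ?case using small[OF Ai r(1), of i] r(2) by linarith
      qed
    qed
    then have "(\<lambda>i. L (A i) / m) \<longlonglongrightarrow> 0" by (rule tendsto_divide_zero)
    then show "(\<lambda>i. \<mu> (A i)) \<longlonglongrightarrow> 0" unfolding \<mu>_def using tendsto_ennrealI by fastforce
  qed
  define M where "M = measure_of square ?S \<mu>"
  have sM: "sets M = ?S" "space M = square" unfolding M_def by (simp_all add: sets_measure_of_eq space_measure_of_eq)
  have eM: "emeasure M A = \<mu> A" if "A \<in> ?S" for A
    unfolding M_def by (rule emeasure_measure_of_sigma[OF sig pos cadd that])
  have sqS: "square \<in> ?S" by (simp add: sets_leb_square square_measurable)
  have GG: "G a = Gm" by (rule ext) (rule G_eq)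
  have Gsq: "Gm p \<in> square" if "p \<in> square" for p using A_square[OF that] by (auto simp: Gm_def)
  have vim: "Gm -` A \<inter> square \<in> ?S" if "A \<in> ?S" for A
    using measurable_sets[OF Gm_measurable, of A] that by (auto simp: sets_leb_square square_measurable)
  have "prob_space M"
  proof
    show "emeasure M (space M) = 1" unfolding sM eM[OF sqS] using m by (simp add: \<mu>_def sq m_def)
  qed
  moreover have "absolutely_continuous leb_square M"
    unfolding absolutely_continuous_def
  proof
    fix A assume "A \<in> null_sets leb_square"
    then have A: "A \<in> ?S" "A \<in> sets borel" "A \<subseteq> square" "emeasure lborel A = 0"
      by (auto simp: null_sets_def sets_leb_square emeasure_leb_square)
    have "L A \<le> 0"
      by (rule small_value) (use small[OF A(2,3)] A(4) in \<open>simp add: measure_def\<close>)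
    then have "L A = 0" using L0[of A] by simp
    then show "A \<in> null_sets M" using A(1) by (simp add: null_sets_def sM eM \<mu>_def)
  qed
  moreover have "G a \<in> measurable M M"
    unfolding GG measurable_def sM using Gsq vim by auto
  moreover have "emeasure M (G a -` A \<inter> space M) = emeasure M A" if "A \<in> sets M" for A
  proof -
    have A: "A \<in> ?S" "A \<in> sets borel" using that by (auto simp: sM sets_leb_square)
    have v: "Gm -` A \<in> sets borel" using measurable_sets[OF Gm_measurable A(2)] by simp
    \<comment> \<open>\<open>L\<close> lives on the whole plane; the complement of the square has
      value 0, so the part of the preimage outside the square can be discarded.\<close>
    have "L (- square \<inter> Gm -` A) + L (- square \<inter> - (Gm -` A)) = 0"
      using Ladd[of "- square \<inter> Gm -` A" "- square \<inter> - (Gm -` A)"] v square_measurable sq(1)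
      by (simp add: Int_Un_distrib[symmetric])
    then have z: "L (- square \<inter> Gm -` A) = 0" using L0[of "- square \<inter> Gm -` A"] L0[of "- square \<inter> - (Gm -` A)"] by linarith
    have "(Gm -` A \<inter> square) \<union> (- square \<inter> Gm -` A) = Gm -` A" by auto
    then have "L (Gm -` A) = L (Gm -` A \<inter> square) + L (- square \<inter> Gm -` A)"
      using Ladd[of "Gm -` A \<inter> square" "- square \<inter> Gm -` A"] v square_measurable by auto
    then show ?thesis unfolding GG sM eM[OF vim[OF A(1)]] eM[OF A(1)] using z inv[OF A(2)] by (simp add: \<mu>_def)
  qed
  ultimately show ?thesis unfolding has_acip_def using sM by blast
qed

end

section \<open>Localising the roots that bound the parameter\<close>

text \<open>The polynomial is negative at 0.2476 and increasing on [0, 0.2476]; monotonicity is read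
  off from the difference after splitting off the factor y - x.\<close>

lemma lower_root:
  fixes x :: real
  assumes x: "0 \<le> x" and root: "16*x^4 + 16*x^3 - 52*x^2 + 48*x - 9 = 0"
  shows "2476/10000 \<le> x"
proof (rule ccontr)
  assume n: "\<not> 2476/10000 \<le> x"
  let ?y = "2476/10000 :: real"
  have "(16*?y^4 + 16*?y^3 - 52*?y^2 + 48*?y - 9) - (16*x^4 + 16*x^3 - 52*x^2 + 48*x - 9)
    = (?y - x) * (16 * (?y^3 + ?y^2*x + ?y*x^2 + x^3) + 16 * (?y^2 + ?y*x + x^2) + (48 - 52 * (?y + x)))"
    by (simp add: field_simps power4_eq_xxxx power3_eq_cube power2_eq_square)
  also have "\<dots> \<ge> 0" using x n by (intro mult_nonneg_nonneg add_nonneg_nonneg) auto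
  finally show False unfolding root by (simp add: power4_eq_xxxx power3_eq_cube power2_eq_square)
qed

text \<open>The left side exceeds 1/2 at 0.27978 and increases up to 0.3. Beyond 0.3 it is 8 y^2
  (y^2 - y + 1), at least 8 * 0.09 * 0.75 = 0.54.\<close>

lemma upper_root:
  fixes y :: real
  assumes y: "y \<le> 1" and root: "8*y^4 - 8*y^3 + 8*y^2 = 1/2"
  shows "y \<le> 27978/100000"
proof (rule ccontr)
  assume n: "\<not> y \<le> 27978/100000"
  let ?x = "27978/100000 :: real"
  show False
  proof (cases "y \<le> 3/10")
    case True
    have "(8*y^4 - 8*y^3 + 8*y^2) - (8*?x^4 - 8*?x^3 + 8*?x^2)
      = (y - ?x) * (8 * (y^3 + y^2*?x + y*?x^2 + ?x^3) + 8 * (y * (1 - ?x - y) + ?x * (1 - ?x)))"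
      by (simp add: field_simps power4_eq_xxxx power3_eq_cube power2_eq_square)
    also have "\<dots> \<ge> 0" using n True by (intro mult_nonneg_nonneg add_nonneg_nonneg) auto
    finally show False unfolding root by (simp add: power4_eq_xxxx power3_eq_cube power2_eq_square)
  next
    case False
    have "0 \<le> (y - 1/2)^2" by simp
    then have "3/4 \<le> y^2 - y + 1" by (simp add: power2_eq_square algebra_simps)
    moreover have "(3/10)^2 \<le> y^2" using False by (intro power_mono) auto
    ultimately have "(3/10)^2 * (3/4) \<le> y^2 * (y^2 - y + 1)" by (intro mult_mono) auto
    also have "\<dots> = (8*y^4 - 8*y^3 + 8*y^2) / 8" by (simp add: field_simps power4_eq_xxxx power3_eq_cube power2_eq_square)
    finally show False unfolding root by (simp add: power2_eq_square)
  qed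
qed

theorem theorem2:
  fixes \<alpha>1 \<alpha>2 \<alpha> :: real
  assumes "\<alpha>1 \<in> {0..1}" and "16*\<alpha>1^4 + 16*\<alpha>1^3 - 52*\<alpha>1^2 + 48*\<alpha>1 - 9 = 0"
      and "\<alpha>2 \<in> {0..1}" and "8*\<alpha>2^4 - 8*\<alpha>2^3 + 8*\<alpha>2^2 = 1/2"
      and "\<alpha> \<in> {\<alpha>1..\<alpha>2}"
  shows "has_acip (G \<alpha>)"
proof -
  have "2476/10000 \<le> \<alpha>" "\<alpha> \<le> 27978/100000"
    using lower_root[of \<alpha>1] upper_root[of \<alpha>2] assms by auto
  then interpret memory_range \<alpha> by unfold_locales auto
  show ?thesis by (rule acip_exists)
qed

end
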